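(* The algebra $H(m,1,n)$ is semi-simple, $\dim_K H(m,1,n)=n!\,m^n$, and every irreducible representation of $H(m,1,n)$ is isomorphic to $V_{\lambda^{(m)}}$ for some $m$-partition $\lambda^{(m)}$ of $n$.
   Context: Parameters. Let $m,n\ge 1$. Either $K=\mathbb{C}(q,v_1,\dots,v_m)$ with $q,v_1,\dots,v_m$ indeterminates, or $K=\mathbb{C}$ and $q,v_1,\dots,v_m\in\mathbb{C}$, $q\neq0$, satisfy: $1+q^2+\dots+q^{2N}\neq0$ for all non-negative integers $N<n$; $q^{2i}v_j-v_k\neq0$ for all $i,j,k$ with $j\neq k$ and $-n<i<n$; $v_j\neq0$ for all $j=1,\dots,m$. Cyclotomic Hecke algebra. $H(m,1,n)$ is the associative unital $K$-algebra generated by $\tau,\sigma_1,\dots,\sigma_{n-1}$ with defining relations $\sigma_i\sigma_{i+1}\sigma_i=\sigma_{i+1}\sigma_i\sigma_{i+1}$; $\sigma_i\sigma_j=\sigma_j\sigma_i$ if $|i-j|>1$; $\tau\sigma_1\tau\sigma_1=\sigma_1\tau\sigma_1\tau$; $\tau\sigma_i=\sigma_i\tau$ for $i>1$; $\sigma_i^2=(q-q^{-1})\sigma_i+1$; $(\tau-v_1)\cdots(\tau-v_m)=0$. Tableaux. An $m$-partition of $n$ is an $m$-tuple $\lambda^{(m)}=(\lambda_1,\dots,\lambda_m)$ of partitions (Young diagrams) with $|\lambda_1|+\dots+|\lambda_m|=n$. Its $m$-nodes are the nodes of the diagrams together with the index $k$ of the diagram. The content of the $m$-node in row $r$ and column $s$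 of the $k$-th diagram is $v_kq^{2(s-r)}$. A standard $m$-tableau of shape $\lambda^{(m)}$ is a bijective filling of the $m$-nodes with $1,\dots,n$ such that in every diagram the numbers increase along rows (to the right) and columns (downwards). $c(X_{\lambda^{(m)}}|i)$ is the content of the $m$-node carrying $i$ in $X_{\lambda^{(m)}}$. $X_{\lambda^{(m)}}^{s_i}$ is obtained by exchanging $i$ and $i+1$. Representations $V_{\lambda^{(m)}}$. $V_{\lambda^{(m)}}$ is the $H(m,1,n)$-module with $K$-basis $\{\mathcal{X}_{\lambda^{(m)}}\}$ indexed by the standard $m$-tableaux $X_{\lambda^{(m)}}$ of shape $\lambda^{(m)}$, and action (with $c^{(i)}:=c(X_{\lambda^{(m)}}|i)$) $$\tau(\mathcal{X}_{\lambda^{(m)}})=c^{(1)}\mathcal{X}_{\lambda^{(m)}},\qquad \sigma_i(\mathcal{X}_{\lambda^{(m)}})=\frac{(q-q^{-1})c^{(i+1)}}{c^{(i+1)}-c^{(i)}}\mathcal{X}_{\lambda^{(m)}}+\frac{qc^{(i+1)}-q^{-1}c^{(i)}}{c^{(i+1)}-c^{(i)}}\mathcal{X}_{\lambda^{(m)}}^{s_i},$$ where $\mathcal{X}_{\lambda^{(m)}}^{s_i}$ is the basis vector of $X_{\lambda^{(m)}}^{s_i}$ if this $m$-tableau is standard and $0$ otherwise.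
   Formalization: For K = C and q = ±1 (allowed by the conditions) the printed coefficients of σ_i are 0/0 when i and i+1 lie in the same diagram; there they are replaced by their limits q/d and 1/q + q/d, with d the difference of (column − row) between i+1 and i. *)

theory Defs
  imports
    Complex_Main
    "HOL-Library.Poly_Mapping"
    "HOL-Library.FuncSet"
    "HOL-Combinatorics.Transposition"
    "HOL-Computational_Algebra.Fraction_Field"
    "HOL-Algebra.QuotRing"
    "HOL-Algebra.Module"
    "HOL-Algebra.Embedded_Algebras"
begin

section \<open>Modules over possibly non-commutative rings\<close>

text \<open>The library locale \<^locale>\<open>module\<close> requires a commutative ring of scalars.  The record
  of modules and the predicate \<^const>\<open>submodule\<close> do not, and are reused here.\<close>

locale left_module = R?: ring R + M?: abelian_group M
  for R :: "('a, 'r) ring_scheme" (structure) and M :: "('a, 'b, 'c) module_scheme" (structure) +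
  assumes smult_closed:
      "\<lbrakk>a \<in> carrier R; x \<in> carrier M\<rbrakk> \<Longrightarrow> a \<odot>\<^bsub>M\<^esub> x \<in> carrier M"
    and smult_l_distr:
      "\<lbrakk>a \<in> carrier R; b \<in> carrier R; x \<in> carrier M\<rbrakk> \<Longrightarrow>
        (a \<oplus>\<^bsub>R\<^esub> b) \<odot>\<^bsub>M\<^esub> x = a \<odot>\<^bsub>M\<^esub> x \<oplus>\<^bsub>M\<^esub> b \<odot>\<^bsub>M\<^esub> x"
    and smult_r_distr:
      "\<lbrakk>a \<in> carrier R; x \<in> carrier M; y \<in> carrier M\<rbrakk> \<Longrightarrow>
        a \<odot>\<^bsub>M\<^esub> (x \<oplus>\<^bsub>M\<^esub> y) = a \<odot>\<^bsub>M\<^esub> x \<oplus>\<^bsub>M\<^esub> a \<odot>\<^bsub>M\<^esub> y"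
    and smult_assoc1:
      "\<lbrakk>a \<in> carrier R; b \<in> carrier R; x \<in> carrier M\<rbrakk> \<Longrightarrow>
        (a \<otimes>\<^bsub>R\<^esub> b) \<odot>\<^bsub>M\<^esub> x = a \<odot>\<^bsub>M\<^esub> (b \<odot>\<^bsub>M\<^esub> x)"
    and smult_one:
      "x \<in> carrier M \<Longrightarrow> \<one>\<^bsub>R\<^esub> \<odot>\<^bsub>M\<^esub> x = x"

definition simple_module :: "('a, 'r) ring_scheme \<Rightarrow> ('a, 'b, 'c) module_scheme \<Rightarrow> bool" where
  "simple_module R M \<longleftrightarrow>
     left_module R M \<and> carrier M \<noteq> {\<zero>\<^bsub>M\<^esub>} \<and>
     (\<forall>N. submodule N R M \<longrightarrow> N = {\<zero>\<^bsub>M\<^esub>} \<or> N = carrier M)"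

definition module_isomorphic ::
    "('a, 'r) ring_scheme \<Rightarrow> ('a, 'b, 'c) module_scheme \<Rightarrow> ('a, 'd, 'e) module_scheme \<Rightarrow> bool" where
  "module_isomorphic R M N \<longleftrightarrow>
     (\<exists>f. bij_betw f (carrier M) (carrier N) \<and>
          (\<forall>x\<in>carrier M. \<forall>y\<in>carrier M. f (x \<oplus>\<^bsub>M\<^esub> y) = f x \<oplus>\<^bsub>N\<^esub> f y) \<and>
          (\<forall>a\<in>carrier R. \<forall>x\<in>carrier M. f (a \<odot>\<^bsub>M\<^esub> x) = a \<odot>\<^bsub>N\<^esub> f x))"

definition submodule_generated ::
    "('a, 'r) ring_scheme \<Rightarrow> ('a, 'b, 'c) module_scheme \<Rightarrow> 'b set \<Rightarrow> 'b set" where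
  "submodule_generated R M A = \<Inter>{N. submodule N R M \<and> A \<subseteq> N}"

text \<open>A semisimple module is the internal direct sum of a family of simple submodules.\<close>

definition semisimple_module :: "('a, 'r) ring_scheme \<Rightarrow> ('a, 'b, 'c) module_scheme \<Rightarrow> bool" where
  "semisimple_module R M \<longleftrightarrow>
     left_module R M \<and>
     (\<exists>F. (\<forall>S\<in>F. submodule S R M \<and> simple_module R (M\<lparr>carrier := S\<rparr>)) \<and>
          submodule_generated R M (\<Union>F) = carrier M \<and>
          (\<forall>S\<in>F. S \<inter> submodule_generated R M (\<Union>(F - {S})) = {\<zero>\<^bsub>M\<^esub>}))"

definition regular_module :: "('a, 'r) ring_scheme \<Rightarrow> ('a, 'a) module" where
  "regular_module R =
     \<lparr>carrier = carrier R, mult = mult R, one = one R, zero = zero R, add = add R, smult = mult R\<rparr>"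

definition semisimple_ring :: "('a, 'r) ring_scheme \<Rightarrow> bool" where
  "semisimple_ring R \<longleftrightarrow> semisimple_module R (regular_module R)"


section \<open>The ground field and the parameters\<close>

type_synonym cpoly = "(nat \<Rightarrow>\<^sub>0 nat) \<Rightarrow>\<^sub>0 complex"

text \<open>Polynomials in the indeterminates \<open>X\<^sub>0, \<dots>, X\<^sub>m\<close> and their field of fractions, inside the
  field of rational functions in countably many indeterminates.\<close>

definition cpolys :: "nat \<Rightarrow> cpoly set" where
  "cpolys m = {p. \<forall>t\<in>Poly_Mapping.keys p. Poly_Mapping.keys t \<subseteq> {0..m}}"

definition rational_functions :: "nat \<Rightarrow> cpoly fract set" where
  "rational_functions m = {Fraction_Field.Fract p r | p r. p \<in> cpolys m \<and> r \<in> cpolys m \<and> r \<noteq> 0}"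

definition indet :: "nat \<Rightarrow> cpoly fract" where
  "indet i = Fraction_Field.Fract (Poly_Mapping.single (Poly_Mapping.single i 1) 1) 1"

definition field_iso :: "'a::field set \<Rightarrow> ('a \<Rightarrow> 'k::field) \<Rightarrow> bool" where
  "field_iso S \<phi> \<longleftrightarrow> bij_betw \<phi> S UNIV \<and> \<phi> 1 = 1 \<and>
     (\<forall>x\<in>S. \<forall>y\<in>S. \<phi> (x + y) = \<phi> x + \<phi> y \<and> \<phi> (x * y) = \<phi> x * \<phi> y)"

text \<open>The ground field \<open>K\<close> is the type \<open>'k\<close>: it is \<open>\<complex>(q, v\<^sub>1, \<dots>, v\<^sub>m)\<close> in the first predicate, with
  \<open>X\<^sub>0\<close> in the role of \<open>q\<close>, and \<open>\<complex>\<close> in the second one, both up to an isomorphism of fields.\<close>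

definition generic_parameters :: "nat \<Rightarrow> 'k::field \<Rightarrow> (nat \<Rightarrow> 'k) \<Rightarrow> bool" where
  "generic_parameters m q v \<longleftrightarrow>
     (\<exists>\<phi>. field_iso (rational_functions m) \<phi> \<and> \<phi> (indet 0) = q \<and> (\<forall>j\<in>{1..m}. \<phi> (indet j) = v j))"

definition complex_parameters :: "nat \<Rightarrow> nat \<Rightarrow> 'k::field \<Rightarrow> (nat \<Rightarrow> 'k) \<Rightarrow> bool" where
  "complex_parameters m n q v \<longleftrightarrow>
     (\<exists>\<phi>. field_iso (UNIV :: complex set) (\<phi> :: complex \<Rightarrow> 'k)) \<and>
     q \<noteq> 0 \<and>
     (\<forall>N<n. (\<Sum>i=0..N. q ^ (2 * i)) \<noteq> 0) \<and>
     (\<forall>i. \<forall>j\<in>{1..m}. \<forall>k\<in>{1..m}. j \<noteq> k \<and> - int n < i \<and> i < int n \<longrightarrow>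
        q powi (2 * i) * v j - v k \<noteq> 0) \<and>
     (\<forall>j\<in>{1..m}. v j \<noteq> 0)"


section \<open>The cyclotomic Hecke algebra\<close>

datatype hgen = Tau | Sigma nat

text \<open>Lists form a monoid under concatenation, so that \<^typ>\<open>'g list \<Rightarrow>\<^sub>0 'k\<close> with the convolution
  product of \<^theory>\<open>HOL-Library.Poly_Mapping\<close> is the free associative unital algebra on \<open>'g\<close>.\<close>

instantiation list :: (type) monoid_add
begin
definition zero_list :: "'a list" where "zero_list = []"
definition plus_list :: "'a list \<Rightarrow> 'a list \<Rightarrow> 'a list" where "plus_list xs ys = xs @ ys"
instance by standard (simp_all add: zero_list_def plus_list_def)
end

type_synonym 'k falg = "hgen list \<Rightarrow>\<^sub>0 'k"

definition free_algebra :: "hgen set \<Rightarrow> ('k::field falg) ring" where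
  "free_algebra G =
     \<lparr>carrier = {p. \<forall>w\<in>Poly_Mapping.keys p. set w \<subseteq> G}, mult = (*), one = 1, zero = 0, add = (+)\<rparr>"

definition const :: "'k::field \<Rightarrow> 'k falg" where
  "const c = Poly_Mapping.single [] c"

definition \<tau> :: "'k::field falg" where
  "\<tau> = Poly_Mapping.single [Tau] 1"

definition \<sigma> :: "nat \<Rightarrow> 'k::field falg" where
  "\<sigma> i = Poly_Mapping.single [Sigma i] 1"

definition hecke_gens :: "nat \<Rightarrow> hgen set" where
  "hecke_gens n = insert Tau (Sigma ` {1..<n})"

definition hecke_relators :: "nat \<Rightarrow> nat \<Rightarrow> 'k::field \<Rightarrow> (nat \<Rightarrow> 'k) \<Rightarrow> 'k falg set" where
  "hecke_relators m n q v =
     {\<sigma> i * \<sigma> (i + 1) * \<sigma> i - \<sigma> (i + 1) * \<sigma> i * \<sigma> (i + 1) | i. 1 \<le> i \<and> i + 1 < n} \<union>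
     {\<sigma> i * \<sigma> j - \<sigma> j * \<sigma> i | i j. i \<in> {1..<n} \<and> j \<in> {1..<n} \<and> \<bar>int i - int j\<bar> > 1} \<union>
     {\<tau> * \<sigma> 1 * \<tau> * \<sigma> 1 - \<sigma> 1 * \<tau> * \<sigma> 1 * \<tau> | i::nat. i = 1 \<and> i < n} \<union>
     {\<tau> * \<sigma> i - \<sigma> i * \<tau> | i. 1 < i \<and> i < n} \<union>
     {\<sigma> i * \<sigma> i - (const (q - inverse q) * \<sigma> i + 1) | i. i \<in> {1..<n}} \<union>
     {prod_list (map (\<lambda>j. \<tau> - const (v j)) [1..<m + 1])}"

definition hecke_ideal :: "nat \<Rightarrow> nat \<Rightarrow> 'k::field \<Rightarrow> (nat \<Rightarrow> 'k) \<Rightarrow> 'k falg set" where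
  "hecke_ideal m n q v = genideal (free_algebra (hecke_gens n)) (hecke_relators m n q v)"

definition hecke_algebra :: "nat \<Rightarrow> nat \<Rightarrow> 'k::field \<Rightarrow> (nat \<Rightarrow> 'k) \<Rightarrow> 'k falg set ring" where
  "hecke_algebra m n q v = free_algebra (hecke_gens n) Quot hecke_ideal m n q v"

text \<open>The image of the ground field in the algebra; dimensions over \<open>K\<close> are dimensions over it.\<close>

definition hecke_scalars :: "nat \<Rightarrow> nat \<Rightarrow> 'k::field \<Rightarrow> (nat \<Rightarrow> 'k) \<Rightarrow> 'k falg set set" where
  "hecke_scalars m n q v =
     {hecke_ideal m n q v +>\<^bsub>free_algebra (hecke_gens n)\<^esub> const c | c. True}"


section \<open>Multipartitions and standard tableaux\<close>

definition is_partition :: "nat list \<Rightarrow> bool" where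
  "is_partition p \<longleftrightarrow> sorted_wrt (\<ge>) p \<and> 0 \<notin> set p"

definition mpartitions :: "nat \<Rightarrow> nat \<Rightarrow> nat list list set" where
  "mpartitions m n =
     {lam. length lam = m \<and> (\<forall>p\<in>set lam. is_partition p) \<and> (\<Sum>p\<leftarrow>lam. sum_list p) = n}"

text \<open>A node \<open>(k, r, s)\<close> lies in row \<open>r\<close> and column \<open>s\<close> of diagram \<open>k\<close>, all counted from 1.\<close>

type_synonym mnode = "nat \<times> nat \<times> nat"

definition mnodes :: "nat list list \<Rightarrow> mnode set" where
  "mnodes lam = {(k, r, s). k \<in> {1..length lam} \<and> r \<in> {1..length (lam ! (k - 1))} \<and>
                            s \<in> {1..lam ! (k - 1) ! (r - 1)}}"

text \<open>Tableaux are extensional functions, so that distinct tableaux differ on some node.\<close>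

type_synonym tableau = "mnode \<Rightarrow> nat"

definition standard_tableaux :: "nat \<Rightarrow> nat list list \<Rightarrow> tableau set" where
  "standard_tableaux n lam =
     {X \<in> extensional (mnodes lam). bij_betw X (mnodes lam) {1..n} \<and>
        (\<forall>k r s s'. (k, r, s) \<in> mnodes lam \<and> (k, r, s') \<in> mnodes lam \<and> s < s' \<longrightarrow>
           X (k, r, s) < X (k, r, s')) \<and>
        (\<forall>k r r' s. (k, r, s) \<in> mnodes lam \<and> (k, r', s) \<in> mnodes lam \<and> r < r' \<longrightarrow>
           X (k, r, s) < X (k, r', s))}"

definition node_of :: "nat list list \<Rightarrow> tableau \<Rightarrow> nat \<Rightarrow> mnode" where
  "node_of lam X i = inv_into (mnodes lam) X i"

fun node_content :: "'k::field \<Rightarrow> (nat \<Rightarrow> 'k) \<Rightarrow> mnode \<Rightarrow> 'k" where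
  "node_content q v (k, r, s) = v k * q powi (2 * (int s - int r))"

fun node_diag :: "mnode \<Rightarrow> int" where
  "node_diag (k, r, s) = int s - int r"

definition content :: "'k::field \<Rightarrow> (nat \<Rightarrow> 'k) \<Rightarrow> nat list list \<Rightarrow> tableau \<Rightarrow> nat \<Rightarrow> 'k" where
  "content q v lam X i = node_content q v (node_of lam X i)"

definition axial_distance :: "nat list list \<Rightarrow> tableau \<Rightarrow> nat \<Rightarrow> int" where
  "axial_distance lam X i = node_diag (node_of lam X (i + 1)) - node_diag (node_of lam X i)"

definition swap_tableau :: "nat list list \<Rightarrow> nat \<Rightarrow> tableau \<Rightarrow> tableau" where
  "swap_tableau lam i X = restrict (transpose i (i + 1) \<circ> X) (mnodes lam)"


section \<open>The modules \<open>V\<^sub>\<lambda>\<close>\<close>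

text \<open>For \<open>q\<^sup>2 \<noteq> 1\<close> the contents of \<open>i\<close> and \<open>i + 1\<close> in a standard tableau differ for all
  admissible parameters.  The conditions on the parameters also allow \<open>q\<^sup>2 = 1\<close>; then the contents
  agree if \<open>i\<close> and \<open>i + 1\<close> lie in the same diagram, and the matrix coefficients take the form
  \<open>0 / 0\<close>.  As rational functions in \<open>q\<close> they extend to this point: with axial distance \<open>d\<close>,
  \<open>(q - 1/q) q\<^sup>2\<^sup>d / (q\<^sup>2\<^sup>d - 1)\<close> takes the value \<open>q / d\<close> at \<open>q = \<plusminus>1\<close>, and the second coefficient is the
  first one plus \<open>1/q\<close>.  The second branches below are these values.\<close>

definition diag_coeff :: "'k::field \<Rightarrow> (nat \<Rightarrow> 'k) \<Rightarrow> nat list list \<Rightarrow> tableau \<Rightarrow> nat \<Rightarrow> 'k" where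
  "diag_coeff q v lam X i =
     (let c = content q v lam X i; c' = content q v lam X (i + 1) in
      if c' \<noteq> c then (q - inverse q) * c' / (c' - c)
      else q / of_int (axial_distance lam X i))"

definition offdiag_coeff :: "'k::field \<Rightarrow> (nat \<Rightarrow> 'k) \<Rightarrow> nat list list \<Rightarrow> tableau \<Rightarrow> nat \<Rightarrow> 'k" where
  "offdiag_coeff q v lam X i =
     (let c = content q v lam X i; c' = content q v lam X (i + 1) in
      if c' \<noteq> c then (q * c' - inverse q * c) / (c' - c)
      else inverse q + q / of_int (axial_distance lam X i))"

definition scale :: "'k::field \<Rightarrow> ('x \<Rightarrow>\<^sub>0 'k) \<Rightarrow> ('x \<Rightarrow>\<^sub>0 'k)" where
  "scale c f = Poly_Mapping.map ((*) c) f"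

definition linear_extension :: "('x \<Rightarrow> ('y \<Rightarrow>\<^sub>0 'k)) \<Rightarrow> ('x \<Rightarrow>\<^sub>0 'k::field) \<Rightarrow> ('y \<Rightarrow>\<^sub>0 'k)" where
  "linear_extension h f = (\<Sum>x\<in>Poly_Mapping.keys f. scale (Poly_Mapping.lookup f x) (h x))"

definition basis_vector :: "tableau \<Rightarrow> (tableau \<Rightarrow>\<^sub>0 'k::field)" where
  "basis_vector X = Poly_Mapping.single X 1"

fun gen_on_basis ::
    "nat \<Rightarrow> 'k::field \<Rightarrow> (nat \<Rightarrow> 'k) \<Rightarrow> nat list list \<Rightarrow> hgen \<Rightarrow> tableau \<Rightarrow> (tableau \<Rightarrow>\<^sub>0 'k)" where
  "gen_on_basis n q v lam Tau X = scale (content q v lam X 1) (basis_vector X)"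
| "gen_on_basis n q v lam (Sigma i) X =
     scale (diag_coeff q v lam X i) (basis_vector X) +
     scale (offdiag_coeff q v lam X i)
       (if swap_tableau lam i X \<in> standard_tableaux n lam
        then basis_vector (swap_tableau lam i X) else 0)"

definition word_action ::
    "nat \<Rightarrow> 'k::field \<Rightarrow> (nat \<Rightarrow> 'k) \<Rightarrow> nat list list \<Rightarrow> hgen list \<Rightarrow> (tableau \<Rightarrow>\<^sub>0 'k) \<Rightarrow> (tableau \<Rightarrow>\<^sub>0 'k)" where
  "word_action n q v lam w f = foldr (\<lambda>g. linear_extension (gen_on_basis n q v lam g)) w f"

definition free_action ::
    "nat \<Rightarrow> 'k::field \<Rightarrow> (nat \<Rightarrow> 'k) \<Rightarrow> nat list list \<Rightarrow> 'k falg \<Rightarrow> (tableau \<Rightarrow>\<^sub>0 'k) \<Rightarrow> (tableau \<Rightarrow>\<^sub>0 'k)" where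
  "free_action n q v lam a f = linear_extension (\<lambda>w. word_action n q v lam w f) a"

text \<open>A coset acts as the common action of its representatives.  The ring fields of the
  module record are irrelevant.\<close>

definition V_module ::
    "nat \<Rightarrow> 'k::field \<Rightarrow> (nat \<Rightarrow> 'k) \<Rightarrow> nat list list \<Rightarrow> ('k falg set, tableau \<Rightarrow>\<^sub>0 'k) module" where
  "V_module n q v lam =
     \<lparr>carrier = {f. Poly_Mapping.keys f \<subseteq> standard_tableaux n lam},
      mult = undefined, one = undefined, zero = 0, add = (+),
      smult = (\<lambda>A f. THE g. \<forall>a\<in>A. free_action n q v lam a f = g)\<rparr>"

end

(* A standard tableau is a path in the lattice of m-tuples of Young diagrams: the list of the nodes
   carrying 1, ..., n.  All V_lambda together form the span V of the paths of length n, on which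
   sigma_i only involves the nodes at positions i and i + 1.  The relations therefore reduce to
   identities for the matrix coefficients of two or three nodes.

   By induction on n, every linear map of V that preserves shapes is the action of an element of the
   free algebra.  For the step it suffices to separate the nodes x that can be added to a path T: the
   n-th Jucys-Murphy element acts on T x by the content of x and, for a path X y with the same nodes
   as T, the compression of sigma_(n-1) to X y x acts by the coefficient of the pair (y, x).  The
   latter is needed for q^2 = 1, when the contents of different x can coincide.

   The number of pairs of paths of equal shape is n! m^n: a tuple has m more addable than removable
   nodes, so one step up in the lattice multiplies the sum of the squares of the f_lambda by m n.  On
   the other hand, coset representatives for consecutive n show that n! m^n monomials span the Hecke
   algebra.  Hence it acts faithfully on V, so it is spanned by matrix units, from which
   semisimplicity, the dimension and the list of simple modules are read off. *)

theory Submission imports Defs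
begin

section \<open>Linear maps on finitely supported functions\<close>

text \<open>The ranges in the conditions on the parameters match one geometric bound. Two nodes that
  can be added to a path of length \<open>n - 1\<close> lie, together with it, in a diagram with
  \<open>n + 1\<close> nodes; there diagonals differ by less than \<open>n\<close> in different
  components and by at most \<open>n\<close> in one component. The obstacle is the admissible case
  q^2 = 1. Contents then depend on the component alone, so the Jucys-Murphy elements do not separate
  paths, and each identity for coefficients has a branch in the contents and a branch in the axial
  distances. The induction for matrix units runs in the nested subsets \<open>FA l\<close> of one
  free algebra and does not touch the ideal; hence no embedding of the Hecke algebra of rank
  \<open>l\<close> into that of rank \<open>n\<close> has to be established. The spanning set is
  likewise obtained without linear independence: an upper bound for its size is enough, and
  independence comes out of the final count.\<close>

lemma lookup_scale [simp]: "Poly_Mapping.lookup (scale c f) x = c * Poly_Mapping.lookup f x"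
  by (simp add: scale_def Poly_Mapping.map.rep_eq when_def)

interpretation PM: vector_space "scale :: 'k::field \<Rightarrow> ('x \<Rightarrow>\<^sub>0 'k) \<Rightarrow> ('x \<Rightarrow>\<^sub>0 'k)"
  by unfold_locales (auto intro!: poly_mapping_eqI simp: lookup_add algebra_simps)

interpretation PMP: vector_space_pair
  "scale :: 'k::field \<Rightarrow> ('x \<Rightarrow>\<^sub>0 'k) \<Rightarrow> ('x \<Rightarrow>\<^sub>0 'k)" "scale :: 'k \<Rightarrow> ('y \<Rightarrow>\<^sub>0 'k) \<Rightarrow> ('y \<Rightarrow>\<^sub>0 'k)"
  by unfold_locales

abbreviation lin :: "(('x \<Rightarrow>\<^sub>0 'k::field) \<Rightarrow> ('y \<Rightarrow>\<^sub>0 'k)) \<Rightarrow> bool" where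
  "lin \<equiv> Vector_Spaces.linear scale scale"

lemma linI:
  assumes "\<And>f g. L (f + g) = L f + L g" "\<And>c f. L (scale c f) = scale c (L f)"
  shows "lin L"
  using assms by unfold_locales auto

lemma lin_compose: "lin L \<Longrightarrow> lin M \<Longrightarrow> lin (\<lambda>f. L (M f))"
  by (rule linI) (simp_all add: PMP.linear_add PMP.linear_scale)

abbreviation bas :: "'x \<Rightarrow> ('x \<Rightarrow>\<^sub>0 'k::field)" where
  "bas x \<equiv> Poly_Mapping.single x 1"

abbreviation supported :: "'x set \<Rightarrow> ('x \<Rightarrow>\<^sub>0 'k::field) set" where
  "supported B \<equiv> {f. Poly_Mapping.keys f \<subseteq> B}"

lemma keys_scale: "Poly_Mapping.keys (scale c f) = (if c = 0 then {} else Poly_Mapping.keys f)"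
  by (auto simp: in_keys_iff)

lemma subspace_supported: "PM.subspace (supported B :: ('x \<Rightarrow>\<^sub>0 'k::field) set)"
proof (rule PM.subspaceI)
  fix f g :: "'x \<Rightarrow>\<^sub>0 'k::field" assume "f \<in> supported B" "g \<in> supported B"
  then show "f + g \<in> supported B" using keys_add[of f g] by auto
qed (auto simp: keys_scale split: if_splits)

lemma single_eq_scale_bas: "Poly_Mapping.single x c = scale c (bas x)"
  by (rule poly_mapping_eqI) (simp add: lookup_single when_def)

lemma linear_extension_superset:
  assumes "finite A" "Poly_Mapping.keys f \<subseteq> A"
  shows "linear_extension h f = (\<Sum>x\<in>A. scale (Poly_Mapping.lookup f x) (h x))"
  unfolding linear_extension_def
  by (rule sum.mono_neutral_left) (use assms in \<open>auto simp: in_keys_iff\<close>)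

lemma lin_linear_extension: "lin (linear_extension (h :: 'x \<Rightarrow> 'y \<Rightarrow>\<^sub>0 'k::field))"
proof (rule linI)
  fix f g :: "'x \<Rightarrow>\<^sub>0 'k"
  let ?A = "Poly_Mapping.keys f \<union> Poly_Mapping.keys g"
  show "linear_extension h (f + g) = linear_extension h f + linear_extension h g"
    using keys_add[of f g]
    by (subst (1 2 3) linear_extension_superset[where A = ?A])
       (auto simp: lookup_add PM.scale_left_distrib sum.distrib)
next
  fix c f
  show "linear_extension h (scale c f) = scale c (linear_extension h f)"
    by (subst (1 2) linear_extension_superset[where A = "Poly_Mapping.keys f"])
       (auto simp: keys_scale PM.scale_sum_right)
qed

lemmas linear_extension_linear [simp] =
  PMP.linear_add[OF lin_linear_extension] PMP.linear_scale[OF lin_linear_extension]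
  PMP.linear_diff[OF lin_linear_extension] PMP.linear_0[OF lin_linear_extension]

lemma linear_extension_bas [simp]: "linear_extension h (bas x) = h x"
  by (simp add: linear_extension_def)

lemma linear_extension_single [simp]: "linear_extension h (Poly_Mapping.single x c) = scale c (h x)"
  by (subst single_eq_scale_bas) simp

lemma bas_expansion: "f = (\<Sum>x\<in>Poly_Mapping.keys f. scale (Poly_Mapping.lookup f x) (bas x))"
proof (rule poly_mapping_eqI)
  fix k
  show "Poly_Mapping.lookup f k
      = Poly_Mapping.lookup (\<Sum>x\<in>Poly_Mapping.keys f. scale (Poly_Mapping.lookup f x) (bas x)) k"
    by (cases "k \<in> Poly_Mapping.keys f")
       (auto simp: lookup_sum lookup_single when_def if_distrib sum.delta in_keys_iff cong: if_cong)
qed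

lemma lin_eq_on:
  assumes "lin L" "lin M" "\<And>x. x \<in> B \<Longrightarrow> L (bas x) = M (bas x)" "Poly_Mapping.keys f \<subseteq> B"
  shows "L f = M f"
proof -
  have "L f = (\<Sum>x\<in>Poly_Mapping.keys f. scale (Poly_Mapping.lookup f x) (L (bas x)))"
    by (subst bas_expansion) (simp add: PMP.linear_sum[OF assms(1)] PMP.linear_scale[OF assms(1)])
  also have "\<dots> = (\<Sum>x\<in>Poly_Mapping.keys f. scale (Poly_Mapping.lookup f x) (M (bas x)))"
    by (rule sum.cong) (use assms in auto)
  also have "\<dots> = M f"
    by (subst (3) bas_expansion) (simp add: PMP.linear_sum[OF assms(2)] PMP.linear_scale[OF assms(2)])
  finally show ?thesis .
qed

lemma lin_eq:
  assumes "lin L" "lin M" "\<And>x. L (bas x) = M (bas x)"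
  shows "L f = M f"
  using lin_eq_on[OF assms(1,2), of UNIV] assms(3) by auto

lemma linear_extension_supported:
  assumes "\<And>x. x \<in> Poly_Mapping.keys f \<Longrightarrow> h x \<in> supported B"
  shows "linear_extension h f \<in> supported B"
  unfolding linear_extension_def
  by (rule PM.subspace_sum[OF subspace_supported], rule PM.subspace_scale[OF subspace_supported])
     (use assms in auto)


section \<open>The free algebra and its actions\<close>

lemma scale_eq_const_mult: "scale c a = const c * a"
  unfolding scale_def const_def mult_map_scale_conv_mult by (simp add: zero_list_def)

lemma const_mult_single: "const c * Poly_Mapping.single w d = Poly_Mapping.single w (c * d)"
  by (simp add: const_def mult_single plus_list_def)

lemma single_mult_const: "Poly_Mapping.single w d * const c = Poly_Mapping.single w (d * c)"
  by (simp add: const_def mult_single plus_list_def)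

lemma lin_mult_const: "lin (\<lambda>a::'k::field falg. a * const c)"
  by (rule linI) (simp_all add: scale_eq_const_mult algebra_simps)

lemma const_central: "const c * a = a * const c"
proof -
  have "lin (\<lambda>a. const c * a)"
    by (rule linI) (simp_all add: PM.scale_right_distrib flip: scale_eq_const_mult)
  then show ?thesis
    by (rule lin_eq) (use lin_mult_const in \<open>simp_all add: const_mult_single single_mult_const\<close>)
qed

lemma scale_mult_left [simp]: "scale c a * b = scale c (a * b)" for a b :: "'k::field falg"
  by (simp add: scale_eq_const_mult mult.assoc)

lemma scale_mult_right [simp]: "a * scale c b = scale c (a * b)" for a b :: "'k::field falg"
  by (simp add: scale_eq_const_mult const_central flip: mult.assoc) (simp add: mult.assoc const_central)

lemma const_eq_scale_one: "const c = scale c 1"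
  by (simp add: scale_eq_const_mult)

lemma bas_mult: "bas u * bas w = (bas (u @ w) :: 'k::field falg)"
  by (simp add: mult_single plus_list_def)

lemma bas_Nil: "bas [] = (1 :: 'k::field falg)"
  by (metis single_one zero_list_def)

text \<open>The table \<open>g\<close> of images of basis elements is a parameter, so that the
  module on tableaux and the formal module on lists of nodes are instances of one construction and
  can be compared by \<open>act_intertwine\<close>.\<close>

definition act :: "('g \<Rightarrow> 'x \<Rightarrow> ('x \<Rightarrow>\<^sub>0 'k::field)) \<Rightarrow> ('g list \<Rightarrow>\<^sub>0 'k) \<Rightarrow> ('x \<Rightarrow>\<^sub>0 'k) \<Rightarrow> ('x \<Rightarrow>\<^sub>0 'k)" where
  "act g a f = linear_extension (\<lambda>w. foldr (\<lambda>h. linear_extension (g h)) w f) a"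

lemma act_linear_left [simp]:
  "act g (a + b) f = act g a f + act g b f"
  "act g (a - b) f = act g a f - act g b f"
  "act g (scale c a) f = scale c (act g a f)"
  "act g 0 f = 0"
  by (simp_all add: act_def)

lemma lin_act_left: "lin (\<lambda>a. act g a f)"
  by (rule linI) simp_all

lemma act_bas: "act g (bas w) f = foldr (\<lambda>h. linear_extension (g h)) w f"
  by (simp add: act_def)

lemma lin_foldr: "lin (foldr (\<lambda>h. linear_extension (g h)) w)"
proof (induction w)
  case Nil
  show ?case by (rule linI) simp_all
next
  case (Cons h w)
  show ?case unfolding foldr.simps comp_def
    by (rule lin_compose[OF lin_linear_extension Cons.IH])
qed

lemma lin_act: "lin (act g a)"
proof (rule linI)
  fix f f' c
  show "act g a (f + f') = act g a f + act g a f'"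
    by (rule lin_eq[where f = a])
       (simp_all add: lin_act_left PMP.linear_compose_add act_bas PMP.linear_add[OF lin_foldr])
  have "lin (\<lambda>a. scale c (act g a f))"
    by (rule linI) (simp_all add: PM.scale_right_distrib mult.commute)
  then show "act g a (scale c f) = scale c (act g a f)"
    by (rule lin_eq[where f = a, rotated])
       (simp_all add: lin_act_left act_bas PMP.linear_scale[OF lin_foldr])
qed

lemmas act_linear_right [simp] =
  PMP.linear_add[OF lin_act] PMP.linear_scale[OF lin_act]
  PMP.linear_diff[OF lin_act] PMP.linear_0[OF lin_act]

text \<open>Both sides are linear in \<open>a\<close> and in \<open>b\<close>; for two words the
  claim is that \<open>foldr\<close> along a concatenation composes.\<close>

lemma act_mult [simp]: "act g (a * b) f = act g a (act g b f)" for a b :: "'k::field falg"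
proof (rule lin_eq[where f = a])
  show "lin (\<lambda>a. act g (a * b) f)" "lin (\<lambda>a. act g a (act g b f))"
    by (rule linI; simp add: distrib_right)+
  fix u
  show "act g (bas u * b) f = act g (bas u) (act g b f)"
  proof (rule lin_eq[where f = b])
    show "lin (\<lambda>b. act g (bas u * b) f)" "lin (\<lambda>b. act g (bas u) (act g b f))"
      by (rule linI; simp add: distrib_left)+
    show "act g (bas u * bas w) f = act g (bas u) (act g (bas w) f)" for w
      by (simp add: bas_mult act_bas)
  qed
qed

lemma act_one [simp]: "act g (1 :: 'k::field falg) f = f"
  by (simp add: act_bas flip: bas_Nil)

lemma act_const [simp]: "act g (const c) f = scale c f"
  by (simp add: const_eq_scale_one)

lemma act_gens [simp]:
  "act g \<tau> f = linear_extension (g Tau) f"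
  "act g (\<sigma> i) f = linear_extension (g (Sigma i)) f"
  by (simp_all add: \<tau>_def \<sigma>_def act_bas)

lemma free_action_eq_act: "free_action n q v lam = act (gen_on_basis n q v lam)"
  by (simp add: fun_eq_iff free_action_def act_def word_action_def)

text \<open>Intertwining needs to be checked only for generators on the basis of an invariant span.
  There are three uses: the identity, which yields invariance alone; appending a node to a path; and
  the passage from tableaux to paths.\<close>

lemma act_intertwine:
  assumes "lin \<phi>"
    and "\<And>h x. h \<in> G \<Longrightarrow> x \<in> B \<Longrightarrow> g h x \<in> supported B \<and> \<phi> (g h x) = linear_extension (g' h) (\<phi> (bas x))"
    and "\<forall>w\<in>Poly_Mapping.keys a. set w \<subseteq> G" and f: "f \<in> supported B"
  shows "act g a f \<in> supported B \<and> \<phi> (act g a f) = act g' a (\<phi> f)"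
proof -
  have step: "linear_extension (g h) e \<in> supported B
      \<and> \<phi> (linear_extension (g h) e) = linear_extension (g' h) (\<phi> e)"
    if "h \<in> G" "e \<in> supported B" for h e
  proof
    show "linear_extension (g h) e \<in> supported B"
      by (rule linear_extension_supported) (use assms(2) that in auto)
    show "\<phi> (linear_extension (g h) e) = linear_extension (g' h) (\<phi> e)"
      using lin_eq_on[OF lin_compose[OF assms(1) lin_linear_extension]
          lin_compose[OF lin_linear_extension assms(1)], of B "g h" "g' h" e] assms(2) that by auto
  qed
  have word: "foldr (\<lambda>h. linear_extension (g h)) w f \<in> supported B
      \<and> \<phi> (foldr (\<lambda>h. linear_extension (g h)) w f) = foldr (\<lambda>h. linear_extension (g' h)) w (\<phi> f)"
    if "set w \<subseteq> G" for w
    using that by (induction w) (use f step in auto)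
  show ?thesis
  proof
    show "act g a f \<in> supported B"
      unfolding act_def by (rule linear_extension_supported) (use word assms(3) in blast)
    show "\<phi> (act g a f) = act g' a (\<phi> f)"
      by (rule lin_eq_on[where f = a and B = "{w. set w \<subseteq> G}"])
         (use word assms(3) in \<open>auto simp: act_bas lin_act_left intro!: lin_compose[OF assms(1) lin_act_left]\<close>)
  qed
qed

section \<open>Elements on the generators of a given rank\<close>

definition FA :: "nat \<Rightarrow> 'k::field falg set" where
  "FA n = carrier (free_algebra (hecke_gens n))"

lemma mem_FA: "a \<in> FA n \<longleftrightarrow> (\<forall>w\<in>Poly_Mapping.keys a. set w \<subseteq> hecke_gens n)"
  by (simp add: FA_def free_algebra_def)

lemma FA_eq_supported: "FA n = supported {w. set w \<subseteq> hecke_gens n}"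
  unfolding set_eq_iff mem_FA by blast

lemma FA_closed [simp, intro]:
  "0 \<in> FA n" "1 \<in> FA n" "const c \<in> FA n" "\<tau> \<in> FA n"
  "a \<in> FA n \<Longrightarrow> b \<in> FA n \<Longrightarrow> a + b \<in> FA n"
  "a \<in> FA n \<Longrightarrow> b \<in> FA n \<Longrightarrow> a - b \<in> FA n"
  "a \<in> FA n \<Longrightarrow> - a \<in> FA n"
  "a \<in> FA n \<Longrightarrow> scale c a \<in> FA n"
proof -
  show one: "1 \<in> FA n" by (simp add: mem_FA zero_list_def flip: bas_Nil)
  show "const c \<in> FA n" by (simp add: mem_FA const_def)
  show "\<tau> \<in> FA n" by (simp add: mem_FA \<tau>_def hecke_gens_def)
  show "a \<in> FA n \<Longrightarrow> b \<in> FA n \<Longrightarrow> a + b \<in> FA n"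
    unfolding FA_eq_supported by (rule PM.subspace_add[OF subspace_supported])
  show "a \<in> FA n \<Longrightarrow> b \<in> FA n \<Longrightarrow> a - b \<in> FA n"
    unfolding FA_eq_supported by (rule PM.subspace_diff[OF subspace_supported])
  show "a \<in> FA n \<Longrightarrow> - a \<in> FA n"
    unfolding FA_eq_supported by (rule PM.subspace_neg[OF subspace_supported])
  show "a \<in> FA n \<Longrightarrow> scale c a \<in> FA n"
    unfolding FA_eq_supported by (rule PM.subspace_scale[OF subspace_supported])
qed (simp add: mem_FA)

lemma FA_sum [intro]: "(\<And>x. x \<in> X \<Longrightarrow> h x \<in> FA n) \<Longrightarrow> sum h X \<in> FA n"
  unfolding FA_eq_supported by (rule PM.subspace_sum[OF subspace_supported])

lemma FA_mult [simp, intro]: "a \<in> FA n \<Longrightarrow> b \<in> FA n \<Longrightarrow> a * b \<in> FA n"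
  using keys_mult[of a b] by (fastforce simp: mem_FA plus_list_def)

lemma FA_power [simp, intro]: "a \<in> FA n \<Longrightarrow> a ^ k \<in> FA n"
  by (induction k) auto

lemma FA_sigma [simp, intro]: "1 \<le> i \<Longrightarrow> i < n \<Longrightarrow> \<sigma> i \<in> FA n"
  by (auto simp: mem_FA \<sigma>_def hecke_gens_def)

lemma FA_mono: "k \<le> n \<Longrightarrow> FA k \<subseteq> FA n"
  by (fastforce simp: mem_FA hecke_gens_def)

text \<open>Words grow on the right because the left spans of coset representatives in the spanning
  argument are closed under right multiplication by generators.\<close>

lemma FA_induct [consumes 1, case_names one add scale tau sigma]:
  assumes "a \<in> FA n"
    and one: "P 1"
    and add: "\<And>a b. a \<in> FA n \<Longrightarrow> b \<in> FA n \<Longrightarrow> P a \<Longrightarrow> P b \<Longrightarrow> P (a + b)"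
    and scale: "\<And>c a. a \<in> FA n \<Longrightarrow> P a \<Longrightarrow> P (scale c a)"
    and tau: "\<And>a. a \<in> FA n \<Longrightarrow> P a \<Longrightarrow> P (a * \<tau>)"
    and sigma: "\<And>a i. a \<in> FA n \<Longrightarrow> P a \<Longrightarrow> 1 \<le> i \<Longrightarrow> i < n \<Longrightarrow> P (a * \<sigma> i)"
  shows "P a"
proof -
  have word: "P (bas w)" if "set w \<subseteq> hecke_gens n" for w
    using that
  proof (induction w rule: rev_induct)
    case Nil
    show ?case using one by (simp add: bas_Nil)
  next
    case (snoc h w)
    then have *: "P (bas w)" "bas w \<in> FA n" by (auto simp: mem_FA)
    show ?case
    proof (cases h)
      case Tau
      then show ?thesis using tau[OF *(2,1)] by (simp add: \<tau>_def bas_mult)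
    next
      case (Sigma i)
      then show ?thesis using sigma[OF *(2,1), of i] snoc.prems by (auto simp: \<sigma>_def bas_mult hecke_gens_def)
    qed
  qed
  have "P (\<Sum>x\<in>W. scale (Poly_Mapping.lookup a x) (bas x))
      \<and> (\<Sum>x\<in>W. scale (Poly_Mapping.lookup a x) (bas x)) \<in> FA n"
    if "finite W" "W \<subseteq> Poly_Mapping.keys a" for W
    using that
  proof (induction W)
    case empty
    show ?case using scale[OF _ one, of 0] by simp
  next
    case (insert w W)
    then have "set w \<subseteq> hecke_gens n" using assms(1) by (auto simp: mem_FA)
    then have "P (bas w)" "bas w \<in> FA n" using word by (simp_all add: mem_FA)
    then show ?case using insert by (auto intro!: add scale)
  qed
  from this[of "Poly_Mapping.keys a"] show ?thesis by (simp flip: bas_expansion)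
qed

lemma free_algebra_simps:
  "carrier (free_algebra (hecke_gens n)) = (FA n :: 'k::field falg set)"
  "mult (free_algebra G) = ((*) :: 'k falg \<Rightarrow> _)" "one (free_algebra G) = (1 :: 'k falg)"
  "zero (free_algebra G) = (0 :: 'k falg)" "add (free_algebra G) = ((+) :: 'k falg \<Rightarrow> _)"
  by (simp_all add: FA_def) (simp_all add: free_algebra_def)

lemma ring_free_algebra: "ring (free_algebra (hecke_gens n) :: 'k::field falg ring)"
proof (rule ringI)
  show "abelian_group (free_algebra (hecke_gens n) :: 'k falg ring)"
  proof (rule abelian_groupI)
    fix x :: "'k falg" assume "x \<in> carrier (free_algebra (hecke_gens n))"
    then show "\<exists>y\<in>carrier (free_algebra (hecke_gens n)).
        y \<oplus>\<^bsub>free_algebra (hecke_gens n)\<^esub> x = \<zero>\<^bsub>free_algebra (hecke_gens n)\<^esub>"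
      by (intro bexI[of _ "- x"]) (auto simp: free_algebra_simps)
  qed (auto simp: free_algebra_simps add_ac)
  show "Group.monoid (free_algebra (hecke_gens n) :: 'k falg ring)"
    by (rule monoidI) (auto simp: free_algebra_simps mult.assoc)
qed (auto simp: free_algebra_simps distrib_left distrib_right)

lemma a_inv_free_algebra: "a \<in> FA n \<Longrightarrow> \<ominus>\<^bsub>free_algebra (hecke_gens n)\<^esub> a = - a"
  by (rule abelian_group.minus_equality[OF ring.is_abelian_group[OF ring_free_algebra]])
     (auto simp: free_algebra_simps)

lemma ideal_free_algebraI:
  assumes "I \<subseteq> FA n" "0 \<in> I" "\<And>a b. a \<in> I \<Longrightarrow> b \<in> I \<Longrightarrow> a + b \<in> I"
    and "\<And>a x. a \<in> I \<Longrightarrow> x \<in> FA n \<Longrightarrow> x * a \<in> I" "\<And>a x. a \<in> I \<Longrightarrow> x \<in> FA n \<Longrightarrow> a * x \<in> I"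
  shows "ideal I (free_algebra (hecke_gens n))"
proof (rule idealI[OF ring_free_algebra])
  interpret R: ring "free_algebra (hecke_gens n) :: 'a falg ring" by (rule ring_free_algebra)
  have neg: "- a \<in> I" if "a \<in> I" for a
    using assms(4)[OF that, of "- 1"] by simp
  show "subgroup I (add_monoid (free_algebra (hecke_gens n)))"
  proof (rule R.add.subgroupI)
    fix a assume "a \<in> I"
    moreover from this have "\<ominus>\<^bsub>free_algebra (hecke_gens n)\<^esub> a = - a"
      using assms(1) by (auto intro: a_inv_free_algebra)
    ultimately show "\<ominus>\<^bsub>free_algebra (hecke_gens n)\<^esub> a \<in> I" using neg by simp
  qed (use assms in \<open>auto simp: free_algebra_simps\<close>)
qed (use assms in \<open>auto simp: free_algebra_simps\<close>)


section \<open>The Hecke ideal\<close>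

lemma prod_list_in_FA: "(\<And>a. a \<in> set as \<Longrightarrow> a \<in> FA n) \<Longrightarrow> prod_list as \<in> FA n"
  by (induction as) auto

lemma hecke_relators_subset: "hecke_relators m n q v \<subseteq> FA n"
  unfolding hecke_relators_def by (auto intro!: prod_list_in_FA simp del: upt_Suc)

lemma hecke_relators_mono: "k \<le> n \<Longrightarrow> hecke_relators m k q v \<subseteq> hecke_relators m n q v"
  unfolding hecke_relators_def
  by (intro Un_mono subset_refl; clarsimp; (metis less_le_trans | fastforce))

lemma hecke_ideal_ideal: "ideal (hecke_ideal m n q v) (free_algebra (hecke_gens n))"
  unfolding hecke_ideal_def
  by (rule ring.genideal_ideal[OF ring_free_algebra]) (simp add: free_algebra_simps hecke_relators_subset)

lemma hecke_ideal_subset: "hecke_ideal m n q v \<subseteq> FA n"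
  using additive_subgroup.a_subset[OF ideal.axioms(1)[OF hecke_ideal_ideal]]
  by (simp add: free_algebra_simps)

lemma hecke_ideal_closed:
  "0 \<in> hecke_ideal m n q v"
  "a \<in> hecke_ideal m n q v \<Longrightarrow> b \<in> hecke_ideal m n q v \<Longrightarrow> a + b \<in> hecke_ideal m n q v"
  "a \<in> hecke_ideal m n q v \<Longrightarrow> x \<in> FA n \<Longrightarrow> x * a \<in> hecke_ideal m n q v"
  "a \<in> hecke_ideal m n q v \<Longrightarrow> x \<in> FA n \<Longrightarrow> a * x \<in> hecke_ideal m n q v"
  using additive_subgroup.zero_closed[OF ideal.axioms(1)[OF hecke_ideal_ideal[of m n q v]]]
    additive_subgroup.a_closed[OF ideal.axioms(1)[OF hecke_ideal_ideal[of m n q v]]]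
    ideal.I_l_closed[OF hecke_ideal_ideal[of m n q v]] ideal.I_r_closed[OF hecke_ideal_ideal[of m n q v]]
  by (simp_all add: free_algebra_simps)

lemma hecke_ideal_minimal:
  "ideal I (free_algebra (hecke_gens n)) \<Longrightarrow> hecke_relators m n q v \<subseteq> I \<Longrightarrow> hecke_ideal m n q v \<subseteq> I"
  unfolding hecke_ideal_def by (rule ring.genideal_minimal[OF ring_free_algebra])

lemma hecke_relators_in_ideal: "hecke_relators m n q v \<subseteq> hecke_ideal m n q v"
  unfolding hecke_ideal_def
  by (rule ring.genideal_self[OF ring_free_algebra]) (simp add: free_algebra_simps hecke_relators_subset)

text \<open>The intersection of \<open>FA k\<close> with the ideal of rank \<open>n\<close> is an
  ideal of \<open>FA k\<close> that contains the relators of rank \<open>k\<close>, hence contains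
  the smallest such ideal. Congruences of rank \<open>k\<close> thereby persist in rank
  \<open>n\<close>.\<close>

lemma hecke_ideal_mono:
  assumes "k \<le> n"
  shows "hecke_ideal m k q v \<subseteq> hecke_ideal m n q v"
proof -
  let ?I = "FA k \<inter> hecke_ideal m n q v"
  have "ideal ?I (free_algebra (hecke_gens k))"
    by (rule ideal_free_algebraI) (use FA_mono[OF assms] in \<open>auto intro: hecke_ideal_closed\<close>)
  moreover have "hecke_relators m k q v \<subseteq> ?I"
    using hecke_relators_subset hecke_relators_mono[OF assms] hecke_relators_in_ideal by blast
  ultimately show ?thesis using hecke_ideal_minimal by blast
qed


section \<open>Diagrams and paths\<close>

fun preds :: "mnode \<Rightarrow> mnode set" where
  "preds (k, r, s) = (if 1 < r then {(k, r - 1, s)} else {}) \<union> (if 1 < s then {(k, r, s - 1)} else {})"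

fun node_ok :: "nat \<Rightarrow> mnode \<Rightarrow> bool" where
  "node_ok m (k, r, s) \<longleftrightarrow> k \<in> {1..m} \<and> 1 \<le> r \<and> 1 \<le> s"

text \<open>The node sets of \<open>m\<close>-tuples of Young diagrams, encoded by closure under the
  neighbours above and to the left. In this form unions and intersections are diagrams for trivial
  reasons.\<close>

definition diagram :: "nat \<Rightarrow> mnode set \<Rightarrow> bool" where
  "diagram m Y \<longleftrightarrow> finite Y \<and> (\<forall>x\<in>Y. node_ok m x \<and> preds x \<subseteq> Y)"

definition adjacent :: "mnode \<Rightarrow> mnode \<Rightarrow> bool" where
  "adjacent x y \<longleftrightarrow> x \<in> preds y \<or> y \<in> preds x"

lemma adjacent_sym: "adjacent x y \<longleftrightarrow> adjacent y x"
  by (auto simp: adjacent_def)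

lemma not_in_preds_self: "node_ok m x \<Longrightarrow> x \<notin> preds x"
  by (cases x) (auto split: if_splits)

lemma diagram_empty [simp]: "diagram m {}"
  by (simp add: diagram_def)

lemma diagram_finite: "diagram m Y \<Longrightarrow> finite Y"
  by (simp add: diagram_def)

lemma diagram_node_ok: "diagram m Y \<Longrightarrow> x \<in> Y \<Longrightarrow> node_ok m x"
  by (simp add: diagram_def)

lemma diagram_Un: "diagram m Y \<Longrightarrow> diagram m Z \<Longrightarrow> diagram m (Y \<union> Z)"
  unfolding diagram_def by blast

lemma diagram_Int: "diagram m Y \<Longrightarrow> diagram m Z \<Longrightarrow> diagram m (Y \<inter> Z)"
  unfolding diagram_def by blast

lemma diagram_insert:
  "diagram m Y \<Longrightarrow> diagram m (insert x Y) \<longleftrightarrow> node_ok m x \<and> preds x \<subseteq> Y"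
  using not_in_preds_self[of m x] unfolding diagram_def by blast

lemma diagram_downward:
  assumes "diagram m Y" "(k, r, s) \<in> Y" "1 \<le> r'" "r' \<le> r" "1 \<le> s'" "s' \<le> s"
  shows "(k, r', s') \<in> Y"
proof -
  have pr: "preds x \<subseteq> Y" if "x \<in> Y" for x using assms(1) that by (simp add: diagram_def)
  have "(k, r', s) \<in> Y" using assms(4)
  proof (induction r' rule: inc_induct)
    case base
    show ?case by fact
  next
    case (step i)
    then show ?case using pr[of "(k, Suc i, s)"] assms(3) by auto
  qed
  with assms(6) show ?thesis
  proof (induction s' rule: inc_induct)
    case base
    then show ?case .
  next
    case (step i)
    then show ?case using pr[of "(k, r', Suc i)"] assms(5) by auto
  qed
qed

lemma diagram_remove_closed:
  assumes "diagram m Y" "diagram m (Y - {x})" "x = (k, r, s)" "(k, r', s') \<in> Y" "r \<le> r'" "s \<le> s'" "x \<in> Y"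
  shows "(k, r', s') = x"
proof (rule ccontr)
  assume "(k, r', s') \<noteq> x"
  then have "x \<in> Y - {x}"
    using diagram_downward[OF assms(2), of k r' s' r s] assms diagram_node_ok[OF assms(1,7)] by auto
  then show False by simp
qed

text \<open>The first column down to row \<open>r\<close> and the first row up to column \<open>s'\<close> form a hook.\<close>

lemma diagram_hook_card:
  assumes Y: "diagram m Y" and x: "(k, r, s) \<in> Y" and y: "(j, r', s') \<in> Y"
  shows "r + s' \<le> card Y + (if k = j then 1 else 0)"
proof -
  let ?C = "(\<lambda>i. (k, i, 1::nat)) ` {1..r}" and ?R = "(\<lambda>i. (j, 1::nat, i)) ` {1..s'}"
  have ok: "1 \<le> s" "1 \<le> r'" using diagram_node_ok[OF Y x] diagram_node_ok[OF Y y] by auto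
  have sub: "?C \<union> ?R \<subseteq> Y"
    using diagram_downward[OF Y x, of _ 1] diagram_downward[OF Y y, of 1] ok by auto
  have "card ?C = r" "card ?R = s'" by (auto simp: card_image inj_on_def)
  moreover have "card (?C \<inter> ?R) \<le> (if k = j then 1 else 0)"
  proof -
    have "?C \<inter> ?R \<subseteq> (if k = j then {(k, 1, 1)} else {})" by auto
    from card_mono[OF _ this] show ?thesis by (auto split: if_splits)
  qed
  moreover have "card ?C + card ?R = card (?C \<union> ?R) + card (?C \<inter> ?R)" by (rule card_Un_Int) auto
  moreover have "card (?C \<union> ?R) \<le> card Y" by (rule card_mono[OF diagram_finite[OF Y] sub])
  ultimately show ?thesis by linarith
qed

text \<open>For \<open>x\<close> in row r and \<open>y\<close> in column s' the difference of the
  diagonals is at most r + s' - 2, which the hook bound controls; exchanging \<open>x\<close> and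
  \<open>y\<close> gives the other sign. The extra 1 for a common component is the corner shared by
  the arm and the leg of the hook.\<close>

lemma diag_difference:
  assumes Y: "diagram m Y" and x: "x \<in> Y" and y: "y \<in> Y"
  shows "\<bar>node_diag y - node_diag x\<bar> + 2 \<le> int (card Y) + (if fst x = fst y then 1 else 0)"
proof -
  obtain k r s j r' s' where xy: "x = (k, r, s)" "y = (j, r', s')" by (metis prod_cases3)
  have "1 \<le> r" "1 \<le> s" "1 \<le> r'" "1 \<le> s'" using diagram_node_ok[OF Y] x y xy by auto
  then show ?thesis
    using diagram_hook_card[OF Y, of k r s j r' s'] diagram_hook_card[OF Y, of j r' s' k r s] x y
    unfolding xy by (auto split: if_splits)
qed

text \<open>Two nodes of \<open>Z - Y\<close> on one diagonal force the right and the lower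
  neighbour of the upper one into \<open>Z - Y\<close> as well, which makes four nodes. Three is the
  number needed for the braid relation.\<close>

lemma diag_distinct:
  assumes Y: "diagram m Y" and Z: "diagram m Z" and small: "card (Z - Y) \<le> 3"
    and x: "x \<in> Z - Y" and y: "y \<in> Z - Y" and "x \<noteq> y" and "fst x = fst y"
  shows "node_diag x \<noteq> node_diag y"
proof
  assume eq: "node_diag x = node_diag y"
  have False if xy: "(k, r, s) \<in> Z - Y" "(k, r + t, s + t) \<in> Z - Y" "1 \<le> t" for k r s t
  proof -
    have ok: "1 \<le> r" "1 \<le> s" using diagram_node_ok[OF Z, of "(k, r, s)"] xy by auto
    have "(k, r, s + 1) \<in> Z" "(k, r + 1, s) \<in> Z"
      using diagram_downward[OF Z, of k "r + t" "s + t"] xy ok by auto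
    moreover have "(k, r, s + 1) \<notin> Y" "(k, r + 1, s) \<notin> Y"
      using diagram_downward[OF Y, of k r "s + 1" r s] diagram_downward[OF Y, of k "r + 1" s r s] xy ok by auto
    ultimately have "{(k, r, s), (k, r, s + 1), (k, r + 1, s), (k, r + t, s + t)} \<subseteq> Z - Y" using xy by auto
    from card_mono[OF _ this] diagram_finite[OF Z] small xy(3) show False by auto
  qed note * = this
  obtain k r s j r' s' where xy: "x = (k, r, s)" "y = (j, r', s')" by (metis prod_cases3)
  show False
  proof (cases "r \<le> r'")
    case True
    then have "s' = s + (r' - r)" "r' = r + (r' - r)" "j = k" "1 \<le> r' - r"
      using xy eq assms(6,7) by auto
    then show ?thesis using *[of k r s "r' - r"] x y xy by metis
  next
    case False
    then have "s = s' + (r - r')" "r = r' + (r - r')" "j = k" "1 \<le> r - r'"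
      using xy eq assms(6,7) by auto
    then show ?thesis using *[of k r' s' "r - r'"] x y xy by metis
  qed
qed

section \<open>Paths in the lattice of diagrams\<close>

definition path :: "nat \<Rightarrow> mnode list \<Rightarrow> bool" where
  "path m xs \<longleftrightarrow> distinct xs \<and> (\<forall>i. diagram m (set (take i xs)))"

definition paths :: "nat \<Rightarrow> nat \<Rightarrow> mnode list set" where
  "paths m n = {xs. path m xs \<and> length xs = n}"

lemma path_Nil [simp]: "path m []"
  by (simp add: path_def)

lemma path_snoc: "path m (xs @ [x]) \<longleftrightarrow> path m xs \<and> x \<notin> set xs \<and> diagram m (insert x (set xs))"
proof -
  have *: "set (take i (xs @ [x])) = (if i \<le> length xs then set (take i xs) else insert x (set xs))" for i
    by (cases "i - length xs") auto
  have "(\<forall>i. diagram m (set (take i (xs @ [x])))) \<longleftrightarrow>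
      (\<forall>i. diagram m (set (take i xs))) \<and> diagram m (insert x (set xs))" (is "?L \<longleftrightarrow> ?R")
  proof
    assume L: ?L
    have "diagram m (set (take i xs))" for i
    proof (cases "i \<le> length xs")
      case True
      then show ?thesis using spec[OF L, of i] by (simp only: * if_True)
    next
      case False
      then show ?thesis using spec[OF L, of "length xs"] by simp
    qed
    moreover have "diagram m (insert x (set xs))" using spec[OF L, of "Suc (length xs)"] by simp
    ultimately show ?R by blast
  next
    assume ?R
    then show ?L unfolding * by auto
  qed
  then show ?thesis by (auto simp: path_def)
qed

lemma path_diagram: "path m xs \<Longrightarrow> diagram m (set xs)"
  unfolding path_def by (metis take_all order_refl)

lemma path_appendD: "path m (us @ vs) \<Longrightarrow> path m us"
  by (induction vs rule: rev_induct) (auto simp: path_snoc simp flip: append_assoc)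

lemma path_distinct: "path m xs \<Longrightarrow> distinct xs"
  by (simp add: path_def)

lemma paths_finite: "finite (paths m n)"
proof -
  let ?N = "{1..m} \<times> {1..n} \<times> {1..n}"
  have "set xs \<subseteq> ?N" if "xs \<in> paths m n" for xs
  proof
    fix x assume x: "x \<in> set xs"
    have xs: "diagram m (set xs)" "card (set xs) = n"
      using that by (auto simp: paths_def path_diagram path_distinct distinct_card)
    obtain k r s where xe: "x = (k, r, s)" by (metis prod_cases3)
    show "x \<in> ?N"
      using diagram_node_ok[OF xs(1) x] diagram_hook_card[OF xs(1), of k r s k r s] x xs(2) xe by auto
  qed
  then have "paths m n \<subseteq> {xs. set xs \<subseteq> ?N \<and> length xs = n}" by (auto simp: paths_def)
  then show ?thesis by (rule finite_subset) (simp add: finite_lists_length_eq)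
qed

text \<open>Only the segment \<open>us @ [y]\<close> is new. It is a diagram iff
  \<open>preds y\<close> avoids \<open>x\<close>; that \<open>y\<close> is not in
  \<open>preds x\<close> is automatic, as \<open>x\<close> could be added before \<open>y\<close>.
  The segments reaching into \<open>vs\<close> have unchanged node sets.\<close>

lemma path_swap:
  assumes "path m (us @ x # y # vs)"
  shows "path m (us @ y # x # vs) \<longleftrightarrow> \<not> adjacent x y"
  using assms
proof (induction vs rule: rev_induct)
  case Nil
  from Nil have p: "path m ((us @ [x]) @ [y])" by simp
  then have us: "diagram m (set us)" "diagram m (insert x (set us))"
      "diagram m (insert y (insert x (set us)))" and d: "x \<notin> set us" "y \<notin> set us" "x \<noteq> y" "path m us"
    unfolding path_snoc by (auto dest: path_diagram)
  have x: "node_ok m x" "preds x \<subseteq> set us" using us diagram_insert by blast+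
  have y: "node_ok m y" "preds y \<subseteq> insert x (set us)" using us diagram_insert by blast+
  have "path m ((us @ [y]) @ [x]) \<longleftrightarrow> diagram m (insert y (set us))"
    unfolding path_snoc using us d by (auto simp: insert_commute)
  also have "\<dots> \<longleftrightarrow> preds y \<subseteq> set us" using diagram_insert[OF us(1)] y by blast
  also have "\<dots> \<longleftrightarrow> \<not> adjacent x y" using x y d by (auto simp: adjacent_def)
  finally show ?case by simp
next
  case (snoc z vs)
  from snoc.prems have "path m ((us @ x # y # vs) @ [z])" by simp
  then have "path m (us @ x # y # vs)" "z \<notin> set (us @ x # y # vs)" "diagram m (insert z (set (us @ x # y # vs)))"
    unfolding path_snoc by auto
  moreover have "path m ((us @ y # x # vs) @ [z]) \<longleftrightarrow> \<not> adjacent x y"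
    unfolding path_snoc using snoc.IH calculation by (auto simp: insert_commute)
  ultimately show ?case by simp
qed

text \<open>A node that maximises the sum of row and column within its component precedes no other
  node. The component is prescribed because \<open>diagonal_separates\<close> needs a corner next to
  given addable nodes.\<close>

lemma diagram_corner:
  assumes Y: "diagram m Y" and "z \<in> Y"
  obtains y where "y \<in> Y" "fst y = fst z" "diagram m (Y - {y})"
proof -
  let ?C = "{y \<in> Y. fst y = fst z}" and ?h = "\<lambda>(k::nat, r::nat, s::nat). r + s"
  have "z \<in> ?C" using assms(2) by simp
  then have ne: "finite ?C" "?C \<noteq> {}" using diagram_finite[OF Y] by (simp, blast)
  then have "Max (?h ` ?C) \<in> ?h ` ?C" by simp
  then obtain x where x: "x \<in> ?C" "Max (?h ` ?C) = ?h x" by blast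
  have max: "?h y \<le> ?h x" if "y \<in> ?C" for y
    using Max_ge[of "?h ` ?C" "?h y"] that ne x(2) by auto
  have "x \<notin> preds y" if "y \<in> Y" for y
  proof
    assume "x \<in> preds y"
    moreover from this have "fst y = fst x" by (cases y; cases x) (auto split: if_splits)
    moreover from this have "?h y \<le> ?h x" using max[of y] x(1) that by simp
    ultimately show False by (cases y; cases x) (auto split: if_splits)
  qed
  then have "diagram m (Y - {x})" using Y unfolding diagram_def by blast
  then show thesis using that[of x] x(1) by simp
qed

lemma diagram_obtain_path:
  assumes "diagram m Y"
  shows "\<exists>xs. path m xs \<and> set xs = Y"
  using assms
proof (induction "card Y" arbitrary: Y)
  case 0
  then have "Y = {}" using diagram_finite by fastforce
  then show ?case by (intro exI[of _ "[]"]) auto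
next
  case (Suc c)
  have fin: "finite Y" by (rule diagram_finite[OF Suc.prems])
  have "Y \<noteq> {}" using Suc.hyps(2) by auto
  then obtain z where "z \<in> Y" by blast
  with Suc.prems obtain x where x: "x \<in> Y" "diagram m (Y - {x})" by (rule diagram_corner)
  have "card (Y - {x}) = c" using Suc.hyps x fin by simp
  then obtain xs where "path m xs" "set xs = Y - {x}" using Suc.hyps(1) x(2) by metis
  then show ?case using Suc.prems x(1)
    by (intro exI[of _ "xs @ [x]"]) (auto simp: path_snoc insert_absorb)
qed


section \<open>The matrix coefficients\<close>

text \<open>The conditions on complex parameters without the identification of the field with the
  complex numbers. Generic parameters satisfy them too, so that both kinds are treated at
  once.\<close>

locale hecke_parameters =
  fixes m n :: nat and q :: "'k::field" and v :: "nat \<Rightarrow> 'k"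
  assumes m_pos: "1 \<le> m" and n_pos: "1 \<le> n"
    and q_nonzero: "q \<noteq> 0"
    and quantum: "\<And>N. N < n \<Longrightarrow> (\<Sum>i=0..N. q ^ (2 * i)) \<noteq> 0"
    and separated: "\<And>i j k. j \<in> {1..m} \<Longrightarrow> k \<in> {1..m} \<Longrightarrow> j \<noteq> k \<Longrightarrow> - int n < i \<Longrightarrow> i < int n \<Longrightarrow>
        q powi (2 * i) * v j \<noteq> v k"
    and v_nonzero: "\<And>j. j \<in> {1..m} \<Longrightarrow> v j \<noteq> 0"
begin

abbreviation cont :: "mnode \<Rightarrow> 'k" where "cont \<equiv> node_content q v"

definition p :: 'k where "p = q - inverse q"

lemma cont_nonzero: "node_ok m x \<Longrightarrow> cont x \<noteq> 0"
  using v_nonzero q_nonzero by (cases x) auto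

text \<open>For k = |d| factor q^(2k) - 1 as q^2 - 1 times 1 + q^2 + ... + q^(2(k-1)); the second
  factor is nonzero as k is at most \<open>n\<close>. Once q^2 = 1, that same factor is k, so axial
  distances up to \<open>n\<close> are invertible.\<close>

lemma root_of_unity:
  assumes "d \<noteq> 0" "\<bar>d\<bar> \<le> int n" "q powi (2 * d) = 1"
  shows "q\<^sup>2 = 1 \<and> of_int d \<noteq> (0::'k)"
proof -
  define k where "k = nat \<bar>d\<bar>"
  have k: "1 \<le> k" "k \<le> n" using assms by (auto simp: k_def)
  have "q powi (2 * int k) = 1"
    using assms by (cases "d \<ge> 0") (auto simp: k_def power_int_minus)
  then have *: "q ^ (2 * k) = 1"
    by (metis of_nat_mult of_nat_numeral power_int_of_nat)
  have sum: "(\<Sum>i<k. (q\<^sup>2) ^ i) \<noteq> 0"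
    using quantum[of "k - 1"] k by (simp add: power_mult atLeast0AtMost flip: lessThan_Suc_atMost)
  have "(q\<^sup>2 - 1) * (\<Sum>i<k. (q\<^sup>2) ^ i) = (q\<^sup>2) ^ k - 1" by (simp add: power_diff_1_eq)
  also have "\<dots> = 0" using * by (simp add: power_mult)
  finally have q2: "q\<^sup>2 = 1" using sum by simp
  then have "of_nat k \<noteq> (0::'k)" using sum by simp
  then have "of_int d \<noteq> (0::'k)"
  proof -
    have "d = int k \<or> d = - int k" by (auto simp: k_def)
    then show ?thesis using \<open>of_nat k \<noteq> (0::'k)\<close> by auto
  qed
  with q2 show ?thesis by simp
qed

text \<open>The shift \<open>i\<close> is 0 when contents are compared, 1 when an off-diagonal
  coefficient vanishes, and the difference of the diagonals in the case of adjacent nodes.\<close>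

lemma cont_eq_same_component:
  assumes "node_ok m x" "fst x = fst y"
  shows "q powi (2 * i) * cont x = cont y \<longleftrightarrow> q powi (2 * (node_diag x - node_diag y + i)) = 1"
proof -
  obtain k r s j r' s' where xy: "x = (k, r, s)" "y = (j, r', s')" by (metis prod_cases3)
  let ?d = "node_diag x" and ?e = "node_diag y"
  have v: "v k \<noteq> 0" "j = k" using assms xy v_nonzero by auto
  have "q powi (2 * (?d - ?e + i)) = q powi (2 * i) * q powi (2 * ?d) / q powi (2 * ?e)"
    using q_nonzero by (simp add: algebra_simps power_int_add power_int_diff)
  then show ?thesis using v q_nonzero by (auto simp: xy field_simps)
qed

lemma cont_eq_other_component:
  assumes "node_ok m x" "node_ok m y" "fst x \<noteq> fst y" "\<bar>node_diag x - node_diag y + i\<bar> < int n"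
  shows "q powi (2 * i) * cont x \<noteq> cont y"
proof
  assume eq: "q powi (2 * i) * cont x = cont y"
  obtain k r s j r' s' where xy: "x = (k, r, s)" "y = (j, r', s')" by (metis prod_cases3)
  let ?d = "node_diag x" and ?e = "node_diag y"
  have "q powi (2 * (?d - ?e + i)) = q powi (2 * i) * q powi (2 * ?d) / q powi (2 * ?e)"
    using q_nonzero by (simp add: algebra_simps power_int_add power_int_diff)
  moreover have "q powi (2 * i) * (v k * q powi (2 * ?d)) = v j * q powi (2 * ?e)" using eq by (simp add: xy)
  moreover have "X * a = b" if "X = A * B / C" "A * (a * B) = b * C" "C \<noteq> 0" for X A B C a b :: 'k
  proof -
    have "X * a = A * (a * B) / C" by (simp add: that(1))
    also have "\<dots> = b" by (simp add: that(2,3))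
    finally show ?thesis .
  qed
  moreover have "q powi (2 * ?e) \<noteq> 0" using q_nonzero by simp
  ultimately have "q powi (2 * (?d - ?e + i)) * v k = v j" by blast
  moreover have "q powi (2 * (?d - ?e + i)) * v k \<noteq> v j"
    by (rule separated) (use assms in \<open>auto simp: xy\<close>)
  ultimately show False by contradiction
qed

text \<open>The second alternative is the case of equal contents, which is admissible for \<open>q\<^sup>2 = 1\<close> only.\<close>

definition good :: "mnode \<Rightarrow> mnode \<Rightarrow> bool" where
  "good x y \<longleftrightarrow> cont x \<noteq> cont y \<or> q\<^sup>2 = 1 \<and> of_int (node_diag y - node_diag x) \<noteq> (0::'k)"

text \<open>With at most \<open>n + 1\<close> nodes the diagonals differ by at most \<open>n\<close>
  in one component, the range of \<open>root_of_unity\<close>, and by less than \<open>n\<close> in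
  different ones, the range of \<open>separated\<close>. The bound is \<open>n + 1\<close> rather
  than \<open>n\<close> since two different extensions of a path of length \<open>n - 1\<close> are
  compared.\<close>

lemma goodI:
  assumes Z: "diagram m Z" and card: "card Z \<le> n + 1" and x: "x \<in> Z" and y: "y \<in> Z"
    and diag: "fst x = fst y \<Longrightarrow> node_diag x \<noteq> node_diag y"
  shows "good x y"
proof (cases "fst x = fst y")
  case True
  have "q powi (2 * (node_diag x - node_diag y + 0)) = 1" if "cont x = cont y"
    using cont_eq_same_component[OF diagram_node_ok[OF Z x] True, of 0] that by simp
  moreover have "node_diag x - node_diag y \<noteq> 0" "\<bar>node_diag x - node_diag y\<bar> \<le> int n"
    using diag_difference[OF Z x y] diag card True by auto
  ultimately show ?thesis
    using root_of_unity[of "node_diag x - node_diag y"] by (auto simp: good_def)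
next
  case False
  then show ?thesis
    using cont_eq_other_component[OF diagram_node_ok[OF Z x] diagram_node_ok[OF Z y] False, of 0]
      diag_difference[OF Z x y] card by (auto simp: good_def)
qed

lemma good_skew:
  assumes "diagram m Y" "diagram m Z" "card (Z - Y) \<le> 3" "card Z \<le> n + 1"
    and "x \<in> Z - Y" "y \<in> Z - Y" "x \<noteq> y"
  shows "good x y"
  by (rule goodI[OF assms(2,4)]) (use assms diag_distinct in auto)

section \<open>Identities for the coefficients of two and three nodes\<close>

definition diag_entry :: "mnode \<Rightarrow> mnode \<Rightarrow> 'k" where
  "diag_entry x y = (if cont y \<noteq> cont x then p * cont y / (cont y - cont x)
             else q / of_int (node_diag y - node_diag x))"

text \<open>If \<open>x\<close> and \<open>y\<close> are adjacent, they cannot be interchanged.  The value 0 makes the formula for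
  the product of the two off-diagonal coefficients valid in this case, too.\<close>

definition offdiag_entry :: "mnode \<Rightarrow> mnode \<Rightarrow> 'k" where
  "offdiag_entry x y = (if adjacent x y then 0 else diag_entry x y + inverse q)"

lemma inverse_q: "q\<^sup>2 = 1 \<Longrightarrow> inverse q = q"
  by (simp add: power2_eq_square inverse_unique)

lemma p_zero: "q\<^sup>2 = 1 \<Longrightarrow> p = 0"
  by (simp add: p_def inverse_q)

text \<open>The trace of \<open>\<sigma> i\<close> on the span of the two orders of \<open>x\<close>
  and \<open>y\<close>: its eigenvalues q and -1/q add up to \<open>p\<close>.\<close>

lemma diag_entry_sum:
  assumes "good x y"
  shows "diag_entry x y + diag_entry y x = p"
proof (cases "cont x = cont y")
  case True
  then have "q\<^sup>2 = 1" using assms by (simp add: good_def)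
  moreover have "of_int (node_diag x - node_diag y) = - (of_int (node_diag y - node_diag x) :: 'k)" by simp
  then have "q / of_int (node_diag y - node_diag x) + q / of_int (node_diag x - node_diag y) = 0"
    by (simp only: divide_minus_right right_minus)
  ultimately show ?thesis using True by (simp add: diag_entry_def p_zero)
next
  case False
  then show ?thesis by (simp add: diag_entry_def) (simp add: divide_simps, simp add: algebra_simps)
qed

lemma diag_entry_cont: "good x y \<Longrightarrow> diag_entry x y * (cont y - cont x) = p * cont y"
  by (auto simp: diag_entry_def good_def p_zero)

text \<open>A partial fraction identity in the contents or, for q^2 = 1 and equal contents, in the
  axial distances. It is the only condition that the braid relation imposes on three nodes beyond
  those on pairs.\<close>

lemma diag_entry_triple:
  assumes "good x y" "good y z" "good x z"
  shows "diag_entry x y * diag_entry y z + diag_entry x z * diag_entry y x = diag_entry x z * diag_entry y z"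
proof (cases "q\<^sup>2 = 1")
  case False
  then have ne: "cont x \<noteq> cont y" "cont y \<noteq> cont z" "cont x \<noteq> cont z"
    using assms by (auto simp: good_def)
  define X Y Z where "X = cont x" and "Y = cont y" and "Z = cont z"
  have ne': "Y - X \<noteq> 0" "Z - Y \<noteq> 0" "Z - X \<noteq> 0" "X - Y \<noteq> 0" using ne by (auto simp: X_def Y_def Z_def)
  have "diag_entry x y = p * Y / (Y - X)" "diag_entry y z = p * Z / (Z - Y)" "diag_entry x z = p * Z / (Z - X)" "diag_entry y x = - (p * X / (Y - X))"
    using ne minus_divide_right[of "p * X" "Y - X"] by (auto simp: diag_entry_def X_def Y_def Z_def)
  moreover have "p * Y / (Y - X) * (p * Z / (Z - Y)) + p * Z / (Z - X) * (- (p * X / (Y - X)))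
      = p * Z / (Z - X) * (p * Z / (Z - Y))"
    using ne' by (simp add: divide_simps) (simp add: algebra_simps)
  ultimately show ?thesis by simp
next
  case True
  show ?thesis
  proof (cases "cont x = cont y \<and> cont y = cont z")
    case True
    define d e where "d = (of_int (node_diag y - node_diag x) :: 'k)" and "e = (of_int (node_diag z - node_diag y) :: 'k)"
    have "d \<noteq> 0" "e \<noteq> 0" "d + e \<noteq> 0"
      using assms True by (auto simp: good_def d_def e_def)
    then have "q / d * (q / e) + q / (d + e) * (- (q / d)) = q / (d + e) * (q / e)"
      by (simp add: divide_simps) (simp add: distrib_left mult_ac)
    moreover have "diag_entry x y = q / d" "diag_entry y z = q / e" "diag_entry x z = q / (d + e)" "diag_entry y x = - (q / d)"
      using True minus_divide_right[of q d] by (auto simp: diag_entry_def d_def e_def)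
    ultimately show ?thesis by (simp only:)
  next
    case False
    \<comment> \<open>Each product involves two of the three pairs, so one of its factors belongs to
      nodes of different content and vanishes because \<open>p\<close> is 0.\<close>
    then show ?thesis using True by (auto simp: diag_entry_def p_zero)
  qed
qed

text \<open>Adjacent nodes give a block of size one, and the coefficient is an eigenvalue of
  \<open>\<sigma> i\<close>: q if the diagonal increases by 1 from \<open>x\<close> to
  \<open>y\<close>, and -1/q if it decreases by 1.\<close>

lemma diag_entry_adjacent:
  assumes "adjacent x y" "node_ok m x" "node_ok m y" "good x y"
  shows "(diag_entry x y + inverse q) * (q - diag_entry x y) = 0"
proof -
  obtain k r s j r' s' where xy: "x = (k, r, s)" "y = (j, r', s')" by (metis prod_cases3)
  define d where "d = node_diag y - node_diag x"
  have d: "d = 1 \<or> d = -1" and kj: "fst x = fst y"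
    using assms(1) by (auto simp: adjacent_def xy d_def split: if_splits)
  have c: "cont y = q powi (2 * d) * cont x"
    using cont_eq_same_component[OF assms(2) kj, of d] by (simp add: d_def)
  have cx: "cont x \<noteq> 0" by (rule cont_nonzero[OF assms(2)])
  show ?thesis
  proof (cases "cont x = cont y")
    case True
    then have "q\<^sup>2 = 1" "diag_entry x y = q / of_int d" using assms(4) by (auto simp: good_def diag_entry_def d_def)
    then show ?thesis using d by (auto simp: inverse_q)
  next
    case False
    then have g: "diag_entry x y = p * cont y / (cont y - cont x)" by (simp add: diag_entry_def)
    have q2: "q * q \<noteq> 1" using False c d by (auto simp: power_int_minus power2_eq_square)
    from d show ?thesis
    proof
      assume "d = 1"
      then have "diag_entry x y = cont x * (p * (q * q)) / (cont x * (q * q - 1))"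
        using g c by (simp add: power2_eq_square algebra_simps)
      also have "\<dots> = p * (q * q) / (q * q - 1)" using cx by simp
      also have "\<dots> = q" using q2 q_nonzero by (simp add: p_def field_simps)
      finally show ?thesis by simp
    next
      assume "d = -1"
      then have cy: "cont x = q * q * cont y" using c q_nonzero by (simp add: power_int_minus power2_eq_square field_simps)
      have "cont y \<noteq> 0" using assms(3) cont_nonzero by auto
      moreover have "diag_entry x y = cont y * p / (cont y * (1 - q * q))"
        using g cy by (simp add: algebra_simps)
      ultimately have "diag_entry x y = p / (1 - q * q)" by simp
      also have "\<dots> = - inverse q" using q2 q_nonzero by (simp add: p_def field_simps)
      finally show ?thesis by simp
    qed
  qed
qed

text \<open>Together with the trace this says that the block has determinant -1. For adjacent nodes
  both sides are 0.\<close>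

lemma offdiag_entry_product:
  assumes "node_ok m x" "node_ok m y" "good x y"
  shows "offdiag_entry x y * offdiag_entry y x = (diag_entry x y + inverse q) * (q - diag_entry x y)"
proof (cases "adjacent x y")
  case True
  then show ?thesis using diag_entry_adjacent assms by (simp add: offdiag_entry_def)
next
  case False
  have "diag_entry y x = p - diag_entry x y" using diag_entry_sum[OF assms(3)] by (simp add: algebra_simps)
  then show ?thesis using False by (simp add: offdiag_entry_def adjacent_sym p_def)
qed

text \<open>Away from equal contents the coefficient vanishes iff q^2 times the content of
  \<open>y\<close> is the content of \<open>x\<close>. Two corners of one component are at least two
  diagonals apart, and \<open>n\<close> nodes instead of \<open>n + 1\<close> leave room for the
  shift by q^2. The lemma lets \<open>\<sigma> l\<close> lead from paths ending in one corner to
  paths ending in another.\<close>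

lemma offdiag_entry_nonzero:
  assumes Z: "diagram m Z" and card: "card Z \<le> n" and x: "x \<in> Z" and y: "y \<in> Z" and "x \<noteq> y"
    and rx: "diagram m (Z - {x})" and ry: "diagram m (Z - {y})"
  shows "offdiag_entry x y \<noteq> 0"
proof
  assume 0: "offdiag_entry x y = 0"
  obtain k r s j r' s' where xy: "x = (k, r, s)" "y = (j, r', s')" by (metis prod_cases3)
  note ok = diagram_node_ok[OF Z x] diagram_node_ok[OF Z y]
  have corners: "r < r' \<and> s' < s \<or> r' < r \<and> s < s'" if "k = j"
  proof -
    have "\<not> (r \<le> r' \<and> s \<le> s')" "\<not> (r' \<le> r \<and> s' \<le> s)"
      using diagram_remove_closed[OF Z rx xy(1), of r' s'] diagram_remove_closed[OF Z ry xy(2), of r s]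
        that x y xy \<open>x \<noteq> y\<close> by auto
    then show ?thesis by linarith
  qed
  then have "\<not> adjacent x y" using xy by (auto simp: adjacent_def split: if_splits)
  with 0 have g: "diag_entry x y + inverse q = 0" by (simp add: offdiag_entry_def)
  \<comment> \<open>The summand 1 accounts for the factor q^2; \<open>D\<close> is nonzero as no two
    corners of a component lie on the same or on neighbouring diagonals.\<close>
  define D where "D = node_diag y - node_diag x + 1"
  have D: "D \<noteq> 0" "\<bar>D\<bar> \<le> int n" if "fst x = fst y"
    using corners diag_difference[OF Z x y] card that xy by (auto simp: D_def)
  have good: "good x y"
    by (rule goodI[OF Z _ x y]) (use card corners xy in auto)
  show False
  proof (cases "cont x = cont y")
    case True
    then have q2: "q\<^sup>2 = 1" and d: "of_int (node_diag y - node_diag x) \<noteq> (0::'k)"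
      using good by (auto simp: good_def)
    have same: "fst x = fst y"
    proof (rule ccontr)
      assume ne: "fst x \<noteq> fst y"
      then have "\<bar>node_diag x - node_diag y + 0\<bar> < int n"
        using diag_difference[OF Z x y] card by simp
      from cont_eq_other_component[OF ok ne this] True show False by simp
    qed
    have "q powi (2 * D) = (q\<^sup>2) powi D" by (simp add: power_int_mult)
    then have "of_int D \<noteq> (0::'k)" using root_of_unity[of D] D[OF same] q2 by simp
    moreover have "q / of_int (node_diag y - node_diag x) + q = 0"
      using g True q2 by (simp add: diag_entry_def inverse_q)
    then have "q * of_int D = 0" using d by (simp add: D_def field_simps)
    ultimately show False using q_nonzero by simp
  next
    case False
    then have "p * cont y / (cont y - cont x) + inverse q = 0" using g by (simp add: diag_entry_def)
    then have "q * (p * cont y) + (cont y - cont x) = 0" using False q_nonzero by (simp add: field_simps)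
    moreover have "q * p = q * q - 1" using q_nonzero by (simp add: p_def right_diff_distrib)
    ultimately have "(q * q - 1) * cont y + (cont y - cont x) = 0" by (metis mult.assoc)
    then have "q * q * cont y = cont x" by (simp add: left_diff_distrib)
    then have eq: "q powi (2 * 1) * cont y = cont x" by (simp add: power2_eq_square)
    show False
    proof (cases "fst x = fst y")
      case True
      then have "q powi (2 * D) = 1"
        using cont_eq_same_component[OF ok(2), of x 1] eq by (simp add: D_def)
      then have "q\<^sup>2 = 1" using root_of_unity D[OF True] by blast
      then show False using eq False by simp
    next
      case other: False
      then have "\<bar>node_diag y - node_diag x + 1\<bar> < int n"
        using diag_difference[OF Z x y] card by simp
      from cont_eq_other_component[OF ok(2,1) _ this] other eq show False by auto
    qed
  qed
qed

end


section \<open>The relations\<close>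

context hecke_parameters
begin

definition swp :: "nat \<Rightarrow> mnode list \<Rightarrow> mnode list" where
  "swp i xs = xs[i - 1 := xs ! i, i := xs ! (i - 1)]"

text \<open>The table covers all lists, without asking whether the exchanged list is a path: where
  it is not, \<open>offdiag_entry\<close> is 0. Positions count from 0, so the nodes carrying
  \<open>i\<close> and \<open>i + 1\<close> are \<open>xs ! (i - 1)\<close> and
  \<open>xs ! i\<close>.\<close>

fun gen_on_path :: "hgen \<Rightarrow> mnode list \<Rightarrow> (mnode list \<Rightarrow>\<^sub>0 'k)" where
  "gen_on_path Tau xs = scale (cont (hd xs)) (bas xs)"
| "gen_on_path (Sigma i) xs = scale (diag_entry (xs ! (i - 1)) (xs ! i)) (bas xs)
     + scale (offdiag_entry (xs ! (i - 1)) (xs ! i)) (bas (swp i xs))"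

declare gen_on_path.simps(2) [simp del]

abbreviation L :: "hgen \<Rightarrow> (mnode list \<Rightarrow>\<^sub>0 'k) \<Rightarrow> (mnode list \<Rightarrow>\<^sub>0 'k)" where
  "L h \<equiv> linear_extension (gen_on_path h)"

lemma gen_on_path_Sigma:
  assumes "i = Suc (length us)"
  shows "gen_on_path (Sigma i) (us @ x # y # vs)
    = scale (diag_entry x y) (bas (us @ x # y # vs)) + scale (offdiag_entry x y) (bas (us @ y # x # vs))"
  using assms by (simp add: gen_on_path.simps swp_def nth_append list_update_append)

lemma split_at_two:
  assumes "1 \<le> i" "i < length xs"
  obtains us x y vs where "xs = us @ x # y # vs" "i = Suc (length us)"
proof -
  have "xs = take (i - 1) xs @ xs ! (i - 1) # xs ! i # drop (Suc i) xs"
    using assms id_take_nth_drop[of "i - 1" xs] Cons_nth_drop_Suc[of i xs] by simp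
  with that[of "take (i - 1) xs"] show ?thesis using assms by simp
qed

lemma path_pair:
  assumes "path m (us @ x # y # vs)" "length (us @ x # y # vs) \<le> n"
  shows "good x y" "node_ok m x" "node_ok m y" "x \<noteq> y"
proof -
  have p: "path m ((us @ [x, y]) @ vs)" using assms by simp
  have Y: "diagram m (set us)" by (rule path_diagram[OF path_appendD[OF assms(1)]])
  have Z: "diagram m (set us \<union> {x, y})" using path_diagram[OF path_appendD[OF p]] by simp
  have d: "distinct (us @ [x, y])" using path_distinct[OF path_appendD[OF p]] .
  show "good x y"
  proof (rule good_skew[OF Y Z])
    have "card (set us \<union> {x, y}) = length (us @ [x, y])" using distinct_card[OF d] by simp
    then show "card (set us \<union> {x, y}) \<le> n + 1" using assms by simp
    have "card (set us \<union> {x, y} - set us) \<le> card {x, y}" by (rule card_mono) auto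
    then show "card (set us \<union> {x, y} - set us) \<le> 3" using card_length[of "[x, y]"] by simp
  qed (use d in auto)
  show "node_ok m x" "node_ok m y" "x \<noteq> y" using diagram_node_ok[OF Z] d by auto
qed

lemma path_triple:
  assumes "path m (us @ x # y # z # vs)" "length (us @ x # y # z # vs) \<le> n"
  shows "good x y" "good y z" "good x z" "node_ok m x" "node_ok m y" "node_ok m z"
proof -
  have p: "path m ((us @ [x, y, z]) @ vs)" using assms by simp
  have Y: "diagram m (set us)" by (rule path_diagram[OF path_appendD[OF assms(1)]])
  have Z: "diagram m (set us \<union> {x, y, z})" using path_diagram[OF path_appendD[OF p]] by simp
  have d: "distinct (us @ [x, y, z])" using path_distinct[OF path_appendD[OF p]] .
  have c: "card (set us \<union> {x, y, z}) \<le> n + 1"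
    using distinct_card[OF d] assms by simp
  have "card (set us \<union> {x, y, z} - set us) \<le> card {x, y, z}" by (rule card_mono) auto
  then have c3: "card (set us \<union> {x, y, z} - set us) \<le> 3" using card_length[of "[x, y, z]"] by simp
  note gs = good_skew[OF Y Z c3 c]
  show "good x y" "good y z" "good x z" by (rule gs; use d in auto)+
  show "node_ok m x" "node_ok m y" "node_ok m z" using diagram_node_ok[OF Z] by auto
qed

lemma path_hd:
  assumes "path m (x # xs)"
  obtains k where "x = (k, 1, 1)" "k \<in> {1..m}"
proof -
  have "diagram m {x}" using path_diagram[OF path_appendD[of m "[x]" xs]] assms by simp
  then have x: "node_ok m x" "preds x \<subseteq> {x}" by (auto simp: diagram_def)
  then show ?thesis using that not_in_preds_self[OF x(1)]
    by (cases x) (auto split: if_splits)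
qed

text \<open>Both sides are compared coefficient by coefficient on the six orders of
  \<open>x\<close>, \<open>y\<close>, \<open>z\<close>. Three coefficients agree as they stand; the
  other three are \<open>E1\<close>, \<open>E2\<close> and \<open>E3\<close>, multiples of the
  triple identity \<open>T\<close>.\<close>

lemma braid_relation:
  assumes "path m (us @ x # y # z # vs)" "length (us @ x # y # z # vs) \<le> n"
    and i: "i = Suc (length us)"
  shows "L (Sigma i) (L (Sigma (Suc i)) (L (Sigma i) (bas (us @ x # y # z # vs))))
      = L (Sigma (Suc i)) (L (Sigma i) (L (Sigma (Suc i)) (bas (us @ x # y # z # vs))))"
proof (rule poly_mapping_eqI)
  fix k
  define B where "B a b c = (bas (us @ a # b # c # vs) :: _ \<Rightarrow>\<^sub>0 'k)" for a b c :: mnode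
  have S1: "L (Sigma i) (B a b c) = scale (diag_entry a b) (B a b c) + scale (offdiag_entry a b) (B b a c)" for a b c
    using gen_on_path_Sigma[OF i, of a b "c # vs"] by (simp add: B_def)
  have S2: "L (Sigma (Suc i)) (B a b c) = scale (diag_entry b c) (B a b c) + scale (offdiag_entry b c) (B a c b)" for a b c
    using gen_on_path_Sigma[of "Suc i" "us @ [a]" b c vs] i by (simp add: B_def)
  define l where "l a b c = Poly_Mapping.lookup (B a b c) k" for a b c
  define a b c where "a = diag_entry x y" and "b = diag_entry x z" and "c = diag_entry y z"
  note good = path_triple[OF assms(1,2)]
  have g': "diag_entry y x = p - a" "diag_entry z y = p - c"
    using diag_entry_sum[OF good(1)] diag_entry_sum[OF good(2)] by (simp_all add: a_def c_def algebra_simps)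
  have T: "a * c + b * (p - a) = b * c"
    using diag_entry_triple[OF good(1-3)] by (simp add: a_def b_def c_def g'[unfolded a_def])
  have sq: "(t + inverse q) * (q - t) = 1 + p * t - t * t" for t
    using q_nonzero by (simp add: p_def algebra_simps)
  have F: "offdiag_entry x y * offdiag_entry y x = 1 + p * a - a * a" "offdiag_entry y z * offdiag_entry z y = 1 + p * c - c * c"
    using offdiag_entry_product good sq by (simp_all add: a_def c_def)
  have E2: "b * (offdiag_entry x y * (p - a)) + a * c * offdiag_entry x y = b * c * offdiag_entry x y"
    using arg_cong[OF T, of "\<lambda>t. t * offdiag_entry x y"] by (simp add: algebra_simps)
  have E3: "a * b * offdiag_entry y z = a * c * offdiag_entry y z + b * (p - c) * offdiag_entry y z"
    using arg_cong[OF T, of "\<lambda>t. t * offdiag_entry y z"] by (simp add: algebra_simps)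
  \<comment> \<open>The two coefficients of the original order differ by \<open>a - c\<close> times
    the identity \<open>T\<close>, once the off-diagonal products are replaced by their values
    \<open>F\<close>.\<close>
  have "a * a * c + b * (1 + p * a - a * a) - (a * c * c + b * (1 + p * c - c * c))
      = (a - c) * (a * c + b * (p - a) - b * c)" by (simp add: algebra_simps)
  then have E1: "a * a * c + b * (offdiag_entry x y * offdiag_entry y x) = a * c * c + b * (offdiag_entry y z * offdiag_entry z y)"
    unfolding F using T by simp
  have "Poly_Mapping.lookup (L (Sigma i) (L (Sigma (Suc i)) (L (Sigma i) (B x y z)))) k
    = (a * a * c + b * (offdiag_entry x y * offdiag_entry y x)) * l x y z
      + (b * (offdiag_entry x y * (p - a)) + a * c * offdiag_entry x y) * l y x z
      + a * b * offdiag_entry y z * l x z y + a * offdiag_entry y z * offdiag_entry x z * l z x y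
      + offdiag_entry x y * offdiag_entry x z * c * l y z x + offdiag_entry x y * offdiag_entry x z * offdiag_entry y z * l z y x"
    by (simp add: S1 S2 lookup_add l_def[symmetric] g' a_def[symmetric] b_def[symmetric] c_def[symmetric])
       (simp add: algebra_simps)
  also have "\<dots> = (a * c * c + b * (offdiag_entry y z * offdiag_entry z y)) * l x y z + b * c * offdiag_entry x y * l y x z
      + (a * c * offdiag_entry y z + b * (p - c) * offdiag_entry y z) * l x z y + a * offdiag_entry y z * offdiag_entry x z * l z x y
      + offdiag_entry x y * offdiag_entry x z * c * l y z x + offdiag_entry x y * offdiag_entry x z * offdiag_entry y z * l z y x"
    by (simp only: E1 E2 E3)
  also have "\<dots> = Poly_Mapping.lookup (L (Sigma (Suc i)) (L (Sigma i) (L (Sigma (Suc i)) (B x y z)))) k"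
    by (simp add: S1 S2 lookup_add l_def[symmetric] g' a_def[symmetric] b_def[symmetric] c_def[symmetric])
       (simp add: algebra_simps)
  finally show "Poly_Mapping.lookup (L (Sigma i) (L (Sigma (Suc i)) (L (Sigma i) (bas (us @ x # y # z # vs))))) k
      = Poly_Mapping.lookup (L (Sigma (Suc i)) (L (Sigma i) (L (Sigma (Suc i)) (bas (us @ x # y # z # vs))))) k"
    by (simp only: B_def)
qed

lemma far_relation:
  assumes "i = Suc (length us)" "j = Suc (length (us @ x # y # ws))"
  shows "L (Sigma i) (L (Sigma j) (bas (us @ x # y # ws @ z # t # vs)))
      = L (Sigma j) (L (Sigma i) (bas (us @ x # y # ws @ z # t # vs)))"
proof -
  define B where "B a b c d = (bas (us @ a # b # ws @ c # d # vs) :: _ \<Rightarrow>\<^sub>0 'k)" for a b c d :: mnode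
  have S1: "L (Sigma i) (B a b c d) = scale (diag_entry a b) (B a b c d) + scale (offdiag_entry a b) (B b a c d)" for a b c d
    using gen_on_path_Sigma[OF assms(1), of a b "ws @ c # d # vs"] by (simp add: B_def)
  have S2: "L (Sigma j) (B a b c d) = scale (diag_entry c d) (B a b c d) + scale (offdiag_entry c d) (B a b d c)" for a b c d
    using gen_on_path_Sigma[of j "us @ a # b # ws" c d vs] assms by (simp add: B_def)
  have "L (Sigma i) (L (Sigma j) (B x y z t)) = L (Sigma j) (L (Sigma i) (B x y z t))"
    by (simp add: S1 S2 PM.scale_right_distrib add_ac mult_ac)
  then show ?thesis by (simp only: B_def)
qed

lemma quadratic_relation:
  assumes "path m (us @ x # y # vs)" "length (us @ x # y # vs) \<le> n" and i: "i = Suc (length us)"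
  shows "L (Sigma i) (L (Sigma i) (bas (us @ x # y # vs)))
    = scale p (L (Sigma i) (bas (us @ x # y # vs))) + bas (us @ x # y # vs)"
proof (rule poly_mapping_eqI)
  fix k
  define B where "B a b = (bas (us @ a # b # vs) :: _ \<Rightarrow>\<^sub>0 'k)" for a b :: mnode
  have S: "L (Sigma i) (B a b) = scale (diag_entry a b) (B a b) + scale (offdiag_entry a b) (B b a)" for a b
    using gen_on_path_Sigma[OF i, of a b] by (simp add: B_def)
  define l where "l a b = Poly_Mapping.lookup (B a b) k" for a b
  define a where "a = diag_entry x y"
  note pr = path_pair[OF assms(1,2)]
  have g': "diag_entry y x = p - a" using diag_entry_sum[OF pr(1)] by (simp add: a_def algebra_simps)
  have F: "offdiag_entry x y * offdiag_entry y x = 1 + p * a - a * a"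
    using offdiag_entry_product[OF pr(2,3,1)] q_nonzero by (simp add: p_def a_def algebra_simps)
  have "Poly_Mapping.lookup (L (Sigma i) (L (Sigma i) (B x y))) k
      = (a * a + offdiag_entry x y * offdiag_entry y x) * l x y + p * offdiag_entry x y * l y x"
    by (simp add: S lookup_add l_def[symmetric] g' a_def[symmetric]) (simp add: algebra_simps)
  also have "\<dots> = Poly_Mapping.lookup (scale p (L (Sigma i) (B x y)) + B x y) k"
    unfolding F by (simp add: S lookup_add l_def[symmetric] a_def[symmetric]) (simp add: algebra_simps)
  finally show "Poly_Mapping.lookup (L (Sigma i) (L (Sigma i) (bas (us @ x # y # vs)))) k
    = Poly_Mapping.lookup (scale p (L (Sigma i) (bas (us @ x # y # vs))) + bas (us @ x # y # vs)) k"
    by (simp only: B_def)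
qed

text \<open>\<open>T\<close> stands for the preceding Jucys-Murphy element, of which only the
  eigenvalues on the two orders of \<open>x\<close> and \<open>y\<close> matter. The last hypothesis
  is conditional because the exchanged list need not be a path when the coefficient is 0.\<close>

lemma jucys_murphy_step:
  assumes "path m (us @ x # y # vs)" "length (us @ x # y # vs) \<le> n" and i: "i = Suc (length us)"
    and T: "lin T" "T (bas (us @ x # y # vs)) = scale (cont x) (bas (us @ x # y # vs))"
      "offdiag_entry x y \<noteq> 0 \<Longrightarrow> T (bas (us @ y # x # vs)) = scale (cont y) (bas (us @ y # x # vs))"
  shows "L (Sigma i) (T (L (Sigma i) (bas (us @ x # y # vs)))) = scale (cont y) (bas (us @ x # y # vs))"
proof (rule poly_mapping_eqI)
  fix k
  define B where "B a b = (bas (us @ a # b # vs) :: _ \<Rightarrow>\<^sub>0 'k)" for a b :: mnode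
  have S: "L (Sigma i) (B a b) = scale (diag_entry a b) (B a b) + scale (offdiag_entry a b) (B b a)" for a b
    using gen_on_path_Sigma[OF i, of a b] by (simp add: B_def)
  define l where "l a b = Poly_Mapping.lookup (B a b) k" for a b
  define a where "a = diag_entry x y"
  note pr = path_pair[OF assms(1,2)]
  have g': "diag_entry y x = p - a" using diag_entry_sum[OF pr(1)] by (simp add: a_def algebra_simps)
  have F: "offdiag_entry x y * offdiag_entry y x = 1 + p * a - a * a"
    using offdiag_entry_product[OF pr(2,3,1)] q_nonzero by (simp add: p_def a_def algebra_simps)
  have C: "a * cont y = p * cont y + a * cont x" using diag_entry_cont[OF pr(1)] by (simp add: a_def algebra_simps)
  have TS: "T (L (Sigma i) (B x y)) = scale (a * cont x) (B x y) + scale (offdiag_entry x y * cont y) (B y x)"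
    using T(2,3) unfolding S
    by (cases "offdiag_entry x y = 0") (simp_all add: PMP.linear_add[OF T(1)] PMP.linear_scale[OF T(1)] a_def B_def)
  have A: "a * a * cont x + offdiag_entry x y * offdiag_entry y x * cont y = cont y"
  proof -
    have "a * (a * cont y) = a * (p * cont y + a * cont x)" by (simp only: C)
    then show ?thesis unfolding F by (simp add: algebra_simps)
  qed
  have D: "a * cont x + (p - a) * cont y = 0" using C by (simp add: algebra_simps)
  have "Poly_Mapping.lookup (L (Sigma i) (T (L (Sigma i) (B x y)))) k
      = (a * a * cont x + offdiag_entry x y * offdiag_entry y x * cont y) * l x y + offdiag_entry x y * (a * cont x + (p - a) * cont y) * l y x"
    unfolding TS by (simp add: S lookup_add l_def[symmetric] g' a_def[symmetric]) (simp add: algebra_simps)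
  also have "\<dots> = Poly_Mapping.lookup (scale (cont y) (B x y)) k" unfolding A D by (simp add: l_def)
  finally show "Poly_Mapping.lookup (L (Sigma i) (T (L (Sigma i) (bas (us @ x # y # vs))))) k
    = Poly_Mapping.lookup (scale (cont y) (bas (us @ x # y # vs))) k" by (simp only: B_def)
qed

text \<open>Indices follow list positions: \<open>jucys_murphy i\<close> is the product of
  \<open>\<sigma> i\<close>, ..., \<open>\<sigma> 1\<close>, \<open>\<tau>\<close>,
  \<open>\<sigma> 1\<close>, ..., \<open>\<sigma> i\<close> and sees the node at position
  \<open>i\<close>.\<close>

fun jucys_murphy :: "nat \<Rightarrow> 'k falg" where
  "jucys_murphy 0 = \<tau>"
| "jucys_murphy (Suc i) = \<sigma> (Suc i) * jucys_murphy i * \<sigma> (Suc i)"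

lemma jucys_murphy_FA: "i < l \<Longrightarrow> jucys_murphy i \<in> FA l"
  by (induction i) auto

lemma offdiag_entry_path_swap: "path m (us @ x # y # vs) \<Longrightarrow> offdiag_entry x y \<noteq> 0 \<Longrightarrow> path m (us @ y # x # vs)"
  using path_swap[of m us x y vs] by (auto simp: offdiag_entry_def)

lemma act_jucys_murphy:
  assumes "path m xs" "length xs \<le> n" "i < length xs"
  shows "act gen_on_path (jucys_murphy i) (bas xs) = scale (cont (xs ! i)) (bas xs)"
  using assms
proof (induction i arbitrary: xs)
  case 0
  then show ?case by (cases xs) auto
next
  case (Suc i)
  have "1 \<le> Suc i" by simp
  from this Suc.prems(3) obtain us x y vs where xs: "xs = us @ x # y # vs" "Suc i = Suc (length us)"
    by (rule split_at_two)
  have "L (Sigma (Suc i)) (act gen_on_path (jucys_murphy i) (L (Sigma (Suc i)) (bas (us @ x # y # vs))))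
      = scale (cont y) (bas (us @ x # y # vs))"
  proof (rule jucys_murphy_step)
    show "act gen_on_path (jucys_murphy i) (bas (us @ x # y # vs)) = scale (cont x) (bas (us @ x # y # vs))"
      using Suc.IH[of "us @ x # y # vs"] Suc.prems xs by simp
    show "act gen_on_path (jucys_murphy i) (bas (us @ y # x # vs)) = scale (cont y) (bas (us @ y # x # vs))"
      if "offdiag_entry x y \<noteq> 0"
      using Suc.IH[of "us @ y # x # vs"] Suc.prems xs offdiag_entry_path_swap[OF _ that] by simp
  qed (use Suc.prems xs lin_act in auto)
  then show ?case using xs by (simp add: nth_append)
qed

text \<open>Generators merely permute the entries of a path. The paths with one node set thus span
  an invariant subspace, the counterpart of a single \<open>V_module\<close>.\<close>

lemma shape_action_closed:
  assumes "a \<in> FA l" "f \<in> supported {xs \<in> paths m l. set xs = Y}" "1 \<le> l"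
  shows "act gen_on_path a f \<in> supported {xs \<in> paths m l. set xs = Y}"
proof -
  let ?B = "{xs \<in> paths m l. set xs = Y}"
  have "gen_on_path h xs \<in> supported ?B" if "h \<in> hecke_gens l" "xs \<in> ?B" for h xs
  proof (cases h)
    case Tau
    then show ?thesis using that by (auto simp: keys_scale)
  next
    case (Sigma i)
    then have "1 \<le> i" "i < length xs" using that by (auto simp: hecke_gens_def paths_def)
    then obtain us x y vs where xs: "xs = us @ x # y # vs" "i = Suc (length us)" by (rule split_at_two)
    have "bas xs \<in> supported ?B" using that by simp
    then have "scale (diag_entry x y) (bas (us @ x # y # vs)) \<in> supported ?B"
      unfolding xs(1) by (rule PM.subspace_scale[OF subspace_supported])
    moreover have "scale (offdiag_entry x y) (bas (us @ y # x # vs)) \<in> supported ?B"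
      using offdiag_entry_path_swap[of us x y vs] that xs by (auto simp: keys_scale paths_def)
    ultimately show ?thesis
      unfolding Sigma xs(1) gen_on_path_Sigma[OF xs(2)]
      by (rule PM.subspace_add[OF subspace_supported])
  qed
  moreover have "lin (\<lambda>f. f)" by (rule linI) auto
  ultimately show ?thesis
    using act_intertwine[of "\<lambda>f. f" "hecke_gens l" ?B gen_on_path gen_on_path a f] assms by (auto simp: mem_FA)
qed

lemma path_action_closed:
  assumes "a \<in> FA l" "f \<in> supported (paths m l)" "1 \<le> l"
  shows "act gen_on_path a f \<in> supported (paths m l)"
proof -
  have "act gen_on_path a (bas xs) \<in> supported (paths m l)" if "xs \<in> paths m l" for xs
    using shape_action_closed[OF assms(1) _ assms(3), of "bas xs" "set xs"] that by auto
  moreover have "act gen_on_path a f = linear_extension (\<lambda>xs. act gen_on_path a (bas xs)) f"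
    by (rule lin_eq) (simp_all add: lin_act lin_linear_extension)
  ultimately show ?thesis
    using linear_extension_supported[of f "\<lambda>xs. act gen_on_path a (bas xs)" "paths m l"] assms(2) by auto
qed

section \<open>Verification of the defining relations on paths\<close>

lemma relator_kills_path:
  assumes "r \<in> hecke_relators m n q v" "xs \<in> paths m n"
  shows "act gen_on_path r (bas xs) = 0"
proof -
  have xs: "path m xs" "length xs = n" using assms(2) by (auto simp: paths_def)
  from assms(1) consider
      (braid) i where "r = \<sigma> i * \<sigma> (i + 1) * \<sigma> i - \<sigma> (i + 1) * \<sigma> i * \<sigma> (i + 1)" "1 \<le> i" "i + 1 < n"
    | (far) i j where "r = \<sigma> i * \<sigma> j - \<sigma> j * \<sigma> i" "i \<in> {1..<n}" "j \<in> {1..<n}" "\<bar>int i - int j\<bar> > 1"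
    | (tau1) "r = \<tau> * \<sigma> 1 * \<tau> * \<sigma> 1 - \<sigma> 1 * \<tau> * \<sigma> 1 * \<tau>" "1 < n"
    | (tau) i where "r = \<tau> * \<sigma> i - \<sigma> i * \<tau>" "1 < i" "i < n"
    | (quad) i where "r = \<sigma> i * \<sigma> i - (const (q - inverse q) * \<sigma> i + 1)" "i \<in> {1..<n}"
    | (cyc) "r = prod_list (map (\<lambda>j. \<tau> - const (v j)) [1..<m + 1])"
    unfolding hecke_relators_def by blast
  then show ?thesis
  proof cases
    case braid
    then have "1 \<le> i" "i < length xs" using xs by auto
    then obtain us x y ws where *: "xs = us @ x # y # ws" "i = Suc (length us)" by (rule split_at_two)
    moreover obtain z vs where "ws = z # vs" using * braid xs by (cases ws) auto
    ultimately show ?thesis using braid_relation[of us x y z vs i] xs braid(1) by simp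
  next
    case far
    have comm: "L (Sigma i) (L (Sigma j) (bas xs)) = L (Sigma j) (L (Sigma i) (bas xs))"
      if ij: "1 \<le> i" "i + 1 < j" "j < n" for i j
    proof -
      have "1 \<le> j" "j < length xs" using ij xs by auto
      then obtain us' z t vs where *: "xs = us' @ z # t # vs" "j = Suc (length us')" by (rule split_at_two)
      moreover have "1 \<le> i" "i < length us'" using ij * by auto
      then obtain us x y ws where "us' = us @ x # y # ws" "i = Suc (length us)" by (rule split_at_two)
      ultimately show ?thesis using far_relation[of i us j x y ws z t vs] by simp
    qed
    show ?thesis using comm[of i j] comm[of j i] far by (cases "i < j") auto
  next
    case tau1
    have "1 \<le> (1::nat)" "1 < length xs" using xs tau1 by auto
    then obtain us x y vs where "xs = us @ x # y # vs" "1 = Suc (length us)" by (rule split_at_two)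
    then have *: "xs = x # y # vs" by simp
    \<comment> \<open>\<open>\<sigma> 1 * \<tau> * \<sigma> 1\<close> is a Jucys-Murphy element,
      hence diagonal on paths like \<open>\<tau>\<close>; the relation says that the two
      commute.\<close>
    have J: "L (Sigma 1) (L Tau (L (Sigma 1) (bas ys))) = scale (cont (ys ! 1)) (bas ys)"
      if "path m ys" "length ys = n" for ys
      using act_jucys_murphy[of ys 1] that tau1 by simp
    have S: "L (Sigma 1) (bas (x # y # vs)) = scale (diag_entry x y) (bas (x # y # vs)) + scale (offdiag_entry x y) (bas (y # x # vs))"
      using gen_on_path_Sigma[of 1 "[]" x y vs] by simp
    have J1: "L (Sigma 1) (L Tau (L (Sigma 1) (bas (x # y # vs)))) = scale (cont y) (bas (x # y # vs))"
      using J[of xs] xs * by simp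
    have "L Tau (L (Sigma 1) (L Tau (L (Sigma 1) (bas xs)))) = scale (cont x * cont y) (bas xs)"
      using * by (simp only: J1) (simp add: mult.commute)
    moreover have "L (Sigma 1) (L Tau (L (Sigma 1) (L Tau (bas xs)))) = scale (cont x * cont y) (bas xs)"
      using * J1 by simp
    ultimately show ?thesis using tau1 by simp
  next
    case tau
    then have "1 \<le> i" "i < length xs" using xs by auto
    then obtain us x y vs where *: "xs = us @ x # y # vs" "i = Suc (length us)" by (rule split_at_two)
    then have "us \<noteq> []" using tau by auto
    then show ?thesis using tau * gen_on_path_Sigma[OF *(2), of x y vs]
      by (simp add: PM.scale_right_distrib mult.commute)
  next
    case quad
    then have "1 \<le> i" "i < length xs" using xs by auto
    then obtain us x y vs where *: "xs = us @ x # y # vs" "i = Suc (length us)" by (rule split_at_two)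
    then show ?thesis using quadratic_relation[of us x y vs i] xs quad by (simp add: p_def)
  next
    case cyc
    obtain x vs where *: "xs = x # vs" using xs n_pos by (cases xs) auto
    \<comment> \<open>A path starts in the corner of some component \<open>k\<close>, whose content
      is \<open>v k\<close>; so the factor with index \<open>k\<close> vanishes.\<close>
    obtain k where k: "x = (k, 1, 1)" "k \<in> {1..m}" using path_hd[of x vs] xs * by auto
    have "act gen_on_path (prod_list (map (\<lambda>j. \<tau> - const (v j)) js)) (bas xs)
        = scale (prod_list (map (\<lambda>j. cont x - v j) js)) (bas xs)" for js
      by (induction js) (simp_all add: * PM.scale_left_diff_distrib[symmetric] mult_ac)
    moreover have "cont x - v k \<in> set (map (\<lambda>j. cont x - v j) [1..<m + 1])"
      unfolding set_map using k(2) by (intro imageI) (simp del: upt_Suc)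
    then have "prod_list (map (\<lambda>j. cont x - v j) [1..<m + 1]) = 0"
      unfolding prod_list_zero_iff using k(1) by simp
    ultimately show ?thesis using cyc by simp
  qed
qed

text \<open>The annihilator of the span of the paths is a two-sided ideal because the span is
  invariant, and it contains the relators.\<close>

lemma hecke_ideal_kills_paths:
  assumes "a \<in> hecke_ideal m n q v" "f \<in> supported (paths m n)"
  shows "act gen_on_path a f = 0"
proof -
  let ?K = "{a \<in> FA n. \<forall>f\<in>supported (paths m n). act gen_on_path a f = 0}"
  have "ideal ?K (free_algebra (hecke_gens n))"
    by (rule ideal_free_algebraI) (use path_action_closed n_pos in auto)
  moreover have "hecke_relators m n q v \<subseteq> ?K"
  proof
    fix r assume r: "r \<in> hecke_relators m n q v"
    have "act gen_on_path r f = 0" if "f \<in> supported (paths m n)" for f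
      using lin_eq_on[of "act gen_on_path r" "\<lambda>f. 0" "paths m n" f] relator_kills_path[OF r] that
      by (auto simp: lin_act PMP.linear_zero)
    then show "r \<in> ?K" using r hecke_relators_subset[of m n q v] by auto
  qed
  ultimately show ?thesis using hecke_ideal_minimal assms by blast
qed

end


section \<open>Matrix units in the image of the free algebra\<close>

lemma path_sets:
  assumes "path m (xs @ [x])"
  shows "set xs = set (xs @ [x]) - {x}" "card (set xs) = length xs"
  using path_distinct[OF assms] by (auto simp: distinct_card)

lemma paths_snoc: "xs @ [x] \<in> paths m (Suc l) \<Longrightarrow> xs \<in> paths m l"
  by (auto simp: paths_def path_snoc)

lemma paths_snocI:
  "xs \<in> paths m l \<Longrightarrow> x \<notin> set xs \<Longrightarrow> diagram m (insert x (set xs)) \<Longrightarrow> xs @ [x] \<in> paths m (Suc l)"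
  by (auto simp: paths_def path_snoc)

lemma paths_Suc_cases:
  assumes "xs \<in> paths m (Suc l)"
  obtains ys y where "xs = ys @ [y]" "ys \<in> paths m l"
  using assms paths_snoc by (cases xs rule: rev_cases) (auto simp: paths_def)

lemma paths_same_set:
  assumes "xs \<in> paths m l" "path m ys" "set ys = set xs"
  shows "ys \<in> paths m l"
proof -
  have "length ys = length xs"
    using distinct_card[OF path_distinct, of m xs] distinct_card[OF path_distinct[OF assms(2)]] assms
    by (simp add: paths_def)
  then show ?thesis using assms by (simp add: paths_def)
qed

context hecke_parameters
begin

text \<open>Only the action on paths is prescribed, which suffices as the span of the paths is
  invariant.\<close>

definition matrix_unit :: "nat \<Rightarrow> 'k falg \<Rightarrow> mnode list \<Rightarrow> mnode list \<Rightarrow> bool" where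
  "matrix_unit l a S T \<longleftrightarrow>
     a \<in> FA l \<and> (\<forall>U\<in>paths m l. act gen_on_path a (bas U) = (if U = T then bas S else 0))"

lemma matrix_unit_mult:
  assumes "matrix_unit l a S T" "matrix_unit l b T U" "T \<in> paths m l"
  shows "matrix_unit l (a * b) S U"
  using assms by (auto simp: matrix_unit_def)

text \<open>What a matrix unit of level \<open>l\<close> becomes one level higher, where the last
  node is carried along. As a notion of its own it also makes sense for \<open>l\<close> = 0, where
  the induction starts.\<close>

definition extended_unit :: "nat \<Rightarrow> 'k falg \<Rightarrow> mnode list \<Rightarrow> mnode list \<Rightarrow> bool" where
  "extended_unit l a S T \<longleftrightarrow> a \<in> FA (Suc l) \<and>
     (\<forall>U u. U @ [u] \<in> paths m (Suc l) \<longrightarrow> act gen_on_path a (bas (U @ [u])) = (if U = T then bas (S @ [u]) else 0))"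

lemma extended_unitD:
  assumes "extended_unit l a S T"
  shows "a \<in> FA (Suc l)"
    and "U @ [u] \<in> paths m (Suc l) \<Longrightarrow> act gen_on_path a (bas (U @ [u])) = (if U = T then bas (S @ [u]) else 0)"
  using assms unfolding extended_unit_def by blast+

text \<open>The generators of rank \<open>l\<close> touch only the first \<open>l\<close> entries.
  The list must not be empty, since \<open>\<tau>\<close> reads its head.\<close>

lemma act_append:
  assumes "a \<in> FA l" "f \<in> supported {xs. length xs = l}" "1 \<le> l"
  shows "act gen_on_path a (linear_extension (\<lambda>xs. bas (xs @ [u])) f)
    = linear_extension (\<lambda>xs. bas (xs @ [u])) (act gen_on_path a f)"
proof -
  let ?\<phi> = "linear_extension (\<lambda>xs. bas (xs @ [u])) :: (mnode list \<Rightarrow>\<^sub>0 'k) \<Rightarrow> _" and ?B = "{xs. length xs = l}"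
  have "gen_on_path h xs \<in> supported ?B \<and> ?\<phi> (gen_on_path h xs) = L h (?\<phi> (bas xs))"
    if "h \<in> hecke_gens l" "xs \<in> ?B" for h xs
  proof (cases h)
    case Tau
    then show ?thesis using that assms(3) by (cases xs) (auto simp: keys_scale)
  next
    case (Sigma i)
    then have "1 \<le> i" "i < length xs" using that by (auto simp: hecke_gens_def)
    then obtain us x y vs where xs: "xs = us @ x # y # vs" "i = Suc (length us)" by (rule split_at_two)
    have sup: "scale c (bas ys) \<in> supported ?B" if "length ys = l" for c ys
      using that by (auto simp: keys_scale)
    have "gen_on_path h xs \<in> supported ?B"
      unfolding Sigma xs(1) gen_on_path_Sigma[OF xs(2)]
      by (rule PM.subspace_add[OF subspace_supported]; rule sup) (use that xs in auto)
    then show ?thesis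
      using gen_on_path_Sigma[OF xs(2), of x y vs] gen_on_path_Sigma[OF xs(2), of x y "vs @ [u]"] by (simp add: Sigma xs(1))
  qed
  then show ?thesis
    using act_intertwine[OF lin_linear_extension, of "hecke_gens l" ?B gen_on_path "\<lambda>xs. bas (xs @ [u])" gen_on_path a f] assms
    by (auto simp: mem_FA)
qed

lemma matrix_unit_extend:
  assumes a: "matrix_unit l a S T" and l: "1 \<le> l"
  shows "extended_unit l a S T"
  unfolding extended_unit_def
proof (intro conjI allI impI)
  show "a \<in> FA (Suc l)" using a FA_mono[of l "Suc l"] by (auto simp: matrix_unit_def)
  fix U u assume "U @ [u] \<in> paths m (Suc l)"
  then have U: "U \<in> paths m l" by (rule paths_snoc)
  have "act gen_on_path a (bas (U @ [u])) = act gen_on_path a (linear_extension (\<lambda>xs. bas (xs @ [u])) (bas U))" by simp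
  also have "\<dots> = linear_extension (\<lambda>xs. bas (xs @ [u])) (act gen_on_path a (bas U))"
    by (rule act_append) (use a l U in \<open>auto simp: matrix_unit_def paths_def\<close>)
  also have "\<dots> = (if U = T then bas (S @ [u]) else 0)" using a U by (simp add: matrix_unit_def)
  finally show "act gen_on_path a (bas (U @ [u])) = (if U = T then bas (S @ [u]) else 0)" .
qed

definition has_extended_units :: "nat \<Rightarrow> bool" where
  "has_extended_units l \<longleftrightarrow>
     (\<forall>S\<in>paths m l. \<forall>T\<in>paths m l. set S = set T \<longrightarrow> (\<exists>a. extended_unit l a S T))"

text \<open>The functions \<open>\<phi>\<close> that occur are closed under products and affine
  changes. If they separate the nodes that can be added to \<open>T\<close>, they contain the
  indicator functions of these nodes, which belong to diagonal matrix units.\<close>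

definition diagonal :: "nat \<Rightarrow> mnode list \<Rightarrow> (mnode \<Rightarrow> 'k) \<Rightarrow> 'k falg \<Rightarrow> bool" where
  "diagonal l T \<phi> a \<longleftrightarrow> a \<in> FA (Suc l) \<and>
     (\<forall>U u. U @ [u] \<in> paths m (Suc l) \<longrightarrow>
        act gen_on_path a (bas (U @ [u])) = (if U = T then scale (\<phi> u) (bas (T @ [u])) else 0))"

lemma diagonalI:
  assumes "a \<in> FA (Suc l)"
    and "\<And>U u. U @ [u] \<in> paths m (Suc l) \<Longrightarrow>
      act gen_on_path a (bas (U @ [u])) = (if U = T then scale (\<phi> u) (bas (T @ [u])) else 0)"
  shows "diagonal l T \<phi> a"
  using assms unfolding diagonal_def by blast

lemma diagonalD:
  assumes "diagonal l T \<phi> a"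
  shows "a \<in> FA (Suc l)"
    and "U @ [u] \<in> paths m (Suc l) \<Longrightarrow>
      act gen_on_path a (bas (U @ [u])) = (if U = T then scale (\<phi> u) (bas (T @ [u])) else 0)"
  using assms unfolding diagonal_def by blast+

lemma diagonal_mult:
  "diagonal l T \<phi> a \<Longrightarrow> diagonal l T \<psi> b \<Longrightarrow> diagonal l T (\<lambda>u. \<phi> u * \<psi> u) (a * b)"
  by (rule diagonalI) (auto simp: diagonalD mult.commute)

lemma diagonal_affine:
  "diagonal l T \<phi> a \<Longrightarrow> extended_unit l e T T \<Longrightarrow> diagonal l T (\<lambda>u. c * \<phi> u + d) (scale c a + scale d e)"
  by (rule diagonalI) (auto simp: diagonalD extended_unitD PM.scale_left_distrib)

lemma diagonal_content:
  assumes "extended_unit l e T T" "l < n"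
  shows "diagonal l T cont (e * jucys_murphy l)"
proof (rule diagonalI)
  show "e * jucys_murphy l \<in> FA (Suc l)" using extended_unitD[OF assms(1)] jucys_murphy_FA[of l "Suc l"] by auto
  fix U u assume U: "U @ [u] \<in> paths m (Suc l)"
  then have "act gen_on_path (jucys_murphy l) (bas (U @ [u])) = scale (cont u) (bas (U @ [u]))"
    using act_jucys_murphy[of "U @ [u]" l] assms(2) by (auto simp: paths_def nth_append)
  then show "act gen_on_path (e * jucys_murphy l) (bas (U @ [u])) = (if U = T then scale (cont u) (bas (T @ [u])) else 0)"
    using extended_unitD(2)[OF assms(1) U] by simp
qed

text \<open>\<open>e'\<close> leads from \<open>T u\<close> to \<open>R y u\<close>; there
  \<open>\<sigma> l\<close> adds a multiple of \<open>R u y\<close>, which \<open>e\<close> kills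
  because \<open>R u\<close> differs from \<open>R y\<close>. What remains is the diagonal
  coefficient of the pair \<open>y\<close>, \<open>u\<close>.\<close>

lemma diagonal_sigma:
  assumes e: "extended_unit l e T (R @ [y])" and e': "extended_unit l e' (R @ [y]) T"
    and R: "R @ [y] \<in> paths m l" and sets: "set (R @ [y]) = set T"
  shows "diagonal l T (diag_entry y) (e * \<sigma> l * e')"
proof (rule diagonalI)
  have l: "l = Suc (length R)" using R by (simp add: paths_def)
  show "e * \<sigma> l * e' \<in> FA (Suc l)" using extended_unitD[OF e] extended_unitD[OF e'] l by auto
  fix U u assume U: "U @ [u] \<in> paths m (Suc l)"
  show "act gen_on_path (e * \<sigma> l * e') (bas (U @ [u])) = (if U = T then scale (diag_entry y u) (bas (T @ [u])) else 0)"
  proof (cases "U = T")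
    case True
    have u: "u \<notin> set T" "diagram m (insert u (set T))" using U True by (auto simp: paths_def path_snoc)
    then have Ru: "(R @ [y]) @ [u] \<in> paths m (Suc l)" using R sets by (intro paths_snocI) auto
    have "act gen_on_path e (bas (R @ [u] @ [y])) = 0" if "offdiag_entry y u \<noteq> 0"
    proof -
      have "path m (R @ u # y # [])" using offdiag_entry_path_swap[OF _ that, of R "[]"] Ru by (simp add: paths_def)
      then have "(R @ [u]) @ [y] \<in> paths m (Suc l)" using l by (simp add: paths_def)
      moreover have "R @ [u] \<noteq> R @ [y]" using u sets by auto
      ultimately show ?thesis using extended_unitD(2)[OF e, of "R @ [u]" y] by simp
    qed
    then have "scale (offdiag_entry y u) (act gen_on_path e (bas (R @ [u, y]))) = 0" by (cases "offdiag_entry y u = 0") auto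
    moreover have "act gen_on_path e (bas (R @ [y, u])) = bas (T @ [u])"
      using extended_unitD(2)[OF e Ru] by simp
    moreover have "act gen_on_path e' (bas (U @ [u])) = bas (R @ [y, u])" using extended_unitD(2)[OF e' U] True by simp
    ultimately show ?thesis using True gen_on_path_Sigma[OF l, of y u "[]"] by simp
  next
    case False
    then show ?thesis using extended_unitD(2)[OF e' U] by simp
  qed
qed

lemma content_square_one:
  assumes "q\<^sup>2 = 1" "node_ok m x" "fst x = fst y"
  shows "cont x = cont y"
proof -
  have "q powi (2 * (node_diag x - node_diag y + 0)) = (q\<^sup>2) powi (node_diag x - node_diag y)"
    unfolding add_0_right by (subst power_int_mult) simp
  then show ?thesis using cont_eq_same_component[OF assms(2,3), of 0] assms(1) by simp
qed

text \<open>If the contents agree, then q^2 = 1 and both nodes lie in one component. With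
  \<open>y\<close> a corner of \<open>T\<close> in this component, the coefficients of the pairs
  \<open>y\<close>, \<open>x\<close> and \<open>y\<close>, \<open>u\<close> are q divided by two
  different axial distances.\<close>

lemma diagonal_separates:
  assumes units: "has_extended_units l" and l: "l < n"
    and x: "T @ [x] \<in> paths m (Suc l)" and u: "T @ [u] \<in> paths m (Suc l)" and "x \<noteq> u"
  shows "\<exists>\<phi> a. diagonal l T \<phi> a \<and> \<phi> x \<noteq> \<phi> u"
proof (cases "cont x = cont u")
  case False
  obtain e where "extended_unit l e T T"
    using units paths_snoc[OF x] by (auto simp: has_extended_units_def)
  then show ?thesis using diagonal_content[OF _ l] False by blast
next
  case True
  have T: "T \<in> paths m l" by (rule paths_snoc[OF x])
  have T': "diagram m (set T)" "card (set T) = l"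
    using T path_sets(2) x by (auto simp: paths_def path_diagram)
  have x': "x \<notin> set T" "diagram m (insert x (set T))" and u': "u \<notin> set T" "diagram m (insert u (set T))"
    using x u by (auto simp: paths_def path_snoc)
  let ?Z = "set T \<union> {x, u}"
  have Z: "diagram m ?Z" using diagram_Un[OF x'(2) u'(2)] by (simp add: insert_commute)
  have cZ: "card ?Z = l + 2" using x' u' \<open>x \<noteq> u\<close> T'(2) by simp
  have ok: "node_ok m x" "node_ok m u" using diagram_node_ok[OF Z] by auto
  have "card (?Z - set T) \<le> card {x, u}" by (rule card_mono) auto
  then have good: "good x u"
    using good_skew[OF T'(1) Z] cZ l x' u' \<open>x \<noteq> u\<close> card_length[of "[x, u]"] by simp
  then have q2: "q\<^sup>2 = 1" and d: "of_int (node_diag u - node_diag x) \<noteq> (0::'k)"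
    using True by (auto simp: good_def)
  have same: "fst x = fst u"
  proof (rule ccontr)
    assume ne: "fst x \<noteq> fst u"
    then have "\<bar>node_diag x - node_diag u + 0\<bar> < int n"
      using diag_difference[OF Z, of x u] cZ l by simp
    from cont_eq_other_component[OF ok ne this] True show False by simp
  qed
  \<comment> \<open>To an empty component only its corner can be added, so \<open>x\<close> and
    \<open>u\<close> would coincide.\<close>
  have "\<exists>z\<in>set T. fst z = fst x"
  proof (rule ccontr)
    assume no: "\<not> (\<exists>z\<in>set T. fst z = fst x)"
    have "w = (fst x, 1, 1)" if "w \<notin> set T" "node_ok m w" "preds w \<subseteq> set T" "fst w = fst x" for w
      using that no by (cases w) (fastforce split: if_splits)
    moreover have "preds x \<subseteq> set T" "preds u \<subseteq> set T" using diagram_insert[OF T'(1)] x' u' by auto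
    ultimately show False using x'(1) u'(1) ok same \<open>x \<noteq> u\<close> by metis
  qed
  then obtain z where z: "z \<in> set T" "fst z = fst x" by blast
  \<comment> \<open>A corner in the component of \<open>x\<close> and \<open>u\<close> has the
    content of both, as q^2 = 1; in another component its coefficients would be 0 because
    \<open>p\<close> is 0.\<close>
  obtain y where y: "y \<in> set T" "fst y = fst x" "diagram m (set T - {y})"
    using diagram_corner[OF T'(1) z(1)] z(2) by metis
  obtain R where R: "path m R" "set R = set T - {y}" using diagram_obtain_path[OF y(3)] by blast
  have Ry: "set (R @ [y]) = set T" using R y by auto
  then have Rp: "R @ [y] \<in> paths m l"
    using R y T'(1) by (intro paths_same_set[OF T]) (auto simp: path_snoc insert_absorb)
  have goody: "good y w" if "w \<notin> set T" "diagram m (insert w (set T))" for w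
  proof -
    have "(R @ [y]) @ [w] \<in> paths m (Suc l)" using Rp Ry that by (intro paths_snocI) auto
    then show ?thesis using path_pair(1)[of R y w "[]"] l by (simp add: paths_def)
  qed
  have gcy: "diag_entry y w = q / of_int (node_diag w - node_diag y)" "of_int (node_diag w - node_diag y) \<noteq> (0::'k)"
    if "w \<notin> set T" "diagram m (insert w (set T))" "fst w = fst x" for w
    using goody[OF that(1,2)] content_square_one[OF q2 diagram_node_ok[OF T'(1) y(1)], of w] y(2) that(3)
    by (auto simp: diag_entry_def good_def)
  have "diag_entry y x \<noteq> diag_entry y u"
  proof
    assume "diag_entry y x = diag_entry y u"
    moreover have "a = b" if "q / a = q / b" "a \<noteq> 0" "b \<noteq> 0" for a b :: 'k
      using that q_nonzero by (simp add: divide_simps)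
    ultimately have "(of_int (node_diag x - node_diag y) :: 'k) = of_int (node_diag u - node_diag y)"
      using gcy[OF x'] gcy[OF u'] same by metis
    then show False using d by simp
  qed
  moreover obtain e e' where "extended_unit l e T (R @ [y])" "extended_unit l e' (R @ [y]) T"
    using units T Rp Ry unfolding has_extended_units_def by metis
  ultimately show ?thesis using diagonal_sigma[OF _ _ Rp Ry] by blast
qed

text \<open>Lagrange interpolation in which the separating function may change from node to
  node.\<close>

lemma diagonal_interpolate:
  assumes units: "has_extended_units l" and l: "l < n" and x: "T @ [x] \<in> paths m (Suc l)"
    and "finite F" "\<And>u. u \<in> F \<Longrightarrow> T @ [u] \<in> paths m (Suc l) \<and> u \<noteq> x"
  shows "\<exists>\<phi> a. diagonal l T \<phi> a \<and> \<phi> x = 1 \<and> (\<forall>u\<in>F. \<phi> u = 0)"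
  using assms(4,5)
proof (induction F rule: finite_induct)
  case empty
  obtain e where "extended_unit l e T T"
    using units paths_snoc[OF x] by (auto simp: has_extended_units_def)
  then have "diagonal l T (\<lambda>_. 1) e" by (intro diagonalI) (auto simp: extended_unitD)
  then show ?case by blast
next
  case (insert u F)
  then obtain \<phi> a where a: "diagonal l T \<phi> a" "\<phi> x = 1" "\<forall>u\<in>F. \<phi> u = 0" by blast
  have "T @ [u] \<in> paths m (Suc l)" "x \<noteq> u" using insert.prems by blast+
  then obtain \<psi> b where b: "diagonal l T \<psi> b" "\<psi> x \<noteq> \<psi> u"
    using diagonal_separates[OF units l x] by blast
  obtain e where e: "extended_unit l e T T"
    using units paths_snoc[OF x] by (auto simp: has_extended_units_def)
  define c where "c = 1 / (\<psi> x - \<psi> u)"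
  let ?\<chi> = "\<lambda>w. \<phi> w * (c * \<psi> w + - (c * \<psi> u))"
  have "diagonal l T ?\<chi> (a * (scale c b + scale (- (c * \<psi> u)) e))"
    by (rule diagonal_mult[OF a(1) diagonal_affine[OF b(1) e]])
  moreover have "?\<chi> x = c * (\<psi> x - \<psi> u)" using a(2) by (simp add: algebra_simps)
  then have "?\<chi> x = 1" using b(2) by (simp add: c_def)
  moreover have "\<forall>w\<in>insert u F. ?\<chi> w = 0" using a(3) by simp
  ultimately show ?case by blast
qed

lemma diagonal_matrix_unit:
  assumes units: "has_extended_units l" and l: "l < n" and x: "T @ [x] \<in> paths m (Suc l)"
  shows "\<exists>a. matrix_unit (Suc l) a (T @ [x]) (T @ [x])"
proof -
  let ?F = "{u. T @ [u] \<in> paths m (Suc l) \<and> u \<noteq> x}"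
  have "finite ((\<lambda>u. T @ [u]) -` paths m (Suc l))"
    by (rule finite_vimageI[OF paths_finite]) (auto simp: inj_def)
  then have "finite ?F" by (rule rev_finite_subset) auto
  then obtain \<phi> a where a: "diagonal l T \<phi> a" "\<phi> x = 1" "\<forall>u\<in>?F. \<phi> u = 0"
    using diagonal_interpolate[OF units l x, of ?F] by blast
  have "matrix_unit (Suc l) a (T @ [x]) (T @ [x])"
    unfolding matrix_unit_def
  proof (intro conjI ballI)
    show "a \<in> FA (Suc l)" using a(1) by (rule diagonalD)
    fix W assume W: "W \<in> paths m (Suc l)"
    then obtain U u where "W = U @ [u]" by (rule paths_Suc_cases)
    moreover have "\<phi> u = 0" if "U = T" "u \<noteq> x" using a(3) that W \<open>W = U @ [u]\<close> by blast
    ultimately show "act gen_on_path a (bas W) = (if W = T @ [x] then bas (T @ [x]) else 0)"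
      using diagonalD(2)[OF a(1), of U u] a(2) W by auto
  qed
  then show ?thesis by blast
qed

lemma same_last_matrix_unit:
  assumes units: "has_extended_units l" and l: "l < n" and x: "T @ [x] \<in> paths m (Suc l)"
    and S: "S \<in> paths m l" "set S = set T"
  shows "\<exists>a. matrix_unit (Suc l) a (S @ [x]) (T @ [x])"
proof -
  obtain a where a: "matrix_unit (Suc l) a (T @ [x]) (T @ [x])"
    using diagonal_matrix_unit[OF units l x] by blast
  obtain e where e: "extended_unit l e S T"
    using units S paths_snoc[OF x] unfolding has_extended_units_def by blast
  have "matrix_unit (Suc l) (e * a) (S @ [x]) (T @ [x])"
    using a extended_unitD(1)[OF e] extended_unitD(2)[OF e x] by (auto simp: matrix_unit_def)
  then show ?thesis by blast
qed

text \<open>If the last nodes \<open>x\<close> and \<open>y\<close> differ, removing both from the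
  common node set leaves a diagram. For a path \<open>R\<close> to it, \<open>R y x\<close> and
  \<open>R x y\<close> differ by an exchange, so compressing \<open>\<sigma> l\<close> gives a
  multiple of the matrix unit between them, with factor \<open>offdiag_entry x y\<close>. Paths with
  equal last node are linked by level \<open>l\<close>.\<close>

lemma matrix_units_step:
  assumes units: "has_extended_units l" and l: "l < n"
    and S: "S \<in> paths m (Suc l)" and T: "T \<in> paths m (Suc l)" and sets: "set S = set T"
  shows "\<exists>a. matrix_unit (Suc l) a S T"
proof -
  obtain S' x where Sx: "S = S' @ [x]" "S' \<in> paths m l" using S by (rule paths_Suc_cases)
  obtain T' y where Ty: "T = T' @ [y]" "T' \<in> paths m l" using T by (rule paths_Suc_cases)
  have pS: "path m (S' @ [x])" and pT: "path m (T' @ [y])" using S T Sx Ty by (auto simp: paths_def)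
  show ?thesis
  proof (cases "x = y")
    case True
    then have "set S' = set T'" using path_sets(1)[OF pS] path_sets(1)[OF pT] sets Sx(1) Ty(1) by metis
    then show ?thesis using same_last_matrix_unit[OF units l, of T' y S'] T Sx Ty True by simp
  next
    case False
    define Z where "Z = set S"
    have Z: "diagram m Z" using path_diagram[OF pS] by (simp add: Z_def Sx)
    have cZ: "card Z \<le> n" using distinct_card[OF path_distinct[OF pS]] S l by (simp add: Z_def Sx paths_def)
    have xy: "x \<in> Z" "y \<in> Z" using sets by (auto simp: Z_def Sx Ty)
    have S': "set S' = Z - {x}" using path_sets(1)[OF pS] by (simp add: Z_def Sx)
    have T': "set T' = Z - {y}" using path_sets(1)[OF pT] sets by (simp add: Z_def Ty)
    have rx: "diagram m (Z - {x})" and ry: "diagram m (Z - {y})"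
      using path_diagram[of m S'] path_diagram[of m T'] Sx(2) Ty(2) S' T' by (simp_all add: paths_def)
    have "Z - {x, y} = (Z - {x}) \<inter> (Z - {y})" by auto
    then have "diagram m (Z - {x, y})" using diagram_Int[OF rx ry] by simp
    then obtain R where R: "path m R" "set R = Z - {x, y}" using diagram_obtain_path by blast
    have iy: "insert y (Z - {x, y}) = Z - {x}" "insert x (Z - {x, y}) = Z - {y}"
      "insert x (Z - {x}) = Z" "insert y (Z - {y}) = Z" using xy False by auto
    have sRy: "set (R @ [y]) = set S'" and sRx: "set (R @ [x]) = set T'" using R iy S' T' by simp_all
    have "path m (R @ [y])" "path m (R @ [x])"
      unfolding path_snoc R(2) iy using R(1) rx ry by simp_all
    then have Ry: "R @ [y] \<in> paths m l" and Rx: "R @ [x] \<in> paths m l"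
      using paths_same_set Sx(2) Ty(2) sRy sRx by blast+
    have Ryx: "(R @ [y]) @ [x] \<in> paths m (Suc l)"
      by (rule paths_snocI[OF Ry]; unfold sRy S' iy) (use Z in simp_all)
    have Rxy: "(R @ [x]) @ [y] \<in> paths m (Suc l)"
      by (rule paths_snocI[OF Rx]; unfold sRx T' iy) (use Z in simp_all)
    obtain a where a: "matrix_unit (Suc l) a S ((R @ [y]) @ [x])"
      using same_last_matrix_unit[OF units l Ryx Sx(2)] sRy Sx(1) by metis
    obtain b where b: "matrix_unit (Suc l) b ((R @ [x]) @ [y]) T"
      using same_last_matrix_unit[OF units l _ Rx, of T' y] T sRx Ty(1) by metis
    obtain d where d: "matrix_unit (Suc l) d ((R @ [y]) @ [x]) ((R @ [y]) @ [x])"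
      using diagonal_matrix_unit[OF units l Ryx] by blast
    obtain d' where d': "matrix_unit (Suc l) d' ((R @ [x]) @ [y]) ((R @ [x]) @ [y])"
      using diagonal_matrix_unit[OF units l Rxy] by blast
    have offdiag_entry: "offdiag_entry x y \<noteq> 0" by (rule offdiag_entry_nonzero[OF Z cZ xy False rx ry])
    have len: "l = Suc (length R)" using Ry by (simp add: paths_def)
    have "matrix_unit (Suc l) (scale (1 / offdiag_entry x y) (d * \<sigma> l * d')) ((R @ [y]) @ [x]) ((R @ [x]) @ [y])"
      unfolding matrix_unit_def
    proof (intro conjI ballI)
      show "scale (1 / offdiag_entry x y) (d * \<sigma> l * d') \<in> FA (Suc l)"
        using d d' len by (auto simp: matrix_unit_def)
      fix U assume U: "U \<in> paths m (Suc l)"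
      have "act gen_on_path d (bas (R @ [x, y])) = 0" "act gen_on_path d (bas (R @ [y, x])) = bas (R @ [y, x])"
        using d Rxy Ryx False by (auto simp: matrix_unit_def)
      then show "act gen_on_path (scale (1 / offdiag_entry x y) (d * \<sigma> l * d')) (bas U)
        = (if U = (R @ [x]) @ [y] then bas ((R @ [y]) @ [x]) else 0)"
        using d' U offdiag_entry gen_on_path_Sigma[OF len, of x y "[]"] by (auto simp: matrix_unit_def)
    qed
    from matrix_unit_mult[OF a matrix_unit_mult[OF this b Rxy] Ryx] show ?thesis by blast
  qed
qed

theorem matrix_units_exist:
  assumes "1 \<le> l" "l \<le> n" "S \<in> paths m l" "T \<in> paths m l" "set S = set T"
  shows "\<exists>a. matrix_unit l a S T"
  using assms
proof (induction l arbitrary: S T rule: nat_induct_at_least)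
  case base
  \<comment> \<open>At level 0 the element 1 serves the empty path; the step to level 1 then
    separates the one-node paths by the eigenvalues \<open>v k\<close> of
    \<open>\<tau>\<close>.\<close>
  have "has_extended_units 0"
    unfolding has_extended_units_def
  proof (intro ballI impI)
    fix S T assume "S \<in> paths m 0" "T \<in> paths m 0"
    then have "extended_unit 0 1 S T" by (auto simp: extended_unit_def paths_def)
    then show "\<exists>a. extended_unit 0 a S T" by blast
  qed
  then show ?case using matrix_units_step[of 0 S T] base by simp
next
  case (Suc l)
  have "has_extended_units l"
    unfolding has_extended_units_def
  proof (intro ballI impI)
    fix S T assume "S \<in> paths m l" "T \<in> paths m l" "set S = set T"
    then have "\<exists>a. matrix_unit l a S T" using Suc.prems(1) by (intro Suc.IH) simp_all
    then show "\<exists>a. extended_unit l a S T" using matrix_unit_extend[OF _ Suc.hyps(1)] by blast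
  qed
  then show ?case using matrix_units_step[of l S T] Suc by simp
qed

end


section \<open>Counting pairs of paths\<close>

definition addable :: "nat \<Rightarrow> mnode set \<Rightarrow> mnode set" where
  "addable m Y = {x. x \<notin> Y \<and> diagram m (insert x Y)}"

definition removable :: "nat \<Rightarrow> mnode set \<Rightarrow> mnode set" where
  "removable m Y = {x \<in> Y. diagram m (Y - {x})}"

lemma initial_segment:
  fixes D :: "nat set"
  assumes "finite D" "\<And>s. s \<in> D \<Longrightarrow> 1 \<le> s" "\<And>s t. s \<in> D \<Longrightarrow> 1 \<le> t \<Longrightarrow> t \<le> s \<Longrightarrow> t \<in> D"
  shows "D = {1..card D}"
proof (cases "D = {}")
  case False
  have "D = {1..Max D}"
  proof (intro equalityI subsetI)
    fix t assume "t \<in> {1..Max D}"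
    then show "t \<in> D" using assms(3)[OF Max_in[OF assms(1) False]] by simp
  qed (use assms(1,2) in auto)
  moreover from this have "card D = Max D" using card_atLeastAtMost[of 1 "Max D"] by simp
  ultimately show ?thesis by simp
qed simp

definition row_length :: "mnode set \<Rightarrow> nat \<Rightarrow> nat \<Rightarrow> nat" where
  "row_length Y k r = card {s. (k, r, s) \<in> Y}"

lemma mem_diagram_iff:
  assumes Y: "diagram m Y"
  shows "(k, r, s) \<in> Y \<longleftrightarrow> 1 \<le> s \<and> s \<le> row_length Y k r"
proof -
  let ?D = "{s. (k, r, s) \<in> Y}"
  have "?D = (\<lambda>s. (k, r, s)) -` Y" by auto
  moreover have "finite ((\<lambda>s. (k, r, s)) -` Y)"
    by (rule finite_vimageI[OF diagram_finite[OF Y]]) (simp add: inj_def)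
  ultimately have "finite ?D" by simp
  then have "?D = {1..card ?D}"
  proof (rule initial_segment)
    fix s assume s: "s \<in> ?D"
    then have ok: "1 \<le> r" "1 \<le> s" using diagram_node_ok[OF Y, of "(k, r, s)"] by simp_all
    then show "1 \<le> s" by simp
    show "t \<in> ?D" if "1 \<le> t" "t \<le> s" for t
      using diagram_downward[OF Y _ ok(1) order_refl that] s by simp
  qed
  then have "s \<in> ?D \<longleftrightarrow> s \<in> {1..card ?D}" by (rule arg_cong)
  then show ?thesis by (simp add: row_length_def)
qed

lemma row_length_antimono:
  assumes Y: "diagram m Y" and r: "1 \<le> r" "r \<le> r'"
  shows "row_length Y k r' \<le> row_length Y k r"
proof (cases "row_length Y k r' = 0")
  case False
  then have "(k, r', row_length Y k r') \<in> Y" by (simp add: mem_diagram_iff[OF Y])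
  from diagram_downward[OF Y this r] False have "(k, r, row_length Y k r') \<in> Y" by simp
  then show ?thesis by (simp add: mem_diagram_iff[OF Y])
qed simp

lemma removable_iff:
  assumes Y: "diagram m Y" and x: "(k, r, s) \<in> Y"
  shows "diagram m (Y - {(k, r, s)}) \<longleftrightarrow> (k, Suc r, s) \<notin> Y \<and> (k, r, Suc s) \<notin> Y"
proof
  assume *: "diagram m (Y - {(k, r, s)})"
  have ok: "1 \<le> r" "1 \<le> s" using diagram_node_ok[OF Y x] by auto
  show "(k, Suc r, s) \<notin> Y \<and> (k, r, Suc s) \<notin> Y"
    using diagram_downward[OF *, of k "Suc r" s r s] diagram_downward[OF *, of k r "Suc s" r s] ok by auto
next
  assume *: "(k, Suc r, s) \<notin> Y \<and> (k, r, Suc s) \<notin> Y"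
  have "(k, r, s) \<notin> preds y" if "y \<in> Y" for y
  proof
    assume "(k, r, s) \<in> preds y"
    then have "y = (k, Suc r, s) \<or> y = (k, r, Suc s)" by (cases y) (auto split: if_splits)
    then show False using * that by auto
  qed
  then show "diagram m (Y - {(k, r, s)})" using Y unfolding diagram_def by blast
qed

lemma row_length_pos:
  assumes "diagram m Y" "0 < row_length Y k r"
  shows "1 \<le> k" "k \<le> m" "1 \<le> r"
proof -
  have "(k, r, 1) \<in> Y" using assms(2) by (simp add: mem_diagram_iff[OF assms(1)])
  then show "1 \<le> k" "k \<le> m" "1 \<le> r" using diagram_node_ok[OF assms(1)] by fastforce+
qed

text \<open>A drop of the row length after row r yields one removable node, the end of row r, and
  one addable node, behind row r + 1. Only the addable nodes in the \<open>m\<close> first rows have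
  no such partner, whence the surplus.\<close>

definition descents :: "mnode set \<Rightarrow> (nat \<times> nat) set" where
  "descents Y = {(k, r). 1 \<le> r \<and> row_length Y k (Suc r) < row_length Y k r}"

lemma removable_eq:
  assumes Y: "diagram m Y"
  shows "removable m Y = (\<lambda>(k, r). (k, r, row_length Y k r)) ` descents Y"
proof (intro equalityI subsetI)
  fix x assume "x \<in> removable m Y"
  then obtain k r s where x: "x = (k, r, s)" "(k, r, s) \<in> Y" "diagram m (Y - {(k, r, s)})"
    by (cases x) (auto simp: removable_def)
  then have "(k, Suc r, s) \<notin> Y" "(k, r, Suc s) \<notin> Y" "1 \<le> r"
    using removable_iff[OF Y x(2)] diagram_node_ok[OF Y x(2)] by auto
  then have "s = row_length Y k r" "row_length Y k (Suc r) < s"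
    using x(2) by (auto simp: mem_diagram_iff[OF Y])
  then show "x \<in> (\<lambda>(k, r). (k, r, row_length Y k r)) ` descents Y"
    using x \<open>1 \<le> r\<close> by (auto simp: descents_def image_iff intro!: bexI[of _ "(k, r)"])
next
  fix x assume "x \<in> (\<lambda>(k, r). (k, r, row_length Y k r)) ` descents Y"
  then obtain k r where x: "x = (k, r, row_length Y k r)" "row_length Y k (Suc r) < row_length Y k r"
    by (auto simp: descents_def)
  then have "x \<in> Y" by (simp add: mem_diagram_iff[OF Y])
  then show "x \<in> removable m Y"
    using x removable_iff[OF Y, of k r "row_length Y k r"] by (simp add: removable_def mem_diagram_iff[OF Y])
qed

lemma addable_eq:
  assumes Y: "diagram m Y"
  shows "addable m Y = (\<lambda>k. (k, 1, Suc (row_length Y k 1))) ` {1..m}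
    \<union> (\<lambda>(k, r). (k, Suc r, Suc (row_length Y k (Suc r)))) ` descents Y" (is "_ = ?A \<union> ?B")
proof (intro equalityI subsetI)
  fix x assume "x \<in> addable m Y"
  then have a: "x \<notin> Y" "node_ok m x" "preds x \<subseteq> Y" using diagram_insert[OF Y] by (auto simp: addable_def)
  obtain k r s where x: "x = (k, r, s)" by (metis prod_cases3)
  have "s = Suc (row_length Y k r)"
    using a x by (cases "s = 1") (auto simp: mem_diagram_iff[OF Y] split: if_splits)
  moreover have "s \<le> row_length Y k (r - 1)" if "1 < r"
    using a x that by (auto simp: mem_diagram_iff[OF Y])
  ultimately have sr: "s = Suc (row_length Y k r)" "1 < r \<Longrightarrow> row_length Y k r < row_length Y k (r - 1)" by auto
  show "x \<in> ?A \<union> ?B"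
  proof (cases "r = 1")
    case True
    then show ?thesis using a x sr by auto
  next
    case False
    then obtain r' where "r = Suc r'" "1 \<le> r'" using a x by (cases r) auto
    then have "(k, r') \<in> descents Y" "x = (\<lambda>(k, r). (k, Suc r, Suc (row_length Y k (Suc r)))) (k, r')"
      using sr x by (auto simp: descents_def)
    then show ?thesis by blast
  qed
next
  fix x assume "x \<in> ?A \<union> ?B"
  then obtain k r where x: "x = (k, r, Suc (row_length Y k r))"
    and r: "r = 1 \<and> k \<in> {1..m} \<or> 1 < r \<and> row_length Y k r < row_length Y k (r - 1)"
    by (fastforce simp: descents_def)
  have "k \<in> {1..m}" using r row_length_pos[OF Y, of k "r - 1"] by auto
  then have "node_ok m x" "preds x \<subseteq> Y" "x \<notin> Y"
    using r x by (auto simp: mem_diagram_iff[OF Y])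
  then show "x \<in> addable m Y" using diagram_insert[OF Y] by (simp add: addable_def)
qed

lemma card_addable:
  assumes Y: "diagram m Y"
  shows "finite (addable m Y)" "card (addable m Y) = card (removable m Y) + m"
proof -
  let ?R = "\<lambda>(k, r). (k, r, row_length Y k r)"
  let ?A = "(\<lambda>k. (k, 1::nat, Suc (row_length Y k 1))) ` {1..m}"
    and ?B = "(\<lambda>(k, r). (k, Suc r, Suc (row_length Y k (Suc r)))) ` descents Y"
  have "finite (removable m Y)" using diagram_finite[OF Y] by (simp add: removable_def)
  moreover have inj: "inj_on ?R (descents Y)" by (auto simp: inj_on_def)
  ultimately have fin: "finite (descents Y)" unfolding removable_eq[OF Y] by (rule finite_imageD)
  have "card ?B = card (descents Y)" by (rule card_image) (auto simp: inj_on_def)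
  moreover have "card ?A = m" by (subst card_image) (auto simp: inj_on_def)
  moreover have "card (?A \<union> ?B) = card ?A + card ?B"
    by (rule card_Un_disjoint) (use fin in \<open>auto simp: descents_def\<close>)
  ultimately show "card (addable m Y) = card (removable m Y) + m"
    unfolding addable_eq[OF Y] removable_eq[OF Y] card_image[OF inj] by simp
  show "finite (addable m Y)" unfolding addable_eq[OF Y] using fin by simp
qed

section \<open>Recursions for the number of paths to a diagram\<close>

definition paths_to :: "nat \<Rightarrow> mnode set \<Rightarrow> mnode list set" where
  "paths_to m Y = {xs. path m xs \<and> set xs = Y}"

lemma paths_to_subset: "paths_to m Y \<subseteq> paths m (card Y)"
  by (auto simp: paths_to_def paths_def path_distinct distinct_card)

lemma finite_paths_to: "finite (paths_to m Y)"
  by (rule finite_subset[OF paths_to_subset paths_finite])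

lemma card_paths_to_rec:
  assumes Y: "diagram m Y" and "Y \<noteq> {}"
  shows "card (paths_to m Y) = (\<Sum>x\<in>removable m Y. card (paths_to m (Y - {x})))"
proof -
  let ?F = "\<lambda>x. (\<lambda>xs. xs @ [x]) ` paths_to m (Y - {x})"
  have "paths_to m Y = (\<Union>x\<in>removable m Y. ?F x)"
  proof (intro equalityI subsetI)
    fix xs assume "xs \<in> paths_to m Y"
    then have xs: "path m xs" "set xs = Y" by (auto simp: paths_to_def)
    then obtain ys x where ys: "xs = ys @ [x]" using assms(2) by (cases xs rule: rev_cases) auto
    then have p: "path m ys" "x \<notin> set ys" "insert x (set ys) = Y" using xs by (auto simp: path_snoc)
    then have "set ys = Y - {x}" by auto
    then have "x \<in> removable m Y" "ys \<in> paths_to m (Y - {x})"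
      using p path_diagram[OF p(1)] by (auto simp: removable_def paths_to_def)
    then show "xs \<in> (\<Union>x\<in>removable m Y. ?F x)" using ys by blast
  next
    fix xs assume "xs \<in> (\<Union>x\<in>removable m Y. ?F x)"
    then obtain x ys where "x \<in> removable m Y" "ys \<in> paths_to m (Y - {x})" "xs = ys @ [x]" by blast
    then show "xs \<in> paths_to m Y"
      using Y by (auto simp: paths_to_def removable_def path_snoc insert_absorb)
  qed
  also have "card \<dots> = (\<Sum>x\<in>removable m Y. card (?F x))"
    by (rule card_UN_disjoint) (use diagram_finite[OF Y] finite_paths_to in \<open>auto simp: removable_def\<close>)
  also have "\<dots> = (\<Sum>x\<in>removable m Y. card (paths_to m (Y - {x})))"
    by (intro sum.cong refl card_image) (auto simp: inj_on_def)
  finally show ?thesis .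
qed

text \<open>Diagrams form a distributive lattice, so adding \<open>x\<close> and then removing \<open>z \<noteq> x\<close> can be done in
  the opposite order; the surplus of \<open>m\<close> addable nodes accounts for the case \<open>z = x\<close>.\<close>

lemma sum_card_paths_to_addable:
  assumes "diagram m Y"
  shows "(\<Sum>x\<in>addable m Y. card (paths_to m (insert x Y))) = m * (card Y + 1) * card (paths_to m Y)"
  using assms
proof (induction "card Y" arbitrary: Y rule: less_induct)
  case less
  note Y = less.prems
  note fin = diagram_finite[OF Y]
  let ?f = "\<lambda>Y. card (paths_to m Y)"
  have finr: "finite (removable m Z)" if "diagram m Z" for Z
    using diagram_finite[OF that] by (simp add: removable_def)
  define S where "S = (\<Sum>x\<in>addable m Y. \<Sum>z\<in>removable m (insert x Y) - {x}. ?f (insert x Y - {z}))"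
  have 1: "?f (insert x Y) = ?f Y + (\<Sum>z\<in>removable m (insert x Y) - {x}. ?f (insert x Y - {z}))"
    if "x \<in> addable m Y" for x
  proof -
    have x: "x \<notin> Y" "diagram m (insert x Y)" using that by (auto simp: addable_def)
    then have "x \<in> removable m (insert x Y)" using Y by (simp add: removable_def)
    then show ?thesis
      using card_paths_to_rec[OF x(2)] sum.remove[OF finr[OF x(2)], of x "\<lambda>z. ?f (insert x Y - {z})"] x(1) by simp
  qed
  then have 2: "(\<Sum>x\<in>addable m Y. ?f (insert x Y)) = card (addable m Y) * ?f Y + S"
    by (simp add: S_def sum.distrib)
  have 3: "(\<Sum>x\<in>addable m (Y - {z}). ?f (insert x (Y - {z})))
      = ?f Y + (\<Sum>x\<in>addable m (Y - {z}) - {z}. ?f (insert x (Y - {z})))" if "z \<in> removable m Y" for z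
  proof -
    have z: "z \<in> Y" "diagram m (Y - {z})" using that by (auto simp: removable_def)
    then have "z \<in> addable m (Y - {z})" using Y by (simp add: addable_def insert_absorb)
    then show ?thesis
      using sum.remove[OF card_addable(1)[OF z(2)], of z "\<lambda>x. ?f (insert x (Y - {z}))"] z(1)
      by (simp add: insert_absorb)
  qed
  have "S = (\<Sum>z\<in>removable m Y. \<Sum>x\<in>addable m (Y - {z}) - {z}. ?f (insert x (Y - {z})))"
  proof -
    have key: "x \<in> addable m Y \<and> z \<in> removable m (insert x Y) - {x} \<longleftrightarrow>
        z \<in> removable m Y \<and> x \<in> addable m (Y - {z}) - {z}" for x z
    proof
      assume *: "x \<in> addable m Y \<and> z \<in> removable m (insert x Y) - {x}"
      then have h: "x \<notin> Y" "diagram m (insert x Y)" "z \<in> Y" "z \<noteq> x" "diagram m (insert x Y - {z})"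
        by (auto simp: addable_def removable_def)
      have "Y \<inter> (insert x Y - {z}) = Y - {z}" "insert x Y - {z} = insert x (Y - {z})" using h by auto
      then show "z \<in> removable m Y \<and> x \<in> addable m (Y - {z}) - {z}"
        using diagram_Int[OF Y h(5)] h by (auto simp: addable_def removable_def)
    next
      assume *: "z \<in> removable m Y \<and> x \<in> addable m (Y - {z}) - {z}"
      then have h: "z \<in> Y" "x \<noteq> z" "x \<notin> Y" "diagram m (insert x (Y - {z}))"
        by (auto simp: addable_def removable_def)
      have "Y \<union> insert x (Y - {z}) = insert x Y" "insert x Y - {z} = insert x (Y - {z})" using h by auto
      then show "x \<in> addable m Y \<and> z \<in> removable m (insert x Y) - {x}"
        using diagram_Un[OF Y h(4)] h by (auto simp: addable_def removable_def)
    qed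
    then have swap: "(x, z) \<in> (SIGMA x:addable m Y. removable m (insert x Y) - {x}) \<longleftrightarrow>
        (z, x) \<in> (SIGMA z:removable m Y. addable m (Y - {z}) - {z})" for x z
      by (simp only: mem_Sigma_iff)
    have "S = (\<Sum>(x, z)\<in>(SIGMA x:addable m Y. removable m (insert x Y) - {x}). ?f (insert x Y - {z}))"
      unfolding S_def using finr card_addable(1)[OF Y] by (subst sum.Sigma) (auto simp: addable_def)
    also have "\<dots> = (\<Sum>(z, x)\<in>(SIGMA z:removable m Y. addable m (Y - {z}) - {z}). ?f (insert x (Y - {z})))"
    proof (rule sum.reindex_bij_witness[of _ "\<lambda>(z, x). (x, z)" "\<lambda>(x, z). (z, x)"], goal_cases)
      case (2 a)
      then show ?case by (cases a) (simp only: swap prod.case)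
    next
      case (4 a)
      then show ?case by (cases a) (simp only: swap prod.case)
    next
      case (5 a)
      obtain x z where "a = (x, z)" by (cases a)
      moreover from this 5 have "x \<noteq> z" by auto
      ultimately show ?case by (simp add: insert_Diff_if)
    qed (simp_all add: split_beta)
    also have "\<dots> = (\<Sum>z\<in>removable m Y. \<Sum>x\<in>addable m (Y - {z}) - {z}. ?f (insert x (Y - {z})))"
      using finr[OF Y] card_addable(1) by (subst sum.Sigma) (auto simp: removable_def)
    finally show ?thesis .
  qed
  then have "S + card (removable m Y) * ?f Y
      = (\<Sum>z\<in>removable m Y. \<Sum>x\<in>addable m (Y - {z}). ?f (insert x (Y - {z})))"
    by (simp add: 3 sum.distrib)
  also have "\<dots> = (\<Sum>z\<in>removable m Y. m * card Y * ?f (Y - {z}))"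
  proof (rule sum.cong[OF refl])
    fix z assume "z \<in> removable m Y"
    then have z: "z \<in> Y" "diagram m (Y - {z})" by (auto simp: removable_def)
    have "card Y = Suc (card (Y - {z}))" using card.remove[OF fin z(1)] .
    then show "(\<Sum>x\<in>addable m (Y - {z}). ?f (insert x (Y - {z}))) = m * card Y * ?f (Y - {z})"
      using less.hyps[OF _ z(2)] by simp
  qed
  also have "\<dots> = m * card Y * ?f Y"
  proof (cases "Y = {}")
    case False
    then show ?thesis using card_paths_to_rec[OF Y] by (simp add: sum_distrib_left)
  qed simp
  \<comment> \<open>All terms are natural numbers, so the removable part is added instead of
    subtracted; it cancels once \<open>card (addable m Y)\<close> is replaced by
    \<open>card (removable m Y) + m\<close>.\<close>
  finally have "(card (addable m Y) * ?f Y + S) + card (removable m Y) * ?f Y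
      = card (addable m Y) * ?f Y + m * card Y * ?f Y" by simp
  then show ?case unfolding 2 card_addable(2)[OF Y] by (simp add: algebra_simps)
qed

section \<open>The sum of the squares\<close>

definition diagrams :: "nat \<Rightarrow> nat \<Rightarrow> mnode set set" where
  "diagrams m n = {Y. diagram m Y \<and> card Y = n}"

lemma set_paths: "set ` paths m n = diagrams m n"
proof (intro equalityI subsetI)
  fix Y assume "Y \<in> diagrams m n"
  then obtain xs where "path m xs" "set xs = Y" "card Y = n"
    using diagram_obtain_path by (auto simp: diagrams_def)
  then show "Y \<in> set ` paths m n" using distinct_card[OF path_distinct] by (auto simp: paths_def)
qed (auto simp: diagrams_def paths_def path_diagram path_distinct distinct_card)

lemma finite_diagrams: "finite (diagrams m n)"
  unfolding set_paths[symmetric] using paths_finite by simp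

text \<open>One of the two equal factors is expanded over the last node of a path. Reindexing by the
  smaller diagram turns the inner sum into one over addable nodes, which is known.\<close>

lemma sum_squares: "(\<Sum>Y\<in>diagrams m n. card (paths_to m Y) * card (paths_to m Y)) = fact n * m ^ n"
proof (induction n)
  case 0
  have "diagrams m 0 = {{}}" using diagram_finite by (auto simp: diagrams_def)
  moreover have "paths_to m {} = {[]}" by (auto simp: paths_to_def)
  ultimately show ?case by simp
next
  case (Suc n)
  let ?f = "\<lambda>Y. card (paths_to m Y)"
  have "(\<Sum>Y\<in>diagrams m (Suc n). ?f Y * ?f Y)
      = (\<Sum>Y\<in>diagrams m (Suc n). \<Sum>x\<in>removable m Y. ?f Y * ?f (Y - {x}))"
  proof (rule sum.cong[OF refl])
    fix Y assume Y: "Y \<in> diagrams m (Suc n)"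
    then have "Y \<noteq> {}" by (auto simp: diagrams_def)
    then show "?f Y * ?f Y = (\<Sum>x\<in>removable m Y. ?f Y * ?f (Y - {x}))"
      using card_paths_to_rec[of m Y] Y by (simp add: diagrams_def flip: sum_distrib_left)
  qed
  also have "\<dots> = (\<Sum>(Y, x)\<in>(SIGMA Y:diagrams m (Suc n). removable m Y). ?f Y * ?f (Y - {x}))"
    using diagram_finite by (subst sum.Sigma) (auto simp: removable_def diagrams_def finite_diagrams[unfolded diagrams_def])
  also have "\<dots> = (\<Sum>(Z, x)\<in>(SIGMA Z:diagrams m n. addable m Z). ?f (insert x Z) * ?f Z)"
    by (rule sum.reindex_bij_witness[of _ "\<lambda>(Z, x). (insert x Z, x)" "\<lambda>(Y, x). (Y - {x}, x)"])
       (auto simp: diagrams_def addable_def removable_def insert_absorb dest: diagram_finite)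
  also have "\<dots> = (\<Sum>Z\<in>diagrams m n. \<Sum>x\<in>addable m Z. ?f (insert x Z) * ?f Z)"
    using card_addable(1) by (subst sum.Sigma) (auto simp: finite_diagrams, auto simp: diagrams_def)
  also have "\<dots> = (\<Sum>Z\<in>diagrams m n. m * Suc n * (?f Z * ?f Z))"
    by (rule sum.cong[OF refl])
       (use sum_card_paths_to_addable in \<open>auto simp: diagrams_def mult.assoc simp flip: sum_distrib_right\<close>)
  also have "\<dots> = m * Suc n * (fact n * m ^ n)" by (simp only: Suc flip: sum_distrib_left)
  finally show ?case by (simp add: algebra_simps)
qed

definition shape_pairs :: "nat \<Rightarrow> nat \<Rightarrow> (mnode list \<times> mnode list) set" where
  "shape_pairs m n = {(S, T). S \<in> paths m n \<and> T \<in> paths m n \<and> set S = set T}"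

lemma finite_shape_pairs: "finite (shape_pairs m n)"
  by (rule finite_subset[of _ "paths m n \<times> paths m n"]) (auto simp: shape_pairs_def paths_finite)

theorem card_shape_pairs: "card (shape_pairs m n) = fact n * m ^ n"
proof -
  have eq: "shape_pairs m n = (\<Union>Y\<in>diagrams m n. paths_to m Y \<times> paths_to m Y)"
  proof (intro equalityI subsetI)
    fix p assume "p \<in> shape_pairs m n"
    then obtain S T where "p = (S, T)" "S \<in> paths m n" "T \<in> paths m n" "set S = set T"
      by (auto simp: shape_pairs_def)
    moreover have "set S \<in> diagrams m n" using calculation set_paths by blast
    ultimately show "p \<in> (\<Union>Y\<in>diagrams m n. paths_to m Y \<times> paths_to m Y)"
      by (auto simp: paths_to_def paths_def)
  next
    fix p assume "p \<in> (\<Union>Y\<in>diagrams m n. paths_to m Y \<times> paths_to m Y)"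
    then show "p \<in> shape_pairs m n"
      using paths_to_subset by (fastforce simp: shape_pairs_def diagrams_def paths_to_def)
  qed
  have "card (shape_pairs m n) = (\<Sum>Y\<in>diagrams m n. card (paths_to m Y \<times> paths_to m Y))"
    unfolding eq by (rule card_UN_disjoint) (use finite_diagrams finite_paths_to in auto, auto simp: paths_to_def)
  then show ?thesis using sum_squares by (simp add: card_cartesian_product)
qed


section \<open>A spanning set of the Hecke algebra\<close>

text \<open>\<open>descend k j\<close> is the product of \<open>\<sigma> k\<close>, ...,
  \<open>\<sigma> (j + 1)\<close>, and \<open>ascend j\<close> that of \<open>\<sigma> 1\<close>,
  ..., \<open>\<sigma> j\<close>; empty products are 1.\<close>

fun descend :: "nat \<Rightarrow> nat \<Rightarrow> 'k::field falg" where
  "descend 0 j = 1"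
| "descend (Suc k) j = (if k < j then 1 else \<sigma> (Suc k) * descend k j)"

fun ascend :: "nat \<Rightarrow> 'k::field falg" where
  "ascend 0 = 1"
| "ascend (Suc j) = ascend j * \<sigma> (Suc j)"

lemma descend_FA: "k < l \<Longrightarrow> descend k j \<in> FA l"
  by (induction k) auto

lemma ascend_FA: "j < l \<Longrightarrow> ascend j \<in> FA l"
  by (induction j) auto

lemma descend_same [simp]: "descend k k = 1"
  by (cases k) auto

context
  fixes m :: nat and q :: "'k::field" and v :: "nat \<Rightarrow> 'k"
begin

lemma descend_sigma: "1 \<le> i \<Longrightarrow> i \<le> k \<Longrightarrow> descend k i * \<sigma> i = (descend k (i - 1) :: 'k falg)"
proof (induction k)
  case (Suc k)
  show ?case
  proof (cases "i = Suc k")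
    case True
    then show ?thesis by simp
  next
    case False
    then have "i \<le> k" "\<not> k < i" "\<not> k < i - 1" using Suc.prems by auto
    then show ?thesis using Suc by (simp add: mult.assoc)
  qed
qed simp

lemma ascend_split: "1 \<le> j \<Longrightarrow> ascend j = (\<sigma> 1 :: 'k falg) * prod_list (map \<sigma> [2..<Suc j])"
  by (induction j rule: nat_induct_at_least) (auto simp: mult.assoc)

text \<open>Membership in \<open>FA l\<close> is part of the relation, so that congruences can be
  chained and multiplied with few side conditions.\<close>

definition hcong :: "'k falg \<Rightarrow> nat \<Rightarrow> 'k falg \<Rightarrow> bool" ("(_/ \<approx>\<^bsub>_\<^esub> _)" [51, 0, 51] 50) where
  "a \<approx>\<^bsub>l\<^esub> b \<longleftrightarrow> a \<in> FA l \<and> b \<in> FA l \<and> a - b \<in> hecke_ideal m l q v"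

lemma hcong_FA: "a \<approx>\<^bsub>l\<^esub> b \<Longrightarrow> a \<in> FA l" "a \<approx>\<^bsub>l\<^esub> b \<Longrightarrow> b \<in> FA l"
  by (auto simp: hcong_def)

lemma hcong_refl: "a \<in> FA l \<Longrightarrow> a \<approx>\<^bsub>l\<^esub> a"
  by (simp add: hcong_def hecke_ideal_closed)

lemma hecke_ideal_uminus: "a \<in> hecke_ideal m l q v \<Longrightarrow> - a \<in> hecke_ideal m l q v"
  using hecke_ideal_closed(3)[of a m l q v "- 1"] by simp

lemma hcong_sym: "a \<approx>\<^bsub>l\<^esub> b \<Longrightarrow> b \<approx>\<^bsub>l\<^esub> a"
  using hecke_ideal_uminus[of "a - b" l] by (auto simp: hcong_def)

lemma hcong_trans [trans]: "a \<approx>\<^bsub>l\<^esub> b \<Longrightarrow> b \<approx>\<^bsub>l\<^esub> c \<Longrightarrow> a \<approx>\<^bsub>l\<^esub> c"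
  using hecke_ideal_closed(2)[of "a - b" m l q v "b - c"] by (auto simp: hcong_def)

lemma hcong_add: "a \<approx>\<^bsub>l\<^esub> b \<Longrightarrow> c \<approx>\<^bsub>l\<^esub> d \<Longrightarrow> a + c \<approx>\<^bsub>l\<^esub> b + d"
  using hecke_ideal_closed(2)[of "a - b" m l q v "c - d"] by (auto simp: hcong_def algebra_simps)

lemma hcong_mult:
  assumes "a \<approx>\<^bsub>l\<^esub> b" "c \<approx>\<^bsub>l\<^esub> d"
  shows "a * c \<approx>\<^bsub>l\<^esub> b * d"
proof -
  have "(a - b) * c + b * (c - d) \<in> hecke_ideal m l q v"
    by (rule hecke_ideal_closed(2)[OF hecke_ideal_closed(4) hecke_ideal_closed(3)])
       (use assms in \<open>simp_all add: hcong_def\<close>)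
  then show ?thesis using assms by (auto simp: hcong_def algebra_simps)
qed

lemma hcong_left: "c \<approx>\<^bsub>l\<^esub> d \<Longrightarrow> a \<in> FA l \<Longrightarrow> a * c \<approx>\<^bsub>l\<^esub> a * d"
  by (rule hcong_mult[OF hcong_refl])

lemma hcong_right: "c \<approx>\<^bsub>l\<^esub> d \<Longrightarrow> a \<in> FA l \<Longrightarrow> c * a \<approx>\<^bsub>l\<^esub> d * a"
  by (rule hcong_mult[OF _ hcong_refl])

lemma hcong_scale: "a \<approx>\<^bsub>l\<^esub> b \<Longrightarrow> scale c a \<approx>\<^bsub>l\<^esub> scale c b"
  unfolding scale_eq_const_mult by (rule hcong_left) auto

lemma hcong_sum: "(\<And>t. t \<in> J \<Longrightarrow> h t \<approx>\<^bsub>l\<^esub> h' t) \<Longrightarrow> sum h J \<approx>\<^bsub>l\<^esub> sum h' J"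
proof (induction J rule: infinite_finite_induct)
  case (insert x F)
  then show ?case by (auto intro!: hcong_add)
qed (auto intro: hcong_refl)

lemma hcong_mono: "a \<approx>\<^bsub>k\<^esub> b \<Longrightarrow> k \<le> l \<Longrightarrow> a \<approx>\<^bsub>l\<^esub> b"
  using FA_mono hecke_ideal_mono by (fastforce simp: hcong_def)

lemma hcong_relator: "a - b \<in> hecke_relators m l q v \<Longrightarrow> a \<in> FA l \<Longrightarrow> b \<in> FA l \<Longrightarrow> a \<approx>\<^bsub>l\<^esub> b"
  using subsetD[OF hecke_relators_in_ideal] by (simp add: hcong_def)

section \<open>The defining relations as congruences\<close>

abbreviation pp :: 'k where "pp \<equiv> q - inverse q"

lemma rel_braid: "1 \<le> i \<Longrightarrow> Suc i < l \<Longrightarrow> \<sigma> i * \<sigma> (Suc i) * \<sigma> i \<approx>\<^bsub>l\<^esub> \<sigma> (Suc i) * \<sigma> i * \<sigma> (Suc i)"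
  by (rule hcong_relator) (auto simp: hecke_relators_def)

lemma rel_far:
  assumes "1 \<le> i" "i < l" "1 \<le> j" "j < l" "Suc i < j \<or> Suc j < i"
  shows "\<sigma> i * \<sigma> j \<approx>\<^bsub>l\<^esub> \<sigma> j * \<sigma> i"
proof (rule hcong_relator)
  have "i \<in> {1..<l}" "j \<in> {1..<l}" "\<bar>int i - int j\<bar> > 1" using assms by auto
  then show "\<sigma> i * \<sigma> j - \<sigma> j * \<sigma> i \<in> hecke_relators m l q v"
    unfolding hecke_relators_def by blast
qed (use assms in auto)

lemma rel_quad: "1 \<le> i \<Longrightarrow> i < l \<Longrightarrow> \<sigma> i * \<sigma> i \<approx>\<^bsub>l\<^esub> scale pp (\<sigma> i) + 1"
  by (rule hcong_relator) (auto simp: hecke_relators_def scale_eq_const_mult)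

lemma rel_tau: "1 < i \<Longrightarrow> i < l \<Longrightarrow> \<tau> * \<sigma> i \<approx>\<^bsub>l\<^esub> \<sigma> i * \<tau>"
  by (rule hcong_relator) (auto simp: hecke_relators_def)

lemma rel_tau1: "1 < l \<Longrightarrow> \<tau> * \<sigma> 1 * \<tau> * \<sigma> 1 \<approx>\<^bsub>l\<^esub> \<sigma> 1 * \<tau> * \<sigma> 1 * \<tau>"
  by (rule hcong_relator) (auto simp: hecke_relators_def)

lemma rel_tau_power:
  assumes "1 < i" "i < l"
  shows "\<tau> ^ k * \<sigma> i \<approx>\<^bsub>l\<^esub> \<sigma> i * \<tau> ^ k"
proof (induction k)
  case 0
  show ?case using assms by (auto intro: hcong_refl)
next
  case (Suc k)
  have "\<tau> ^ Suc k * \<sigma> i = \<tau> * (\<tau> ^ k * \<sigma> i)" by (simp add: mult.assoc)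
  also have "\<dots> \<approx>\<^bsub>l\<^esub> \<tau> * (\<sigma> i * \<tau> ^ k)" using Suc by (rule hcong_left) auto
  also have "\<dots> = (\<tau> * \<sigma> i) * \<tau> ^ k" by (simp add: mult.assoc)
  also have "\<dots> \<approx>\<^bsub>l\<^esub> (\<sigma> i * \<tau>) * \<tau> ^ k" using rel_tau[OF assms] by (rule hcong_right) auto
  also have "\<dots> = \<sigma> i * \<tau> ^ Suc k" by (simp add: mult.assoc)
  finally show ?case .
qed

lemma cyclotomic_expand: "\<exists>c. prod_list (map (\<lambda>j. \<tau> - const (v j)) [1..<k + 1]) = \<tau> ^ k - (\<Sum>i<k. scale (c i) (\<tau> ^ i))"
proof (induction k)
  case 0
  show ?case by simp
next
  case (Suc k)
  then obtain c where c: "prod_list (map (\<lambda>j. \<tau> - const (v j)) [1..<k + 1]) = \<tau> ^ k - (\<Sum>i<k. scale (c i) (\<tau> ^ i))" ..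
  \<comment> \<open>The first term comes from multiplication by \<open>\<tau>\<close>, which shifts
    the coefficients, the second from the constant \<open>v (Suc k)\<close>; its value at
    \<open>i\<close> = \<open>k\<close> belongs to the leading power.\<close>
  define d where "d i = (if i = 0 then 0 else c (i - 1)) - (if i < k then v (Suc k) * c i else - v (Suc k))" for i
  have "prod_list (map (\<lambda>j. \<tau> - const (v j)) [1..<Suc k + 1])
      = (\<tau> ^ k - (\<Sum>i<k. scale (c i) (\<tau> ^ i))) * (\<tau> - const (v (Suc k)))"
    using c by simp
  also have "\<dots> = \<tau> ^ Suc k - (\<Sum>i<k. scale (c i) (\<tau> ^ Suc i))
      - (scale (v (Suc k)) (\<tau> ^ k) - (\<Sum>i<k. scale (v (Suc k) * c i) (\<tau> ^ i)))"
    by (simp add: right_diff_distrib left_diff_distrib const_eq_scale_one sum_distrib_right power_Suc2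
        PM.scale_sum_right del: power_Suc) (simp add: algebra_simps PM.scale_sum_right)
  also have "(\<Sum>i<k. scale (c i) (\<tau> ^ Suc i)) = (\<Sum>i<Suc k. scale (if i = 0 then 0 else c (i - 1)) (\<tau> ^ i))"
    by (subst sum.lessThan_Suc_shift) simp
  also have "scale (v (Suc k)) (\<tau> ^ k) - (\<Sum>i<k. scale (v (Suc k) * c i) (\<tau> ^ i))
      = - (\<Sum>i<Suc k. scale (if i < k then v (Suc k) * c i else - v (Suc k)) (\<tau> ^ i))"
    by simp
  finally have "prod_list (map (\<lambda>j. \<tau> - const (v j)) [1..<Suc k + 1]) = \<tau> ^ Suc k - (\<Sum>i<Suc k. scale (d i) (\<tau> ^ i))"
    unfolding d_def PM.scale_left_diff_distrib sum_subtractf by simp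
  then show ?case by blast
qed

lemma tau_power_m: "\<exists>c. \<tau> ^ m \<approx>\<^bsub>l\<^esub> (\<Sum>i<m. scale (c i) (\<tau> ^ i))"
proof -
  obtain c where c: "prod_list (map (\<lambda>j. \<tau> - const (v j)) [1..<m + 1]) = \<tau> ^ m - (\<Sum>i<m. scale (c i) (\<tau> ^ i))"
    using cyclotomic_expand by blast
  have "\<tau> ^ m \<approx>\<^bsub>l\<^esub> (\<Sum>i<m. scale (c i) (\<tau> ^ i))"
    by (rule hcong_relator) (auto simp: c[symmetric] hecke_relators_def simp del: upt_Suc)
  then show ?thesis by blast
qed

section \<open>Commuting generators with descending and ascending products\<close>

lemma comm_mult:
  assumes "x * a \<approx>\<^bsub>l\<^esub> a * x" "x * b \<approx>\<^bsub>l\<^esub> b * x" "x \<in> FA l" "a \<in> FA l" "b \<in> FA l"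
  shows "x * (a * b) \<approx>\<^bsub>l\<^esub> (a * b) * x"
proof -
  have "x * (a * b) = (x * a) * b" by (simp add: mult.assoc)
  also have "\<dots> \<approx>\<^bsub>l\<^esub> (a * x) * b" by (rule hcong_right) fact+
  also have "\<dots> = a * (x * b)" by (simp add: mult.assoc)
  also have "\<dots> \<approx>\<^bsub>l\<^esub> a * (b * x)" by (rule hcong_left) fact+
  also have "\<dots> = (a * b) * x" by (simp add: mult.assoc)
  finally show ?thesis .
qed

lemma sigma_comm_descend:
  assumes "1 \<le> i" "i < l" "i < j \<or> Suc k < i" "k < l"
  shows "\<sigma> i * descend k j \<approx>\<^bsub>l\<^esub> descend k j * \<sigma> i"
  using assms(3,4)
proof (induction k)
  case 0
  show ?case using assms by (auto intro: hcong_refl)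
next
  case (Suc k)
  show ?case
  proof (cases "k < j")
    case True
    then show ?thesis using assms by (auto intro: hcong_refl)
  next
    case False
    then have "\<sigma> i * (\<sigma> (Suc k) * descend k j) \<approx>\<^bsub>l\<^esub> (\<sigma> (Suc k) * descend k j) * \<sigma> i"
      using Suc assms by (intro comm_mult rel_far) (auto intro!: descend_FA)
    then show ?thesis using False by simp
  qed
qed

lemma tau_comm_descend:
  assumes "1 \<le> j" "k < l"
  shows "\<tau> * descend k j \<approx>\<^bsub>l\<^esub> descend k j * \<tau>"
  using assms(2)
proof (induction k)
  case 0
  show ?case using assms by (auto intro: hcong_refl)
next
  case (Suc k)
  show ?case
  proof (cases "k < j")
    case True
    then show ?thesis using assms by (auto intro: hcong_refl)
  next
    case False
    then have "\<tau> * (\<sigma> (Suc k) * descend k j) \<approx>\<^bsub>l\<^esub> (\<sigma> (Suc k) * descend k j) * \<tau>"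
      using Suc assms by (intro comm_mult rel_tau) (auto intro!: descend_FA)
    then show ?thesis using False by simp
  qed
qed

text \<open>\<open>\<sigma> i\<close> moves to the left up to the factors
  \<open>\<sigma> i * \<sigma> (i - 1)\<close>; the braid relation turns it into
  \<open>\<sigma> (i - 1)\<close>, which commutes with everything further left. The lower index
  matters: for \<open>k\<close> = \<open>n\<close> the new left factor lies in
  \<open>FA n\<close>.\<close>

lemma descend_shift:
  assumes "Suc j < i" "i \<le> k" "k < l"
  shows "descend k j * \<sigma> i \<approx>\<^bsub>l\<^esub> \<sigma> (i - 1) * descend k j"
  using assms(2,3)
proof (induction k)
  case 0
  then show ?case using assms(1) by simp
next
  case (Suc k)
  show ?case
  proof (cases "i = Suc k")
    case True
    obtain k' where k: "k = Suc k'" using assms(1) True by (cases k) auto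
    have j: "j \<le> k'" using assms(1) True k by simp
    have FAs: "\<sigma> (Suc k) \<in> FA l" "\<sigma> k \<in> FA l" "descend k' j \<in> FA l" using Suc.prems k by (auto intro: descend_FA)
    have "descend (Suc k) j * \<sigma> i = (\<sigma> (Suc k) * \<sigma> k) * (descend k' j * \<sigma> (Suc k))"
      using True k j by (simp add: mult.assoc)
    also have "\<dots> \<approx>\<^bsub>l\<^esub> (\<sigma> (Suc k) * \<sigma> k) * (\<sigma> (Suc k) * descend k' j)"
      by (rule hcong_left[OF hcong_sym[OF sigma_comm_descend]]) (use Suc.prems k FAs in auto)
    also have "\<dots> = (\<sigma> (Suc k) * \<sigma> k * \<sigma> (Suc k)) * descend k' j" by (simp add: mult.assoc)
    also have "\<dots> \<approx>\<^bsub>l\<^esub> (\<sigma> k * \<sigma> (Suc k) * \<sigma> k) * descend k' j"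
      by (rule hcong_right[OF hcong_sym[OF rel_braid]]) (use Suc.prems k FAs in auto)
    also have "\<dots> = \<sigma> (i - 1) * descend (Suc k) j" using True k j by (simp add: mult.assoc)
    finally show ?thesis .
  next
    case False
    then have i: "i \<le> k" using Suc.prems by simp
    have FAs: "\<sigma> (Suc k) \<in> FA l" "\<sigma> (i - 1) \<in> FA l" "descend k j \<in> FA l"
      using Suc.prems i assms(1) by (auto intro: descend_FA)
    have "descend (Suc k) j * \<sigma> i = \<sigma> (Suc k) * (descend k j * \<sigma> i)" using assms(1) i by (simp add: mult.assoc)
    also have "\<dots> \<approx>\<^bsub>l\<^esub> \<sigma> (Suc k) * (\<sigma> (i - 1) * descend k j)"
      by (rule hcong_left[OF Suc.IH]) (use Suc.prems i FAs in auto)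
    also have "\<dots> = (\<sigma> (Suc k) * \<sigma> (i - 1)) * descend k j" by (simp add: mult.assoc)
    also have "\<dots> \<approx>\<^bsub>l\<^esub> (\<sigma> (i - 1) * \<sigma> (Suc k)) * descend k j"
      by (rule hcong_right[OF rel_far]) (use Suc.prems i FAs assms(1) in auto)
    also have "\<dots> = \<sigma> (i - 1) * descend (Suc k) j" using assms(1) i by (simp add: mult.assoc)
    finally show ?thesis .
  qed
qed

lemma descend_quad:
  assumes "j < k" "k < l"
  shows "descend k j * \<sigma> (Suc j) \<approx>\<^bsub>l\<^esub> scale pp (descend k j) + descend k (Suc j)"
proof -
  have d: "descend k j = descend k (Suc j) * (\<sigma> (Suc j) :: 'k falg)"
    using descend_sigma[of "Suc j" k] assms by simp
  have "descend k j * \<sigma> (Suc j) = descend k (Suc j) * (\<sigma> (Suc j) * (\<sigma> (Suc j) :: 'k falg))" by (simp add: d mult.assoc)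
  also have "\<dots> \<approx>\<^bsub>l\<^esub> descend k (Suc j) * (scale pp (\<sigma> (Suc j)) + 1)"
    by (rule hcong_left[OF rel_quad]) (use assms in \<open>auto intro: descend_FA\<close>)
  also have "\<dots> = scale pp (descend k j) + descend k (Suc j)" by (simp add: d distrib_left)
  finally show ?thesis .
qed

lemma sigma_comm_ascend:
  assumes "Suc j < i" "i < l"
  shows "\<sigma> i * ascend j \<approx>\<^bsub>l\<^esub> ascend j * \<sigma> i"
  using assms(1)
proof (induction j)
  case 0
  show ?case using assms by (auto intro: hcong_refl)
next
  case (Suc j)
  then have "\<sigma> i * (ascend j * \<sigma> (Suc j)) \<approx>\<^bsub>l\<^esub> (ascend j * \<sigma> (Suc j)) * \<sigma> i"
    using assms by (intro comm_mult rel_far) (auto intro!: ascend_FA)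
  then show ?case by simp
qed

text \<open>The mirror image of \<open>descend_shift\<close>: here the braid relation raises the
  index, and \<open>E_shift\<close> lowers it again afterwards.\<close>

lemma ascend_shift:
  assumes "1 \<le> i" "i < j" "j < l"
  shows "ascend j * \<sigma> i \<approx>\<^bsub>l\<^esub> \<sigma> (Suc i) * ascend j"
  using assms(2,3)
proof (induction j)
  case 0
  then show ?case by simp
next
  case (Suc j)
  show ?case
  proof (cases "i = j")
    case True
    obtain j' where j: "j = Suc j'" using assms(1) True by (cases j) auto
    have FAs: "\<sigma> (Suc j) \<in> FA l" "\<sigma> j \<in> FA l" "ascend j' \<in> FA l" using Suc.prems j by (auto intro: ascend_FA)
    have "ascend (Suc j) * \<sigma> i = ascend j' * (\<sigma> j * \<sigma> (Suc j) * \<sigma> j)" using True j by (simp add: mult.assoc)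
    also have "\<dots> \<approx>\<^bsub>l\<^esub> ascend j' * (\<sigma> (Suc j) * \<sigma> j * \<sigma> (Suc j))"
      by (rule hcong_left[OF rel_braid]) (use Suc.prems j FAs in auto)
    also have "\<dots> = (ascend j' * \<sigma> (Suc j)) * (\<sigma> j * \<sigma> (Suc j))" by (simp add: mult.assoc)
    also have "\<dots> \<approx>\<^bsub>l\<^esub> (\<sigma> (Suc j) * ascend j') * (\<sigma> j * \<sigma> (Suc j))"
      by (rule hcong_right[OF hcong_sym[OF sigma_comm_ascend]]) (use Suc.prems j FAs in auto)
    also have "\<dots> = \<sigma> (Suc i) * ascend (Suc j)" using True j by (simp add: mult.assoc)
    finally show ?thesis .
  next
    case False
    then have i: "i < j" using Suc.prems by simp
    have FAs: "\<sigma> (Suc j) \<in> FA l" "\<sigma> i \<in> FA l" "ascend j \<in> FA l" using Suc.prems i assms(1) by (auto intro: ascend_FA)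
    have "ascend (Suc j) * \<sigma> i = ascend j * (\<sigma> (Suc j) * \<sigma> i)" by (simp add: mult.assoc)
    also have "\<dots> \<approx>\<^bsub>l\<^esub> ascend j * (\<sigma> i * \<sigma> (Suc j))"
      by (rule hcong_left[OF rel_far]) (use Suc.prems i FAs assms(1) in auto)
    also have "\<dots> = (ascend j * \<sigma> i) * \<sigma> (Suc j)" by (simp add: mult.assoc)
    also have "\<dots> \<approx>\<^bsub>l\<^esub> (\<sigma> (Suc i) * ascend j) * \<sigma> (Suc j)"
      by (rule hcong_right[OF Suc.IH]) (use Suc.prems i FAs in auto)
    also have "\<dots> = \<sigma> (Suc i) * ascend (Suc j)" by (simp add: mult.assoc)
    finally show ?thesis .
  qed
qed

lemma ascend_quad:
  assumes "1 \<le> j" "j < l"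
  shows "ascend j * \<sigma> j \<approx>\<^bsub>l\<^esub> scale pp (ascend j) + ascend (j - 1)"
proof -
  obtain i where i: "j = Suc i" using assms by (cases j) auto
  have "ascend j * \<sigma> j = ascend i * (\<sigma> j * \<sigma> j)" by (simp add: i mult.assoc)
  also have "\<dots> \<approx>\<^bsub>l\<^esub> ascend i * (scale pp (\<sigma> j) + 1)"
    by (rule hcong_left[OF rel_quad]) (use assms i in \<open>auto intro: ascend_FA\<close>)
  also have "\<dots> = scale pp (ascend j) + ascend (j - 1)" by (simp add: i distrib_left)
  finally show ?thesis .
qed


subsection \<open>Commuting \<open>\<tau>\<close> past \<open>\<sigma>\<^sub>1 \<tau>\<^sup>k \<sigma>\<^sub>1\<close>\<close>

lemma tau_power_assoc: "\<tau> ^ i * (\<tau> * a) = \<tau> * (\<tau> ^ i * a)"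
  by (metis mult.assoc power_commutes)

context
  notes One_nat_def [simp del]
begin

text \<open>Left combinations over the polynomials in \<open>\<tau>\<close>, modulo the ideal, of 1,
  \<open>\<sigma> 1 * \<tau> ^ i\<close> and \<open>\<sigma> 1 * \<tau> ^ i * \<sigma> 1\<close>,
  with \<open>k\<close> bounding the exponents. Powers of \<open>\<tau>\<close> on the left do no
  harm, because \<open>\<tau>\<close> commutes with the factor \<open>descend n 1\<close> that
  precedes in the application.\<close>

inductive tau_span :: "nat \<Rightarrow> nat \<Rightarrow> 'k falg \<Rightarrow> bool" for l k where
  sts: "1 \<le> i \<Longrightarrow> i \<le> k \<Longrightarrow> tau_span l k (\<sigma> 1 * \<tau> ^ i * \<sigma> 1)"
| st: "i \<le> k \<Longrightarrow> tau_span l k (\<sigma> 1 * \<tau> ^ i)"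
| t: "tau_span l k (\<tau> ^ i)"
| add: "tau_span l k a \<Longrightarrow> tau_span l k b \<Longrightarrow> tau_span l k (a + b)"
| scale: "tau_span l k a \<Longrightarrow> tau_span l k (scale c a)"
| tau: "tau_span l k a \<Longrightarrow> tau_span l k (\<tau> * a)"
| cong: "tau_span l k a \<Longrightarrow> a \<approx>\<^bsub>l\<^esub> b \<Longrightarrow> tau_span l k b"

lemma tau_span_FA: "tau_span l k a \<Longrightarrow> 1 < l \<Longrightarrow> a \<in> FA l"
  by (induction rule: tau_span.induct) (auto dest: hcong_FA)

lemma tau_span_mono: "tau_span l k a \<Longrightarrow> k \<le> k' \<Longrightarrow> tau_span l k' a"
  by (induction rule: tau_span.induct) (auto intro: tau_span.intros)

lemma tau_span_tau_power: "tau_span l k a \<Longrightarrow> tau_span l k (\<tau> ^ i * a)"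
  by (induction i) (auto simp: mult.assoc intro: tau_span.tau)

lemma tau_span_sigma:
  assumes "tau_span l k a" and l: "1 < l"
  shows "tau_span l k (a * \<sigma> 1)"
  using assms(1)
proof (induction rule: tau_span.induct)
  case (sts i)
  have "tau_span l k (scale pp (\<sigma> 1 * \<tau> ^ i * \<sigma> 1) + \<sigma> 1 * \<tau> ^ i)"
    using sts by (intro tau_span.add tau_span.scale tau_span.sts tau_span.st)
  moreover have "\<sigma> 1 * \<tau> ^ i * (scale pp (\<sigma> 1) + 1) \<approx>\<^bsub>l\<^esub> \<sigma> 1 * \<tau> ^ i * (\<sigma> 1 * \<sigma> 1)"
    by (rule hcong_left[OF hcong_sym[OF rel_quad]]) (use l in auto)
  ultimately show ?case
    by (auto simp: distrib_left mult.assoc intro: tau_span.cong)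
next
  case (st i)
  show ?case
  proof (cases "i = 0")
    case True
    have "tau_span l k (scale pp (\<sigma> 1 * \<tau> ^ 0) + \<tau> ^ 0)"
      by (intro tau_span.add tau_span.scale tau_span.st tau_span.t) simp
    moreover have "scale pp (\<sigma> 1) + 1 \<approx>\<^bsub>l\<^esub> \<sigma> 1 * \<sigma> 1" by (rule hcong_sym[OF rel_quad]) (use l in auto)
    ultimately show ?thesis using True by (auto intro: tau_span.cong)
  next
    case False
    then show ?thesis using st by (intro tau_span.sts) auto
  qed
next
  case (t i)
  show ?case using tau_span_tau_power[OF tau_span.st[of 0 k l]] by simp
next
  case (cong a b)
  then show ?case using hcong_right[of a l b "\<sigma> 1"] l by (auto intro: tau_span.cong)
qed (auto simp: distrib_right mult.assoc intro: tau_span.intros)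

text \<open>\<open>\<sigma> 1\<close> is invertible modulo the ideal with inverse
  \<open>\<sigma> 1\<close> - (q - 1/q), and right multiplication by both terms stays in the
  span.\<close>

lemma tau_span_sigma_inverse:
  assumes "tau_span l k (a * \<sigma> 1)" "1 < l" "a \<in> FA l"
  shows "tau_span l k a"
proof -
  have Y: "tau_span l k (a * \<sigma> 1 * \<sigma> 1 + scale (- pp) (a * \<sigma> 1))"
    by (intro tau_span.add tau_span.scale tau_span_sigma assms)
  have "a * (\<sigma> 1 * \<sigma> 1) + scale (- pp) (a * \<sigma> 1) \<approx>\<^bsub>l\<^esub> a * (scale pp (\<sigma> 1) + 1) + scale (- pp) (a * \<sigma> 1)"
    by (intro hcong_add hcong_left rel_quad hcong_refl) (use assms in auto)
  moreover have "a * (scale pp (\<sigma> 1) + 1) + scale (- pp) (a * \<sigma> 1) = a"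
    by (simp only: distrib_left scale_mult_right mult_1_right PM.scale_minus_left) simp
  ultimately have "a * \<sigma> 1 * \<sigma> 1 + scale (- pp) (a * \<sigma> 1) \<approx>\<^bsub>l\<^esub> a"
    by (simp only: mult.assoc)
  with Y show ?thesis by (rule tau_span.cong)
qed

text \<open>Right multiplication by the Jucys-Murphy element
  \<open>\<sigma> 1 * \<tau> * \<sigma> 1\<close> raises the bound by at most one. The hypothesis
  \<open>IH\<close> is what \<open>tau_past_sts\<close> proves, supplied there by its induction for
  smaller exponents.\<close>

lemma tau_span_times_J:
  assumes "tau_span l k a" and l: "1 < l"
    and IH: "\<And>i. 1 \<le> i \<Longrightarrow> i \<le> k \<Longrightarrow> tau_span l i (\<sigma> 1 * \<tau> ^ i * \<sigma> 1 * \<tau>)"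
  shows "tau_span l (Suc k) (a * (\<sigma> 1 * \<tau> * \<sigma> 1))"
  using assms(1)
proof (induction rule: tau_span.induct)
  case (sts i)
  have *: "tau_span l (Suc k) (\<sigma> 1 * \<tau> ^ i * \<sigma> 1 * \<tau> * \<sigma> 1)"
    by (rule tau_span_sigma[OF tau_span_mono[OF IH]]) (use sts l in auto)
  have "tau_span l (Suc k) (scale pp (\<sigma> 1 * \<tau> ^ i * \<sigma> 1 * \<tau> * \<sigma> 1) + \<sigma> 1 * \<tau> ^ Suc i * \<sigma> 1)"
    by (intro tau_span.add tau_span.scale tau_span.sts *) (use sts in auto)
  moreover have "(\<sigma> 1 * \<tau> ^ i) * (scale pp (\<sigma> 1) + 1) * (\<tau> * \<sigma> 1) \<approx>\<^bsub>l\<^esub> (\<sigma> 1 * \<tau> ^ i) * (\<sigma> 1 * \<sigma> 1) * (\<tau> * \<sigma> 1)"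
    by (rule hcong_right[OF hcong_left[OF hcong_sym[OF rel_quad]]]) (use l in auto)
  moreover have "(\<sigma> 1 * \<tau> ^ i) * (scale pp (\<sigma> 1) + 1) * (\<tau> * \<sigma> 1)
      = scale pp (\<sigma> 1 * \<tau> ^ i * \<sigma> 1 * \<tau> * \<sigma> 1) + \<sigma> 1 * \<tau> ^ Suc i * \<sigma> 1"
    by (simp add: distrib_left distrib_right mult.assoc tau_power_assoc)
  ultimately show ?case by (auto simp: mult.assoc intro: tau_span.cong)
next
  case (st i)
  show ?case
  proof (cases "i = 0")
    case True
    have "tau_span l (Suc k) (scale pp (\<sigma> 1 * \<tau> ^ 1 * \<sigma> 1) + \<tau> ^ 1 * (\<sigma> 1 * \<tau> ^ 0))"
      by (intro tau_span.add tau_span.scale tau_span.sts tau_span_tau_power tau_span.st) auto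
    moreover have "(scale pp (\<sigma> 1) + 1) * (\<tau> * \<sigma> 1) \<approx>\<^bsub>l\<^esub> (\<sigma> 1 * \<sigma> 1) * (\<tau> * \<sigma> 1)"
      by (rule hcong_right[OF hcong_sym[OF rel_quad]]) (use l in auto)
    ultimately show ?thesis using True by (auto simp: mult.assoc distrib_right intro: tau_span.cong)
  next
    case False
    have "tau_span l (Suc k) (\<sigma> 1 * \<tau> ^ i * \<sigma> 1 * \<tau> * \<sigma> 1)"
      by (rule tau_span_sigma[OF tau_span_mono[OF IH]]) (use st False l in auto)
    then show ?thesis by (simp add: mult.assoc)
  qed
next
  case (t i)
  show ?case using tau_span_tau_power[OF tau_span.sts[of 1 "Suc k" l]] by simp
next
  case (cong a b)
  then show ?case using hcong_right[of a l b "\<sigma> 1 * \<tau> * \<sigma> 1"] l by (auto intro: tau_span.cong)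
qed (auto simp: distrib_right mult.assoc intro: tau_span.intros)

text \<open>With \<open>s = \<sigma>\<^sub>1\<close> and \<open>Z = s \<tau>\<^sup>k\<^sup>+\<^sup>1 s \<tau>\<close>, the relation \<open>\<tau> s \<tau> = s\<^sup>-\<^sup>1 \<tau> s \<tau> s\<close> gives
  \<open>Z (1 + (q - q\<^sup>-\<^sup>1) s) = (s \<tau>\<^sup>k s \<tau>)(s \<tau> s)\<close>, and \<open>1 + (q - q\<^sup>-\<^sup>1) s = s\<^sup>2\<close> is invertible.\<close>

lemma tau_past_sts:
  assumes l: "1 < l" and "1 \<le> k"
  shows "tau_span l k (\<sigma> 1 * \<tau> ^ k * \<sigma> 1 * \<tau>)"
  using assms(2)
proof (induction k rule: less_induct)
  case (less k)
  show ?case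
  proof (cases "k = 1")
    case True
    have "tau_span l 1 (\<tau> * (\<sigma> 1 * \<tau> ^ 1 * \<sigma> 1))" by (intro tau_span.tau tau_span.sts) auto
    moreover have "\<tau> * (\<sigma> 1 * \<tau> ^ 1 * \<sigma> 1) \<approx>\<^bsub>l\<^esub> \<sigma> 1 * \<tau> ^ 1 * \<sigma> 1 * \<tau>"
      using rel_tau1[OF l] by (simp add: mult.assoc)
    ultimately show ?thesis using True by (auto intro: tau_span.cong)
  next
    case False
    then obtain j where k: "k = Suc j" and j: "1 \<le> j" using less.prems by (cases k) auto
    define Z where "Z = \<sigma> 1 * \<tau> ^ k * \<sigma> 1 * (\<tau> :: 'k falg)"
    have s: "(\<sigma> 1 :: 'k falg) \<in> FA l" using l by auto
    have Z: "Z \<in> FA l" using s by (auto simp: Z_def)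
    have Y: "tau_span l k ((\<sigma> 1 * \<tau> ^ j * \<sigma> 1 * \<tau>) * (\<sigma> 1 * \<tau> * \<sigma> 1))"
      unfolding k by (rule tau_span_times_J[OF less.IH l less.IH]) (use k j in auto)
    have "(\<sigma> 1 * \<tau> ^ j * \<sigma> 1 * \<tau>) * (\<sigma> 1 * \<tau> * \<sigma> 1) = (\<sigma> 1 * \<tau> ^ j) * \<sigma> 1 * (\<tau> * \<sigma> 1 * \<tau> * \<sigma> 1)"
      by (simp add: mult.assoc)
    also have "\<dots> \<approx>\<^bsub>l\<^esub> (\<sigma> 1 * \<tau> ^ j) * \<sigma> 1 * (\<sigma> 1 * \<tau> * \<sigma> 1 * \<tau>)"
      by (rule hcong_left[OF rel_tau1]) (use l s in auto)
    also have "\<dots> = (\<sigma> 1 * \<tau> ^ j) * (\<sigma> 1 * \<sigma> 1) * (\<tau> * \<sigma> 1 * \<tau>)" by (simp add: mult.assoc)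
    also have "\<dots> \<approx>\<^bsub>l\<^esub> (\<sigma> 1 * \<tau> ^ j) * (scale pp (\<sigma> 1) + 1) * (\<tau> * \<sigma> 1 * \<tau>)"
      by (rule hcong_right[OF hcong_left[OF rel_quad]]) (use l s in auto)
    also have "\<dots> = scale pp ((\<sigma> 1 * \<tau> ^ j) * (\<sigma> 1 * \<tau> * \<sigma> 1 * \<tau>)) + Z"
      by (simp add: Z_def k distrib_left distrib_right mult.assoc tau_power_assoc)
    also have "\<dots> \<approx>\<^bsub>l\<^esub> scale pp ((\<sigma> 1 * \<tau> ^ j) * (\<tau> * \<sigma> 1 * \<tau> * \<sigma> 1)) + Z"
      by (intro hcong_add hcong_scale hcong_left hcong_refl Z hcong_sym[OF rel_tau1]) (use l s in auto)
    also have "\<dots> = Z * (scale pp (\<sigma> 1) + 1)"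
      by (simp add: Z_def k distrib_left distrib_right mult.assoc tau_power_assoc)
    also have "\<dots> \<approx>\<^bsub>l\<^esub> Z * (\<sigma> 1 * \<sigma> 1)"
      by (rule hcong_left[OF hcong_sym[OF rel_quad]]) (use l Z in auto)
    finally have "tau_span l k (Z * \<sigma> 1 * \<sigma> 1)" using Y by (auto simp: mult.assoc intro: tau_span.cong)
    then have "tau_span l k Z" using tau_span_sigma_inverse l s Z by auto
    then show ?thesis by (simp add: Z_def)
  qed
qed

end


subsection \<open>Coset representatives\<close>

text \<open>The coefficients come from \<open>FA n\<close>, while the congruence is that of the next
  rank; a spanning set of rank \<open>n\<close> can later be substituted for the
  coefficients.\<close>

definition left_span :: "nat \<Rightarrow> 't set \<Rightarrow> ('t \<Rightarrow> 'k falg) \<Rightarrow> 'k falg set" where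
  "left_span n J s = {y. \<exists>h. (\<forall>t\<in>J. h t \<in> FA n) \<and> y \<approx>\<^bsub>Suc n\<^esub> (\<Sum>t\<in>J. h t * s t)}"

lemma left_spanI:
  "(\<And>t. t \<in> J \<Longrightarrow> h t \<in> FA n) \<Longrightarrow> y \<approx>\<^bsub>Suc n\<^esub> (\<Sum>t\<in>J. h t * s t) \<Longrightarrow> y \<in> left_span n J s"
  unfolding left_span_def by blast

lemma left_span_cong: "y \<in> left_span n J s \<Longrightarrow> z \<approx>\<^bsub>Suc n\<^esub> y \<Longrightarrow> z \<in> left_span n J s"
  unfolding left_span_def using hcong_trans by blast

lemma left_span_base:
  assumes "finite J" "t \<in> J" "a \<in> FA n" "s t \<in> FA (Suc n)"
  shows "a * s t \<in> left_span n J s"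
proof -
  have "(\<Sum>u\<in>J. (if u = t then a else 0) * s u) = a * s t"
    using assms by (simp add: if_distrib[of "\<lambda>x. x * _"] sum.delta cong: if_cong)
  moreover have "a * s t \<approx>\<^bsub>Suc n\<^esub> a * s t"
    using assms FA_mono[of n "Suc n"] by (auto intro!: hcong_refl)
  ultimately show ?thesis unfolding left_span_def using assms
    by (intro CollectI exI[of _ "\<lambda>u. if u = t then a else 0"]) auto
qed

lemma left_span_add:
  assumes "y \<in> left_span n J s" "z \<in> left_span n J s"
  shows "y + z \<in> left_span n J s"
proof -
  obtain h h' where "\<forall>t\<in>J. h t \<in> FA n" "y \<approx>\<^bsub>Suc n\<^esub> (\<Sum>t\<in>J. h t * s t)"
    "\<forall>t\<in>J. h' t \<in> FA n" "z \<approx>\<^bsub>Suc n\<^esub> (\<Sum>t\<in>J. h' t * s t)"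
    using assms unfolding left_span_def by blast
  then show ?thesis unfolding left_span_def
    using hcong_add[of y "Suc n" _ z] by (intro CollectI exI[of _ "\<lambda>t. h t + h' t"])
      (auto simp: distrib_right sum.distrib)
qed

lemma left_span_left:
  assumes "y \<in> left_span n J s" "a \<in> FA n"
  shows "a * y \<in> left_span n J s"
proof -
  obtain h where h: "\<forall>t\<in>J. h t \<in> FA n" "y \<approx>\<^bsub>Suc n\<^esub> (\<Sum>t\<in>J. h t * s t)"
    using assms unfolding left_span_def by blast
  have "a \<in> FA (Suc n)" using assms(2) FA_mono[of n "Suc n"] by auto
  from hcong_left[OF h(2) this] have "a * y \<approx>\<^bsub>Suc n\<^esub> (\<Sum>t\<in>J. (a * h t) * s t)"
    by (simp add: sum_distrib_left mult.assoc)
  then show ?thesis by (rule left_spanI[rotated]) (use h(1) assms(2) in auto)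
qed

lemma left_span_scale: "y \<in> left_span n J s \<Longrightarrow> scale c y \<in> left_span n J s"
  unfolding scale_eq_const_mult by (rule left_span_left) auto

lemma left_span_zero: "0 \<in> left_span n J s"
  unfolding left_span_def by (intro CollectI exI[of _ "\<lambda>_. 0"]) (auto intro: hcong_refl)

lemma left_span_sum: "(\<And>t. t \<in> T \<Longrightarrow> h t \<in> left_span n J s) \<Longrightarrow> sum h T \<in> left_span n J s"
  by (induction T rule: infinite_finite_induct) (auto intro: left_span_zero left_span_add)

text \<open>As coefficients stand on the left, right multiplication has to be examined on the
  spanning elements alone.\<close>

lemma left_span_transfer:
  assumes y: "y \<in> left_span n J s" and g: "g \<in> FA (Suc n)"
    and s: "\<And>t. t \<in> J \<Longrightarrow> s t * g \<in> left_span n J' s'"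
  shows "y * g \<in> left_span n J' s'"
proof -
  obtain h where h: "\<forall>t\<in>J. h t \<in> FA n" "y \<approx>\<^bsub>Suc n\<^esub> (\<Sum>t\<in>J. h t * s t)"
    using y unfolding left_span_def by blast
  have "(\<Sum>t\<in>J. h t * (s t * g)) \<in> left_span n J' s'"
  proof (rule left_span_sum)
    fix t assume "t \<in> J"
    then show "h t * (s t * g) \<in> left_span n J' s'" using h(1) by (intro left_span_left[OF s]) auto
  qed
  moreover have "y * g \<approx>\<^bsub>Suc n\<^esub> (\<Sum>t\<in>J. h t * (s t * g))"
    using hcong_right[OF h(2) g] by (simp add: sum_distrib_right mult.assoc)
  ultimately show ?thesis by (rule left_span_cong)
qed

definition reps :: "nat \<Rightarrow> (nat \<times> nat) set" where
  "reps n = {..n} \<times> {..<m}"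

text \<open>Representatives for rank \<open>n + 1\<close> over rank \<open>n\<close>. There are (n +
  1) m of them, the ratio of the two expected dimensions. For exponent 0 the product
  \<open>descend n 0 * ascend j\<close> is replaced by the shorter
  \<open>descend n j\<close>.\<close>

definition rep :: "nat \<Rightarrow> nat \<times> nat \<Rightarrow> 'k falg" where
  "rep n t = (if snd t = 0 then descend n (fst t) else descend n 0 * \<tau> ^ snd t * ascend (fst t))"

abbreviation W :: "nat \<Rightarrow> 'k falg set" where
  "W n \<equiv> left_span n (reps n) (rep n)"

lemma rep_FA: "t \<in> reps n \<Longrightarrow> rep n t \<in> FA (Suc n)"
  by (auto simp: rep_def reps_def intro!: FA_mult descend_FA ascend_FA)

lemma rep_in_W: "t \<in> reps n \<Longrightarrow> rep n t \<in> W n"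
  using left_span_base[of "reps n" t 1 n "rep n"] rep_FA by (auto simp: reps_def)

context
  fixes n :: nat
  assumes m: "1 \<le> m" and n: "1 \<le> n"
begin

lemma descend_in_W: "j \<le> n \<Longrightarrow> descend n j \<in> W n"
  using rep_in_W[of "(j, 0)" n] m by (simp add: rep_def[of n "(j, 0)"] reps_def)

lemma descend_sigma_in_span:
  assumes "j \<le> n" "1 \<le> i" "i \<le> n"
  shows "descend n j * \<sigma> i \<in> left_span n {..n} (descend n)"
proof -
  have base: "descend n j \<in> left_span n {..n} (descend n)" if "j \<le> n" for j
    using left_span_base[of "{..n}" j 1 n "descend n"] that by (auto intro: descend_FA)
  consider "Suc j < i" | "i = Suc j" | "i = j" | "i < j" by linarith
  then show ?thesis
  proof cases
    case 1
    then show ?thesis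
      using left_span_cong[OF left_span_left[OF base] descend_shift] assms by auto
  next
    case 2
    then show ?thesis
      using left_span_cong[OF left_span_add[OF left_span_scale[OF base] base] descend_quad] assms by auto
  next
    case 3
    then show ?thesis using base[of "i - 1"] descend_sigma[of i n] assms by simp
  next
    case 4
    then show ?thesis
      using left_span_cong[OF left_span_left[OF base] hcong_sym[OF sigma_comm_descend]] assms by auto
  qed
qed

lemma descend_span_subset: "y \<in> left_span n {..n} (descend n) \<Longrightarrow> y \<in> W n"
  using left_span_transfer[of y n "{..n}" "descend n" 1] descend_in_W by auto

lemma descend_up_in_span: "j \<le> n \<Longrightarrow> descend n 0 * ascend j \<in> left_span n {..n} (descend n)"
proof (induction j)
  case 0
  then show ?case using left_span_base[of "{..n}" 0 1 n "descend n"] by (auto intro: descend_FA)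
next
  case (Suc j)
  have "(descend n 0 * ascend j) * \<sigma> (Suc j) \<in> left_span n {..n} (descend n)"
    by (rule left_span_transfer[OF Suc.IH]) (use Suc.prems descend_sigma_in_span in auto)
  then show ?case by (simp add: mult.assoc)
qed

text \<open>Exponents from \<open>m\<close> on are lowered by the cyclotomic relation; exponent 0
  leads to products of the \<open>\<sigma> i\<close> alone, which the representatives
  \<open>descend n j\<close> span.\<close>

lemma E_in_W:
  assumes j: "j \<le> n"
  shows "descend n 0 * \<tau> ^ k * ascend j \<in> W n"
proof (induction k rule: less_induct)
  case (less k)
  consider "k = 0" | "0 < k" "k < m" | "m \<le> k" by linarith
  then show ?case
  proof cases
    case 1
    then show ?thesis using descend_span_subset[OF descend_up_in_span[OF j]] by simp
  next
    case 2
    then have "rep n (j, k) \<in> W n" using j by (intro rep_in_W) (simp add: reps_def)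
    then show ?thesis using 2 by (simp add: rep_def[of n "(j, k)"])
  next
    case 3
    obtain c where c: "\<tau> ^ m \<approx>\<^bsub>Suc n\<^esub> (\<Sum>i<m. scale (c i) (\<tau> ^ i))" using tau_power_m by blast
    have FAs: "descend n 0 \<in> FA (Suc n)" "ascend j \<in> FA (Suc n)" using j by (auto intro: descend_FA ascend_FA)
    have "(\<Sum>i<m. scale (c i) (descend n 0 * \<tau> ^ (i + (k - m)) * ascend j)) \<in> W n"
      by (intro left_span_sum left_span_scale less.IH) (use 3 in auto)
    moreover have "descend n 0 * (\<tau> ^ m * (\<tau> ^ (k - m) * ascend j))
        \<approx>\<^bsub>Suc n\<^esub> descend n 0 * ((\<Sum>i<m. scale (c i) (\<tau> ^ i)) * (\<tau> ^ (k - m) * ascend j))"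
      by (rule hcong_left[OF hcong_right[OF c]]) (use FAs in auto)
    moreover have "\<tau> ^ m * (\<tau> ^ (k - m) * ascend j) = \<tau> ^ k * (ascend j :: 'k falg)"
      using 3 by (simp add: mult.assoc[symmetric] power_add[symmetric])
    ultimately show ?thesis
      by (auto simp: sum_distrib_left sum_distrib_right mult.assoc power_add intro: left_span_cong)
  qed
qed

lemma E_shift:
  assumes "1 < i" "i \<le> n" "y \<in> FA (Suc n)"
  shows "descend n 0 * \<tau> ^ k * (\<sigma> i * y) \<approx>\<^bsub>Suc n\<^esub> \<sigma> (i - 1) * (descend n 0 * \<tau> ^ k * y)"
proof -
  have FAs: "descend n 0 \<in> FA (Suc n)" by (auto intro: descend_FA)
  have "descend n 0 * \<tau> ^ k * (\<sigma> i * y) = descend n 0 * ((\<tau> ^ k * \<sigma> i) * y)" by (simp add: mult.assoc)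
  also have "\<dots> \<approx>\<^bsub>Suc n\<^esub> descend n 0 * ((\<sigma> i * \<tau> ^ k) * y)"
    by (rule hcong_left[OF hcong_right[OF rel_tau_power]]) (use assms FAs in auto)
  also have "\<dots> = (descend n 0 * \<sigma> i) * (\<tau> ^ k * y)" by (simp add: mult.assoc)
  also have "\<dots> \<approx>\<^bsub>Suc n\<^esub> (\<sigma> (i - 1) * descend n 0) * (\<tau> ^ k * y)"
    by (rule hcong_right[OF descend_shift]) (use assms in auto)
  finally show ?thesis by (simp add: mult.assoc)
qed

text \<open>Either \<open>\<sigma> i\<close> changes the length of the ascending factor by at most
  one, or it can be carried through to the far left, where it arrives with an index below
  \<open>n\<close>.\<close>

lemma E_sigma_in_W:
  assumes "j \<le> n" "1 \<le> i" "i \<le> n"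
  shows "descend n 0 * \<tau> ^ k * ascend j * \<sigma> i \<in> W n"
proof -
  have FAs: "descend n 0 * \<tau> ^ k \<in> FA (Suc n)" "ascend j \<in> FA (Suc n)" using assms by (auto intro: descend_FA ascend_FA)
  consider "Suc j < i" | "i = Suc j" | "i = j" | "i < j" by linarith
  then show ?thesis
  proof cases
    case 1
    have "descend n 0 * \<tau> ^ k * (ascend j * \<sigma> i) \<approx>\<^bsub>Suc n\<^esub> descend n 0 * \<tau> ^ k * (\<sigma> i * ascend j)"
      by (rule hcong_left[OF hcong_sym[OF sigma_comm_ascend]]) (use 1 assms FAs in auto)
    also have "\<dots> \<approx>\<^bsub>Suc n\<^esub> \<sigma> (i - 1) * (descend n 0 * \<tau> ^ k * ascend j)" by (rule E_shift) (use 1 assms FAs in auto)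
    finally show ?thesis
      using left_span_cong[OF left_span_left[OF E_in_W[OF assms(1), of k], of "\<sigma> (i - 1)"]] 1 assms
      by (auto simp: mult.assoc)
  next
    case 2
    then show ?thesis using E_in_W[of "Suc j" k] assms by (simp add: mult.assoc)
  next
    case 3
    have "descend n 0 * \<tau> ^ k * (ascend j * \<sigma> j) \<approx>\<^bsub>Suc n\<^esub> descend n 0 * \<tau> ^ k * (scale pp (ascend j) + ascend (j - 1))"
      by (rule hcong_left[OF ascend_quad]) (use 3 assms FAs in auto)
    moreover have "scale pp (descend n 0 * \<tau> ^ k * ascend j) + descend n 0 * \<tau> ^ k * ascend (j - 1) \<in> W n"
      by (intro left_span_add left_span_scale E_in_W) (use assms in auto)
    ultimately show ?thesis using 3 by (auto simp: mult.assoc distrib_left intro: left_span_cong)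
  next
    case 4
    \<comment> \<open>Passing \<open>ascend j\<close> raises the index to \<open>Suc i\<close>,
      passing \<open>descend n 0\<close> lowers it back to \<open>i\<close>, which is less than
      \<open>j\<close>.\<close>
    have "descend n 0 * \<tau> ^ k * (ascend j * \<sigma> i) \<approx>\<^bsub>Suc n\<^esub> descend n 0 * \<tau> ^ k * (\<sigma> (Suc i) * ascend j)"
      by (rule hcong_left[OF ascend_shift]) (use 4 assms FAs in auto)
    also have "\<dots> \<approx>\<^bsub>Suc n\<^esub> \<sigma> (Suc i - 1) * (descend n 0 * \<tau> ^ k * ascend j)" by (rule E_shift) (use 4 assms FAs in auto)
    finally show ?thesis
      using left_span_cong[OF left_span_left[OF E_in_W[OF assms(1), of k], of "\<sigma> i"]] 4 assms
      by (auto simp: mult.assoc)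
  qed
qed

lemma W_sigma:
  assumes "y \<in> W n" "1 \<le> i" "i \<le> n"
  shows "y * \<sigma> i \<in> W n"
proof (rule left_span_transfer[OF assms(1)])
  fix t assume "t \<in> reps n"
  then show "rep n t * \<sigma> i \<in> W n"
    using descend_span_subset[OF descend_sigma_in_span[of "fst t" i]] E_sigma_in_W[of "fst t" i "snd t"] assms
    by (auto simp: rep_def reps_def)
qed (use assms in auto)

text \<open>\<open>descend n 1\<close> absorbs a leading \<open>\<sigma> 1\<close> to become
  \<open>descend n 0\<close>, and a leading \<open>\<tau>\<close> commutes with it and becomes a
  coefficient.\<close>

lemma tau_span_in_W:
  assumes "tau_span (Suc n) k y"
  shows "descend n 1 * y \<in> W n"
  using assms
proof (induction rule: tau_span.induct)
  case (sts i)
  then show ?case using E_in_W[of 1 i] descend_sigma[of 1 n] n by (simp add: mult.assoc[symmetric])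
next
  case (st i)
  then show ?case using E_in_W[of 0 i] descend_sigma[of 1 n] n by (simp add: mult.assoc[symmetric])
next
  case (t i)
  have "descend n 1 * \<tau> ^ i \<approx>\<^bsub>Suc n\<^esub> \<tau> ^ i * descend n 1"
  proof (induction i)
    case 0
    show ?case by (auto intro: hcong_refl descend_FA)
  next
    case (Suc i)
    have "descend n 1 * \<tau> ^ Suc i = (descend n 1 * \<tau>) * \<tau> ^ i" by (simp add: mult.assoc)
    also have "\<dots> \<approx>\<^bsub>Suc n\<^esub> (\<tau> * descend n 1) * \<tau> ^ i" by (rule hcong_right[OF hcong_sym[OF tau_comm_descend]]) auto
    also have "\<dots> = \<tau> * (descend n 1 * \<tau> ^ i)" by (simp add: mult.assoc)
    also have "\<dots> \<approx>\<^bsub>Suc n\<^esub> \<tau> * (\<tau> ^ i * descend n 1)" by (rule hcong_left[OF Suc]) auto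
    finally show ?case by (simp add: mult.assoc)
  qed
  then show ?case by (rule left_span_cong[OF left_span_left[OF descend_in_W[OF n]], rotated]) auto
next
  case (tau a)
  have "a \<in> FA (Suc n)" using tau_span_FA tau.hyps n by auto
  then have "(descend n 1 * \<tau>) * a \<approx>\<^bsub>Suc n\<^esub> (\<tau> * descend n 1) * a"
    by (intro hcong_right[OF hcong_sym[OF tau_comm_descend]]) auto
  with left_span_left[OF tau.IH] show ?case by (auto simp: mult.assoc intro: left_span_cong)
next
  case (cong a b)
  have "descend n 1 * b \<approx>\<^bsub>Suc n\<^esub> descend n 1 * a"
    by (rule hcong_left[OF hcong_sym[OF cong.hyps(2)]]) (auto intro: descend_FA)
  with cong.IH show ?case by (auto intro: left_span_cong)
qed (auto simp: distrib_left intro: left_span_add left_span_scale)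

lemma W_tau:
  assumes "y \<in> W n"
  shows "y * \<tau> \<in> W n"
proof (rule left_span_transfer[OF assms])
  fix t assume t: "t \<in> reps n"
  obtain j k where jk: "t = (j, k)" "j \<le> n" "k < m" using t by (auto simp: reps_def)
  show "rep n t * \<tau> \<in> W n"
  proof (cases "k = 0")
    case True
    show ?thesis
    proof (cases "j = 0")
      case True
      then show ?thesis using E_in_W[of 0 1] jk \<open>k = 0\<close> by (simp add: rep_def)
    next
      case False
      then have "descend n j * \<tau> \<approx>\<^bsub>Suc n\<^esub> \<tau> * descend n j" by (intro hcong_sym[OF tau_comm_descend]) auto
      with left_span_left[OF descend_in_W[OF jk(2)]] show ?thesis
        using True jk by (auto simp: rep_def intro: left_span_cong)
    qed
  next
    case k: False
    show ?thesis
    proof (cases "j = 0")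
      case True
      then show ?thesis using E_in_W[of 0 "Suc k"] jk k by (simp add: rep_def mult.assoc power_commutes)
    next
      case False
      \<comment> \<open>\<open>u\<close> is the part of \<open>ascend j\<close> after
        \<open>\<sigma> 1\<close>; it commutes with \<open>\<tau>\<close>, so only
        \<open>\<sigma> 1 * \<tau> ^ k * \<sigma> 1 * \<tau>\<close> needs
        \<open>tau_past_sts\<close>.\<close>
      define u where "u = prod_list (map (\<sigma> :: nat \<Rightarrow> 'k falg) [2..<Suc j])"
      have u: "\<tau> * u \<approx>\<^bsub>Suc n\<^esub> u * \<tau>"
      proof -
        have "\<tau> * prod_list (map \<sigma> is) \<approx>\<^bsub>Suc n\<^esub> prod_list (map \<sigma> is) * \<tau>
            \<and> prod_list (map \<sigma> is) \<in> (FA (Suc n) :: 'k falg set)"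
          if "set is \<subseteq> {2..n}" for "is"
          using that by (induction "is") (auto intro!: hcong_refl comm_mult rel_tau)
        moreover have "set [2..<Suc j] \<subseteq> {2..n}" using jk(2) by (auto simp del: upt_Suc)
        ultimately show ?thesis unfolding u_def by blast
      qed
      have closed: "y * prod_list (map \<sigma> is) \<in> W n" if "y \<in> W n" "set is \<subseteq> {1..n}" for y "is"
        using that
      proof (induction "is" arbitrary: y)
        case (Cons i "is")
        then have "(y * \<sigma> i) * prod_list (map \<sigma> is) \<in> W n" by (intro Cons.IH W_sigma) auto
        then show ?case by (simp add: mult.assoc)
      qed simp
      have "(descend n 1 * (\<sigma> 1 * \<tau> ^ k * \<sigma> 1 * \<tau>)) * u \<in> W n"
        unfolding u_def
        by (rule closed[OF tau_span_in_W[OF tau_past_sts]]) (use n k jk in auto)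
      moreover have "(descend n 0 * \<tau> ^ k * \<sigma> 1) * (u * \<tau>) \<approx>\<^bsub>Suc n\<^esub> (descend n 0 * \<tau> ^ k * \<sigma> 1) * (\<tau> * u)"
        by (rule hcong_left[OF hcong_sym[OF u]]) (use n in \<open>auto intro!: FA_mult descend_FA\<close>)
      moreover have "descend n 0 = descend n 1 * (\<sigma> 1 :: 'k falg)" using descend_sigma[of 1 n] n by simp
      ultimately show ?thesis
        using ascend_split[of j] jk k False
        by (auto simp: rep_def u_def mult.assoc simp del: upt_Suc intro: left_span_cong)
    qed
  qed
qed auto

lemma FA_subset_W: "a \<in> FA (Suc n) \<Longrightarrow> a \<in> W n"
proof (induction rule: FA_induct)
  case one
  show ?case using descend_in_W[of n] by simp
qed (auto intro: left_span_add left_span_scale W_tau W_sigma)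

end

section \<open>Spanning sets by induction on the rank\<close>

definition spans_hecke :: "nat \<Rightarrow> 'k falg set \<Rightarrow> bool" where
  "spans_hecke n M \<longleftrightarrow> M \<subseteq> FA n \<and> (\<forall>a\<in>FA n. \<exists>b\<in>PM.span M. a \<approx>\<^bsub>n\<^esub> b)"

lemma spans_hecke_one: "spans_hecke 1 ((\<lambda>k. \<tau> ^ k) ` {..<m})"
proof -
  let ?M = "(\<lambda>k. \<tau> ^ k) ` {..<m} :: 'k falg set"
  define P where "P a \<longleftrightarrow> (\<exists>b\<in>PM.span ?M. a \<approx>\<^bsub>1\<^esub> b)" for a
  have add: "P (a + b)" if ab: "P a" "P b" for a b
    using ab hcong_add PM.span_add unfolding P_def by blast
  have scale: "P (scale c a)" if a: "P a" for c a
    using a hcong_scale PM.span_scale unfolding P_def by blast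
  have cong: "P a" if "P b" "a \<approx>\<^bsub>1\<^esub> b" for a b
    using that hcong_trans unfolding P_def by blast
  have zero: "P 0" unfolding P_def by (intro bexI[of _ 0] PM.span_zero hcong_refl) auto
  have sum: "P (sum h T)" if "\<And>t. t \<in> T \<Longrightarrow> P (h t)" for h and T :: "nat set"
    using that by (induction T rule: infinite_finite_induct) (auto intro: zero add)
  have power: "P (\<tau> ^ k)" for k
  proof (induction k rule: less_induct)
    case (less k)
    show ?case
    proof (cases "k < m")
      case True
      then show ?thesis unfolding P_def by (intro bexI[of _ "\<tau> ^ k"] PM.span_base hcong_refl) auto
    next
      case False
      obtain c where c: "\<tau> ^ m \<approx>\<^bsub>1\<^esub> (\<Sum>i<m. scale (c i) (\<tau> ^ i))" using tau_power_m by blast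
      have "P (\<Sum>i<m. scale (c i) (\<tau> ^ (i + (k - m))))"
        by (intro sum scale less.IH) (use False in auto)
      moreover have "\<tau> ^ m * \<tau> ^ (k - m) \<approx>\<^bsub>1\<^esub> (\<Sum>i<m. scale (c i) (\<tau> ^ i)) * \<tau> ^ (k - m)"
        by (rule hcong_right[OF c]) auto
      ultimately show ?thesis using False by (auto simp: sum_distrib_right simp flip: power_add intro: cong)
    qed
  qed
  have "P a" if "a \<in> FA 1" for a
  proof -
    \<comment> \<open>Induction on words that grow on the right asks for all powers of
      \<open>\<tau>\<close> behind \<open>a\<close> at once.\<close>
    have "\<forall>k. P (a * \<tau> ^ k)" using that
    proof (induction rule: FA_induct)
      case (tau a)
      show ?case
      proof
        fix k
        from tau.IH have "P (a * \<tau> ^ Suc k)" by blast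
        then show "P (a * \<tau> * \<tau> ^ k)" by (simp add: mult.assoc)
      qed
    qed (auto simp: power distrib_right intro: add scale)
    then have "P (a * \<tau> ^ 0)" by blast
    then show ?thesis by simp
  qed
  then show ?thesis by (auto simp: spans_hecke_def P_def)
qed

lemma spans_hecke_Suc:
  assumes m: "1 \<le> m" and n: "1 \<le> n" and M: "spans_hecke n M"
  shows "spans_hecke (Suc n) ((\<lambda>(w, t). w * rep n t) ` (M \<times> reps n))"
proof -
  let ?M = "(\<lambda>(w, t). w * rep n t) ` (M \<times> reps n)"
  have mult: "b * rep n t \<in> PM.span ?M" if "b \<in> PM.span M" "t \<in> reps n" for b t
    using that(1)
  proof (induction rule: PM.span_induct_alt)
    case base
    show ?case by (simp add: PM.span_zero)
  next
    case (step c x y)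
    then have "x * rep n t \<in> PM.span ?M" using that(2) by (intro PM.span_base) auto
    then have "scale c (x * rep n t) + y * rep n t \<in> PM.span ?M"
      using step by (intro PM.span_add PM.span_scale) auto
    then show ?case by (simp add: distrib_right)
  qed
  have "\<exists>b\<in>PM.span ?M. a \<approx>\<^bsub>Suc n\<^esub> b" if a: "a \<in> FA (Suc n)" for a
  proof -
    obtain h where h: "\<forall>t\<in>reps n. h t \<in> FA n" "a \<approx>\<^bsub>Suc n\<^esub> (\<Sum>t\<in>reps n. h t * rep n t)"
      using FA_subset_W[OF m n a] by (auto simp: left_span_def)
    have "\<forall>t\<in>reps n. \<exists>b\<in>PM.span M. h t \<approx>\<^bsub>n\<^esub> b" using h(1) M by (auto simp: spans_hecke_def)
    then obtain b where b: "\<And>t. t \<in> reps n \<Longrightarrow> b t \<in> PM.span M \<and> h t \<approx>\<^bsub>n\<^esub> b t" by metis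
    note h(2)
    also have "(\<Sum>t\<in>reps n. h t * rep n t) \<approx>\<^bsub>Suc n\<^esub> (\<Sum>t\<in>reps n. b t * rep n t)"
      by (intro hcong_sum hcong_right hcong_mono[of _ n _ "Suc n"] rep_FA) (use b in auto)
    finally have "a \<approx>\<^bsub>Suc n\<^esub> (\<Sum>t\<in>reps n. b t * rep n t)" .
    moreover have "(\<Sum>t\<in>reps n. b t * rep n t) \<in> PM.span ?M"
      by (rule PM.span_sum, rule mult) (use b in blast)+
    ultimately show ?thesis by (rule bexI)
  qed
  moreover have "?M \<subseteq> FA (Suc n)"
  proof clarify
    fix w t assume "w \<in> M" "t \<in> reps n"
    then show "w * rep n t \<in> FA (Suc n)"
      using M FA_mono[of n "Suc n"] by (intro FA_mult rep_FA) (auto simp: spans_hecke_def)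
  qed
  ultimately show ?thesis unfolding spans_hecke_def by blast
qed

text \<open>An inequality is all that can be read off here, as different products might coincide;
  that none do follows from the action on paths.\<close>

theorem hecke_spanning_set:
  assumes "1 \<le> m" "1 \<le> n"
  shows "\<exists>M. finite M \<and> card M \<le> fact n * m ^ n \<and> spans_hecke n M"
  using assms(2)
proof (induction n rule: nat_induct_at_least)
  case base
  have "card ((\<lambda>k. \<tau> ^ k :: 'k falg) ` {..<m}) \<le> m" using card_image_le[of "{..<m}"] by simp
  then show ?case using spans_hecke_one by (intro exI[of _ "(\<lambda>k. \<tau> ^ k) ` {..<m}"]) auto
next
  case (Suc n)
  then obtain M where M: "finite M" "card M \<le> fact n * m ^ n" "spans_hecke n M" by blast
  let ?M = "(\<lambda>(w, t). w * rep n t) ` (M \<times> reps n)"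
  have fin: "finite (M \<times> reps n)" using M by (simp add: reps_def)
  have "card ?M \<le> card M * card (reps n)" using card_image_le[OF fin] by (simp add: card_cartesian_product)
  also have "\<dots> \<le> (fact n * m ^ n) * (Suc n * m)" using M(2) by (intro mult_mono) (auto simp: reps_def)
  finally have "card ?M \<le> fact (Suc n) * m ^ Suc n" by (simp add: algebra_simps)
  then show ?case using spans_hecke_Suc[OF assms(1) Suc.hyps M(3)] fin by blast
qed

end


section \<open>Standard tableaux as paths\<close>

lemma mnodes_Sigma: "mnodes lam = (SIGMA k:{1..length lam}. SIGMA r:{1..length (lam ! (k - 1))}. {1..lam ! (k - 1) ! (r - 1)})"
  by (auto simp: mnodes_def)

lemma finite_mnodes: "finite (mnodes lam)"
  unfolding mnodes_Sigma by (intro finite_SigmaI) auto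

lemma sum_shift: "(\<Sum>i=1..k. h (i - 1)) = (\<Sum>i=0..<k. h i)" for h :: "nat \<Rightarrow> nat"
  by (rule sum.reindex_bij_witness[of _ Suc "\<lambda>i. i - 1"]) auto

lemma card_mnodes: "card (mnodes lam) = (\<Sum>p\<leftarrow>lam. sum_list p)"
proof -
  have "card (mnodes lam) = (\<Sum>k=1..length lam. \<Sum>r=1..length (lam ! (k - 1)). lam ! (k - 1) ! (r - 1))"
    unfolding mnodes_Sigma by simp
  also have "\<dots> = (\<Sum>k=1..length lam. sum_list (lam ! (k - 1)))"
    by (simp only: sum_shift[of "\<lambda>r. _ ! r"] sum_list_sum_nth)
  also have "\<dots> = (\<Sum>k=0..<length lam. sum_list (lam ! k))" by (rule sum_shift)
  finally show ?thesis by (simp add: sum_list_sum_nth)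
qed

lemma mnodes_diagram:
  assumes "lam \<in> mpartitions m n"
  shows "diagram m (mnodes lam)" "card (mnodes lam) = n"
proof -
  have lam: "length lam = m" "\<And>p. p \<in> set lam \<Longrightarrow> is_partition p" "(\<Sum>p\<leftarrow>lam. sum_list p) = n"
    using assms by (auto simp: mpartitions_def)
  show "card (mnodes lam) = n" by (simp add: card_mnodes lam)
  show "diagram m (mnodes lam)"
    unfolding diagram_def
  proof (intro conjI ballI)
    show "finite (mnodes lam)" by (rule finite_mnodes)
    fix x assume x: "x \<in> mnodes lam"
    obtain k r s where xe: "x = (k, r, s)" by (metis prod_cases3)
    have h: "k \<in> {1..m}" "1 \<le> r" "r \<le> length (lam ! (k - 1))" "1 \<le> s" "s \<le> lam ! (k - 1) ! (r - 1)"
      using x lam(1) by (auto simp: xe mnodes_def)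
    show "node_ok m x" using h by (simp add: xe)
    have "lam ! (k - 1) \<in> set lam" using h(1) lam(1) by (intro nth_mem) auto
    then have "sorted_wrt (\<ge>) (lam ! (k - 1))" using lam(2) by (auto simp: is_partition_def)
    then have "lam ! (k - 1) ! (r - 1) \<le> lam ! (k - 1) ! (r - 1 - 1)" if "1 < r"
      using sorted_wrt_nth_less[of "(\<ge>)" "lam ! (k - 1)" "r - 1 - 1" "r - 1"] h that by auto
    then have "(k, r - 1, s) \<in> mnodes lam" if "1 < r" using h that lam(1) by (force simp: mnodes_def)
    moreover have "(k, r, s - 1) \<in> mnodes lam" if "1 < s" using h that lam(1) by (auto simp: mnodes_def)
    ultimately show "preds x \<subseteq> mnodes lam" by (auto simp: xe)
  qed
qed

text \<open>Parts of a partition are positive, so the number of rows of a component is read off from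
  its first column.\<close>

lemma diagram_is_mnodes:
  assumes Y: "diagram m Y"
  shows "\<exists>lam\<in>mpartitions m (card Y). mnodes lam = Y"
proof -
  define rows where "rows k = card {r. (k, r, 1) \<in> Y}" for k
  have first: "(k, r, 1) \<in> Y \<longleftrightarrow> 1 \<le> r \<and> r \<le> rows k" for k r
  proof -
    let ?D = "{r. (k, r, 1) \<in> Y}"
    have "?D = (\<lambda>r. (k, r, 1)) -` Y" by auto
    moreover have "finite ((\<lambda>r. (k, r, 1::nat)) -` Y)"
      by (rule finite_vimageI[OF diagram_finite[OF Y]]) (simp add: inj_def)
    ultimately have "finite ?D" by simp
    then have "?D = {1..card ?D}"
    proof (rule initial_segment)
      fix r assume r: "r \<in> ?D"
      then show "1 \<le> r" using diagram_node_ok[OF Y, of "(k, r, 1)"] by simp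
      show "t \<in> ?D" if "1 \<le> t" "t \<le> r" for t
        using diagram_downward[OF Y _ that order_refl order_refl] r by simp
    qed
    then have "r \<in> ?D \<longleftrightarrow> r \<in> {1..card ?D}" by (rule arg_cong)
    then show ?thesis by (simp add: rows_def)
  qed
  define lam where "lam = map (\<lambda>k. map (row_length Y k) [1..<Suc (rows k)]) [1..<Suc m]"
  have len: "length lam = m" by (simp add: lam_def)
  have nth: "lam ! (k - 1) = map (row_length Y k) [1..<Suc (rows k)]" if "k \<in> {1..m}" for k
    using that by (auto simp: lam_def simp del: upt_Suc)
  have "(k, r, s) \<in> mnodes lam \<longleftrightarrow> (k, r, s) \<in> Y" for k r s
  proof -
    have "(k, r, s) \<in> mnodes lam \<longleftrightarrow> k \<in> {1..m} \<and> r \<in> {1..rows k} \<and> s \<in> {1..row_length Y k r}"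
    proof (cases "k \<in> {1..m}")
      case True
      have l: "lam ! (k - Suc 0) = map (row_length Y k) [1..<Suc (rows k)]" using nth[OF True] by simp
      have "map (row_length Y k) [1..<Suc (rows k)] ! (r - Suc 0) = row_length Y k r" if "1 \<le> r" "r \<le> rows k"
        using that by (simp del: upt_Suc)
      then show ?thesis using True by (auto simp: mnodes_def len l simp del: upt_Suc)
    qed (auto simp: mnodes_def len)
    also have "\<dots> \<longleftrightarrow> k \<in> {1..m} \<and> (k, r, 1) \<in> Y \<and> (k, r, s) \<in> Y"
      using first[of k r] by (auto simp: mem_diagram_iff[OF Y])
    also have "\<dots> \<longleftrightarrow> (k, r, s) \<in> Y"
      using diagram_node_ok[OF Y, of "(k, r, s)"] diagram_downward[OF Y, of k r s r 1] by auto
    finally show ?thesis .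
  qed
  then have mn: "mnodes lam = Y" by auto
  have "is_partition (map (row_length Y k) [1..<Suc (rows k)])" for k
    unfolding is_partition_def
  proof
    show "sorted_wrt (\<ge>) (map (row_length Y k) [1..<Suc (rows k)])"
      unfolding sorted_wrt_map
      by (rule sorted_wrt_mono_rel[of _ "(<)"]) (auto intro: row_length_antimono[OF Y] simp del: upt_Suc)
    have "row_length Y k r \<noteq> 0" if "r \<in> {1..rows k}" for r
      using first[of k r] that by (auto simp: mem_diagram_iff[OF Y])
    then show "0 \<notin> set (map (row_length Y k) [1..<Suc (rows k)])" by (force simp del: upt_Suc)
  qed
  then have "\<forall>p\<in>set lam. is_partition p" by (auto simp: lam_def simp del: upt_Suc)
  moreover have "(\<Sum>p\<leftarrow>lam. sum_list p) = card Y" using card_mnodes[of lam] mn by simp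
  ultimately have "lam \<in> mpartitions m (card Y)" by (simp add: mpartitions_def len)
  with mn show ?thesis by blast
qed

text \<open>Standardness is left out, since exchanging \<open>i\<close> and \<open>i + 1\<close> in
  a standard tableau may destroy it while the list of nodes must still be available.\<close>

definition filling :: "nat \<Rightarrow> nat list list \<Rightarrow> tableau \<Rightarrow> bool" where
  "filling n lam X \<longleftrightarrow> X \<in> extensional (mnodes lam) \<and> bij_betw X (mnodes lam) {1..n}"

definition tableau_path :: "nat \<Rightarrow> nat list list \<Rightarrow> tableau \<Rightarrow> mnode list" where
  "tableau_path n lam X = map (node_of lam X) [1..<Suc n]"

lemma length_tableau_path [simp]: "length (tableau_path n lam X) = n"
  by (simp add: tableau_path_def)

lemma nth_tableau_path: "j < n \<Longrightarrow> tableau_path n lam X ! j = node_of lam X (Suc j)"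
  by (simp add: tableau_path_def del: upt_Suc)

lemma filling_node_of:
  assumes "filling n lam X"
  shows "i \<in> {1..n} \<Longrightarrow> node_of lam X i \<in> mnodes lam" "i \<in> {1..n} \<Longrightarrow> X (node_of lam X i) = i"
    and "x \<in> mnodes lam \<Longrightarrow> node_of lam X (X x) = x" "x \<in> mnodes lam \<Longrightarrow> X x \<in> {1..n}"
proof -
  have b: "bij_betw X (mnodes lam) {1..n}" using assms by (simp add: filling_def)
  show "i \<in> {1..n} \<Longrightarrow> node_of lam X i \<in> mnodes lam"
    unfolding node_of_def using bij_betwE[OF bij_betw_inv_into[OF b]] by blast
  show "i \<in> {1..n} \<Longrightarrow> X (node_of lam X i) = i"
    unfolding node_of_def by (rule bij_betw_inv_into_right[OF b])
  show "x \<in> mnodes lam \<Longrightarrow> node_of lam X (X x) = x"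
    unfolding node_of_def by (rule bij_betw_inv_into_left[OF b])
  show "x \<in> mnodes lam \<Longrightarrow> X x \<in> {1..n}" using bij_betwE[OF b] by blast
qed

lemma set_take_tableau_path:
  assumes "filling n lam X"
  shows "set (take i (tableau_path n lam X)) = {x \<in> mnodes lam. X x \<le> i}"
proof -
  have "set (take i [1..<Suc n]) = {1..min i n}"
  proof (cases "i \<le> n")
    case True
    then have "take i [1..<Suc n] = [1..<1 + i]" by (intro take_upt) simp
    then show ?thesis using True by (auto simp del: upt_Suc)
  qed (auto simp del: upt_Suc)
  then have "set (take i (tableau_path n lam X)) = node_of lam X ` {1..min i n}"
    by (simp only: tableau_path_def take_map set_map)
  also have "\<dots> = {x \<in> mnodes lam. X x \<le> i}"
  proof (intro equalityI subsetI)
    fix x assume "x \<in> {x \<in> mnodes lam. X x \<le> i}"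
    then have "x = node_of lam X (X x)" "X x \<in> {1..min i n}" using filling_node_of(3,4)[OF assms, of x] by auto
    then show "x \<in> node_of lam X ` {1..min i n}" by blast
  qed (use filling_node_of(1,2)[OF assms] in auto)
  finally show ?thesis .
qed

lemma tableau_path_distinct: "filling n lam X \<Longrightarrow> distinct (tableau_path n lam X)"
  unfolding tableau_path_def
  by (rule distinct_map[THEN iffD2]) (auto intro!: inj_on_inverseI[of _ X] filling_node_of(2) simp del: upt_Suc)

lemma set_tableau_path: "filling n lam X \<Longrightarrow> set (tableau_path n lam X) = mnodes lam"
  using set_take_tableau_path[of n lam X n] filling_node_of(4)[of n lam X] by auto

text \<open>The first \<open>i\<close> nodes of the list are those with entry at most
  \<open>i\<close>. These sets are all closed under \<open>preds\<close> iff the entries increase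
  along rows and columns.\<close>

lemma standard_iff_path:
  assumes lam: "lam \<in> mpartitions m n" and X: "filling n lam X"
  shows "X \<in> standard_tableaux n lam \<longleftrightarrow> path m (tableau_path n lam X)"
proof
  note D = mnodes_diagram(1)[OF lam]
  assume std: "X \<in> standard_tableaux n lam"
  have pred: "X y < X x" if "x \<in> mnodes lam" "y \<in> preds x" for x y
  proof -
    have "y \<in> mnodes lam" using D that unfolding diagram_def by blast
    moreover obtain k r s where "x = (k, r, s)" by (metis prod_cases3)
    ultimately show ?thesis using std that by (auto simp: standard_tableaux_def split: if_splits)
  qed
  have "diagram m (set (take i (tableau_path n lam X)))" for i
    unfolding set_take_tableau_path[OF X] diagram_def
  proof (intro conjI ballI)
    fix x assume x: "x \<in> {x \<in> mnodes lam. X x \<le> i}"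
    then show "node_ok m x" using diagram_node_ok[OF D] by blast
    show "preds x \<subseteq> {x \<in> mnodes lam. X x \<le> i}"
    proof
      fix y assume "y \<in> preds x"
      moreover from this have "y \<in> mnodes lam" using D x unfolding diagram_def by blast
      ultimately show "y \<in> {x \<in> mnodes lam. X x \<le> i}" using pred[of x y] x by auto
    qed
  qed (simp add: finite_mnodes)
  then show "path m (tableau_path n lam X)" using tableau_path_distinct[OF X] by (simp add: path_def)
next
  assume p: "path m (tableau_path n lam X)"
  have D: "diagram m {x \<in> mnodes lam. X x \<le> i}" for i
    using p unfolding path_def set_take_tableau_path[OF X] by blast
  have inj: "inj_on X (mnodes lam)" using X by (simp add: filling_def bij_betw_def)
  have mono: "X (k, r, s) < X (k, r', s')"
    if "(k, r, s) \<in> mnodes lam" "(k, r', s') \<in> mnodes lam" "r \<le> r'" "s \<le> s'" "(r, s) \<noteq> (r', s')" for k r s r' s'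
  proof -
    have "1 \<le> r" "1 \<le> s" using that(1) by (auto simp: mnodes_def)
    then have "X (k, r, s) \<le> X (k, r', s')"
      using diagram_downward[OF D[of "X (k, r', s')"], of k r' s' r s] that by simp
    moreover have "X (k, r, s) \<noteq> X (k, r', s')" using inj that by (auto dest: inj_onD)
    ultimately show ?thesis by simp
  qed
  then show "X \<in> standard_tableaux n lam"
    using X unfolding standard_tableaux_def filling_def by auto
qed

lemma standard_filling: "X \<in> standard_tableaux n lam \<Longrightarrow> filling n lam X"
  by (auto simp: standard_tableaux_def filling_def)

lemma node_of_eq: "filling n lam X \<Longrightarrow> x \<in> mnodes lam \<Longrightarrow> X x = i \<Longrightarrow> node_of lam X i = x"
  using filling_node_of(3) by blast

lemma filling_swap:
  assumes X: "filling n lam X" and i: "1 \<le> i" "i < n"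
  shows "filling n lam (swap_tableau lam i X)"
    and "j \<in> {1..n} \<Longrightarrow> node_of lam (swap_tableau lam i X) j = node_of lam X (transpose i (i + 1) j)"
proof -
  have "bij_betw (transpose i (i + 1)) {1..n} {1..n}"
    using i by (intro bij_betw_byWitness[where f' = "transpose i (i + 1)"]) (auto simp: transpose_def)
  then have "bij_betw (transpose i (i + 1) \<circ> X) (mnodes lam) {1..n}"
    using X by (intro bij_betw_trans[of X _ "{1..n}"]) (auto simp: filling_def)
  then have "bij_betw (swap_tableau lam i X) (mnodes lam) {1..n}"
    by (subst bij_betw_cong[of _ _ "transpose i (i + 1) \<circ> X"]) (auto simp: swap_tableau_def)
  then show *: "filling n lam (swap_tableau lam i X)" by (simp add: filling_def swap_tableau_def)
  assume j: "j \<in> {1..n}"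
  have t: "transpose i (i + 1) j \<in> {1..n}" using i j by (auto simp: transpose_def)
  show "node_of lam (swap_tableau lam i X) j = node_of lam X (transpose i (i + 1) j)"
    by (rule node_of_eq[OF *])
       (use filling_node_of(1,2)[OF X t] in \<open>auto simp: swap_tableau_def\<close>)
qed

lemma bij_tableau_path:
  assumes lam: "lam \<in> mpartitions m n"
  shows "bij_betw (tableau_path n lam) (standard_tableaux n lam) (paths_to m (mnodes lam))"
proof (rule bij_betw_imageI)
  show "inj_on (tableau_path n lam) (standard_tableaux n lam)"
  proof (rule inj_onI)
    fix X X' assume "X \<in> standard_tableaux n lam" "X' \<in> standard_tableaux n lam"
      and eq: "tableau_path n lam X = tableau_path n lam X'"
    then have f: "filling n lam X" "filling n lam X'" by (auto intro: standard_filling)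
    have "node_of lam X i = node_of lam X' i" if "i \<in> {1..n}" for i
      using nth_tableau_path[of "i - 1" n lam X] nth_tableau_path[of "i - 1" n lam X'] eq that by auto
    then have "X x = X' x" if "x \<in> mnodes lam" for x
      using filling_node_of(3,4)[OF f(1) that] filling_node_of(2)[OF f(2), of "X x"] by metis
    then show "X = X'" using f by (auto simp: filling_def intro: extensionalityI)
  qed
  show "tableau_path n lam ` standard_tableaux n lam = paths_to m (mnodes lam)"
  proof (intro equalityI subsetI)
    fix xs assume "xs \<in> tableau_path n lam ` standard_tableaux n lam"
    then obtain X where X: "X \<in> standard_tableaux n lam" "xs = tableau_path n lam X" by blast
    then show "xs \<in> paths_to m (mnodes lam)"
      using standard_iff_path[OF lam standard_filling[OF X(1)]] set_tableau_path[OF standard_filling[OF X(1)]]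
      by (simp add: paths_to_def)
  next
    fix xs assume xs: "xs \<in> paths_to m (mnodes lam)"
    then have p: "path m xs" "set xs = mnodes lam" "distinct xs" by (auto simp: paths_to_def path_distinct)
    then have len: "length xs = n" using distinct_card[of xs] mnodes_diagram(2)[OF lam] by simp
    define ix where "ix = inv_into {..<n} ((!) xs)"
    have b: "bij_betw ((!) xs) {..<n} (mnodes lam)" using bij_betw_nth[OF p(3)] p(2) len by simp
    have ix: "ix (xs ! j) = j" if "j < n" for j
      unfolding ix_def by (rule bij_betw_inv_into_left[OF b]) (use that in simp)
    define X where "X = restrict (\<lambda>x. Suc (ix x)) (mnodes lam)"
    have "bij_betw Suc {..<n} {1..n}" by (rule bij_betw_byWitness[where f' = "\<lambda>i. i - 1"]) auto
    then have "bij_betw (Suc \<circ> ix) (mnodes lam) {1..n}"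
      by (intro bij_betw_trans[OF bij_betw_inv_into[OF b, folded ix_def]])
    then have "bij_betw X (mnodes lam) {1..n}"
      by (subst bij_betw_cong[of _ _ "Suc \<circ> ix"]) (auto simp: X_def)
    then have X: "filling n lam X" by (simp add: filling_def X_def)
    have "tableau_path n lam X = xs"
    proof (rule nth_equalityI)
      fix j assume "j < length (tableau_path n lam X)"
      then have j: "j < n" by simp
      then have "xs ! j \<in> mnodes lam" using p(2) len by (metis nth_mem)
      then have "node_of lam X (Suc j) = xs ! j"
        by (intro node_of_eq[OF X]) (auto simp: X_def ix[OF j])
      then show "tableau_path n lam X ! j = xs ! j" using j by (simp add: nth_tableau_path)
    qed (simp add: len)
    then show "xs \<in> tableau_path n lam ` standard_tableaux n lam"
      using standard_iff_path[OF lam X] p(1) by force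
  qed
qed

section \<open>Comparison of the actions on tableaux and on paths\<close>

context hecke_parameters
begin

definition to_paths :: "nat list list \<Rightarrow> (tableau \<Rightarrow>\<^sub>0 'k) \<Rightarrow> (mnode list \<Rightarrow>\<^sub>0 'k)" where
  "to_paths lam = linear_extension (\<lambda>X. bas (tableau_path n lam X))"

lemma lin_to_paths: "lin (to_paths lam)"
  unfolding to_paths_def by (rule lin_linear_extension)

lemma gen_on_basis_to_paths:
  assumes lam: "lam \<in> mpartitions m n" and h: "h \<in> hecke_gens n" and X: "X \<in> standard_tableaux n lam"
  shows "gen_on_basis n q v lam h X \<in> supported (standard_tableaux n lam) \<and>
    to_paths lam (gen_on_basis n q v lam h X) = L h (to_paths lam (bas X))"
proof (cases h)
  case Tau
  have "hd (tableau_path n lam X) = node_of lam X 1"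
    using nth_tableau_path[of 0 n lam X] n_pos by (simp add: hd_conv_nth flip: length_greater_0_conv)
  then show ?thesis
    using X by (auto simp: Tau to_paths_def basis_vector_def content_def keys_scale)
next
  case (Sigma i)
  then have i: "1 \<le> i" "i < n" using h by (auto simp: hecke_gens_def)
  let ?w = "tableau_path n lam X" and ?X' = "swap_tableau lam i X"
  note f = standard_filling[OF X]
  have "i < length ?w" using i by simp
  with i(1) obtain us x y vs where w: "?w = us @ x # y # vs" "i = Suc (length us)" by (rule split_at_two)
  have xy: "node_of lam X i = x" "node_of lam X (i + 1) = y"
    using nth_tableau_path[of "i - 1" n lam X] nth_tableau_path[of i n lam X] i w by (simp_all add: nth_append)
  have len: "n = length us + 2 + length vs" using arg_cong[OF w(1), of length] by simp
  have w': "tableau_path n lam ?X' = us @ y # x # vs"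
  proof (rule nth_equalityI)
    fix j assume "j < length (tableau_path n lam ?X')"
    then have j: "j < n" by simp
    have *: "(us @ x # y # vs) ! k = node_of lam X (Suc k)" if "k < n" for k
      using nth_tableau_path[OF that, of lam X] w(1) by simp
    have "tableau_path n lam ?X' ! j = node_of lam X (transpose i (i + 1) (Suc j))"
      using filling_swap(2)[OF f i, of "Suc j"] j by (simp add: nth_tableau_path)
    also have "\<dots> = (us @ y # x # vs) ! j"
    proof -
      consider "j = length us" | "j = Suc (length us)" | "j < length us" | "Suc (length us) < j" by linarith
      then show ?thesis
      proof cases
        case 1
        then show ?thesis using xy w(2) by (simp add: nth_append transpose_def)
      next
        case 2
        then show ?thesis using xy w(2) by (simp add: nth_append transpose_def)
      next
        case 3
        then show ?thesis using *[OF j] w(2) by (simp add: nth_append transpose_def)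
      next
        case 4
        then obtain d where "j = length us + 2 + d" by (metis add_2_eq_Suc' add_Suc_right less_iff_Suc_add add.assoc add.commute)
        then show ?thesis using *[OF j] w(2) by (simp add: nth_append transpose_def)
      qed
    qed
    finally show "tableau_path n lam ?X' ! j = (us @ y # x # vs) ! j" .
  qed (simp add: len)
  have pw: "path m (us @ x # y # vs)" using standard_iff_path[OF lam f] X w by simp
  \<comment> \<open>This matches the two conventions: the basis vector of a non-standard exchange is
    0 on the side of tableaux, and \<open>offdiag_entry\<close> is 0 on the side of paths.\<close>
  have std': "?X' \<in> standard_tableaux n lam \<longleftrightarrow> \<not> adjacent x y"
    using standard_iff_path[OF lam filling_swap(1)[OF f i]] w' path_swap[OF pw] by simp
  have d: "diag_coeff q v lam X i = diag_entry x y"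
    by (simp add: diag_coeff_def content_def axial_distance_def diag_entry_def p_def xy[simplified] Let_def)
  have o: "offdiag_coeff q v lam X i = diag_entry x y + inverse q"
  proof (cases "cont y = cont x")
    case True
    then show ?thesis
      by (simp add: offdiag_coeff_def content_def axial_distance_def diag_entry_def xy[simplified] Let_def)
  next
    case False
    have "(q * cont y - inverse q * cont x) / (cont y - cont x) = p * cont y / (cont y - cont x) + inverse q"
    proof -
      have "q * cont y - inverse q * cont x = p * cont y + inverse q * (cont y - cont x)"
        by (simp add: p_def algebra_simps)
      then show ?thesis using False by (simp add: add_divide_distrib)
    qed
    then show ?thesis using False by (simp add: offdiag_coeff_def content_def diag_entry_def xy[simplified] Let_def)
  qed
  have sup: "scale c (bas Z) \<in> supported (standard_tableaux n lam)" if "Z \<in> standard_tableaux n lam" for c Z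
    using that by (auto simp: keys_scale)
  show ?thesis
  proof (cases "adjacent x y")
    case True
    then have "gen_on_basis n q v lam h X = scale (diag_entry x y) (bas X)"
      using std' by (simp add: Sigma d basis_vector_def)
    then show ?thesis
      using sup[OF X] gen_on_path_Sigma[OF w(2), of x y vs] True by (simp add: Sigma to_paths_def w(1) offdiag_entry_def)
  next
    case False
    then have "gen_on_basis n q v lam h X = scale (diag_entry x y) (bas X) + scale (diag_entry x y + inverse q) (bas ?X')"
      using std' by (simp add: Sigma d o basis_vector_def)
    moreover have "\<dots> \<in> supported (standard_tableaux n lam)"
      by (rule PM.subspace_add[OF subspace_supported sup sup]) (use X std' False in auto)
    ultimately show ?thesis
      using gen_on_path_Sigma[OF w(2), of x y vs] False by (simp add: Sigma to_paths_def w(1) w' offdiag_entry_def)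
  qed
qed

lemma free_action_to_paths:
  assumes "lam \<in> mpartitions m n" "a \<in> FA n" "f \<in> supported (standard_tableaux n lam)"
  shows "free_action n q v lam a f \<in> supported (standard_tableaux n lam)"
    and "to_paths lam (free_action n q v lam a f) = act gen_on_path a (to_paths lam f)"
proof -
  have "\<forall>w\<in>Poly_Mapping.keys a. set w \<subseteq> hecke_gens n" using assms(2) by (simp add: mem_FA)
  from act_intertwine[where G = "hecke_gens n" and g = "gen_on_basis n q v lam" and g' = gen_on_path,
      OF lin_to_paths gen_on_basis_to_paths[OF assms(1)] this assms(3)]
  show "free_action n q v lam a f \<in> supported (standard_tableaux n lam)"
    "to_paths lam (free_action n q v lam a f) = act gen_on_path a (to_paths lam f)"
    unfolding free_action_eq_act by blast+
qed

lemma bij_to_paths: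
  assumes lam: "lam \<in> mpartitions m n"
  shows "bij_betw (to_paths lam) (supported (standard_tableaux n lam)) (supported (paths_to m (mnodes lam)))"
proof -
  let ?t = "tableau_path n lam" and ?B = "standard_tableaux n lam" and ?C = "paths_to m (mnodes lam)"
  note b = bij_tableau_path[OF lam]
  define from_paths where "from_paths = linear_extension (\<lambda>xs. bas (inv_into ?B ?t xs) :: tableau \<Rightarrow>\<^sub>0 'k)"
  have linb: "lin from_paths" unfolding from_paths_def by (rule lin_linear_extension)
  have id: "lin (\<lambda>f. f)" by (rule linI) auto
  show ?thesis
  proof (rule bij_betw_byWitness[where f' = from_paths])
    show "\<forall>f\<in>(supported ?B :: (tableau \<Rightarrow>\<^sub>0 'k) set). from_paths (to_paths lam f) = f"
    proof clarify
      fix f :: "tableau \<Rightarrow>\<^sub>0 'k" assume "Poly_Mapping.keys f \<subseteq> ?B"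
      then show "from_paths (to_paths lam f) = f"
        by (rule lin_eq_on[OF lin_compose[OF linb lin_to_paths] id, rotated])
           (simp add: from_paths_def to_paths_def bij_betw_inv_into_left[OF b])
    qed
    show "\<forall>f\<in>(supported ?C :: (mnode list \<Rightarrow>\<^sub>0 'k) set). to_paths lam (from_paths f) = f"
    proof clarify
      fix f :: "mnode list \<Rightarrow>\<^sub>0 'k" assume "Poly_Mapping.keys f \<subseteq> ?C"
      then show "to_paths lam (from_paths f) = f"
        by (rule lin_eq_on[OF lin_compose[OF lin_to_paths linb] id, rotated])
           (simp add: from_paths_def to_paths_def bij_betw_inv_into_right[OF b])
    qed
    show "to_paths lam ` supported ?B \<subseteq> supported ?C"
      unfolding to_paths_def
      by (rule image_subsetI, rule linear_extension_supported) (use bij_betwE[OF b] in auto)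
    show "from_paths ` supported ?C \<subseteq> supported ?B"
      unfolding from_paths_def
      by (rule image_subsetI, rule linear_extension_supported) (use bij_betwE[OF bij_betw_inv_into[OF b]] in auto)
  qed
qed

end


section \<open>The two kinds of parameters\<close>

abbreviation var :: "nat \<Rightarrow> cpoly" where
  "var i \<equiv> Poly_Mapping.single (Poly_Mapping.single i 1) 1"

lemma var_nonzero: "var i \<noteq> 0"
  by (metis lookup_single_eq lookup_zero one_neq_zero)

lemma var_power: "var i ^ k = Poly_Mapping.single (Poly_Mapping.single i k) 1"
proof (induction k)
  case (Suc k)
  then show ?case by (simp add: mult_single single_add[symmetric])
qed simp

lemma cpolys_closed:
  "0 \<in> cpolys m" "1 \<in> cpolys m"
  "p \<in> cpolys m \<Longrightarrow> p' \<in> cpolys m \<Longrightarrow> p + p' \<in> cpolys m"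
  "p \<in> cpolys m \<Longrightarrow> p' \<in> cpolys m \<Longrightarrow> p * p' \<in> cpolys m"
  "i \<le> m \<Longrightarrow> var i \<in> cpolys m"
proof -
  show "p \<in> cpolys m \<Longrightarrow> p' \<in> cpolys m \<Longrightarrow> p + p' \<in> cpolys m"
    unfolding cpolys_def using keys_add[of p p'] by blast
  show "p * p' \<in> cpolys m" if pp: "p \<in> cpolys m" "p' \<in> cpolys m"
    unfolding cpolys_def
  proof (rule CollectI, rule ballI)
    fix t assume "t \<in> Poly_Mapping.keys (p * p')"
    then obtain a b where "t = a + b" "a \<in> Poly_Mapping.keys p" "b \<in> Poly_Mapping.keys p'"
      using keys_mult[of p p'] by blast
    then show "Poly_Mapping.keys t \<subseteq> {0..m}"
      using pp keys_add[of a b] unfolding cpolys_def by blast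
  qed
qed (auto simp: cpolys_def)

lemma cpolys_power: "p \<in> cpolys m \<Longrightarrow> p ^ k \<in> cpolys m"
  by (induction k) (auto intro: cpolys_closed)

text \<open>\<open>\<psi>\<close> embeds the polynomials in the indeterminates into the field, so
  each condition becomes an inequality of polynomials: different monomials are different, and the
  sum of powers has constant coefficient 1.\<close>

lemma generic_hecke_parameters:
  fixes q :: "'k::field" and v :: "nat \<Rightarrow> 'k"
  assumes "1 \<le> m" "1 \<le> n" "generic_parameters m q v"
  shows "hecke_parameters m n q v"
proof -
  obtain \<phi> :: "cpoly fract \<Rightarrow> 'k" where iso: "field_iso (rational_functions m) \<phi>"
    and q: "\<phi> (indet 0) = q" and v: "\<And>j. j \<in> {1..m} \<Longrightarrow> \<phi> (indet j) = v j"
    using assms(3) by (auto simp: generic_parameters_def)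
  define \<psi> where "\<psi> p = \<phi> (Fraction_Field.Fract p 1)" for p
  have S: "Fraction_Field.Fract p 1 \<in> rational_functions m" if "p \<in> cpolys m" for p
    unfolding rational_functions_def
    by (rule CollectI, rule exI[of _ p], rule exI[of _ 1]) (simp add: that cpolys_closed)
  have add: "\<psi> (p + p') = \<psi> p + \<psi> p'" and mult: "\<psi> (p * p') = \<psi> p * \<psi> p'"
    if "p \<in> cpolys m" "p' \<in> cpolys m" for p p'
  proof -
    have "\<phi> (Fraction_Field.Fract p 1 + Fraction_Field.Fract p' 1) = \<psi> p + \<psi> p'"
         "\<phi> (Fraction_Field.Fract p 1 * Fraction_Field.Fract p' 1) = \<psi> p * \<psi> p'"
      using iso S[OF that(1)] S[OF that(2)] unfolding field_iso_def \<psi>_def by blast+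
    then show "\<psi> (p + p') = \<psi> p + \<psi> p'" "\<psi> (p * p') = \<psi> p * \<psi> p'" by (simp_all add: \<psi>_def)
  qed
  have inj: "p = p'" if "\<psi> p = \<psi> p'" "p \<in> cpolys m" "p' \<in> cpolys m" for p p'
  proof -
    have "inj_on \<phi> (rational_functions m)" using iso by (simp add: field_iso_def bij_betw_def)
    then have "Fraction_Field.Fract p 1 = Fraction_Field.Fract p' 1"
      using that S unfolding \<psi>_def by (metis inj_onD)
    then show ?thesis by (simp add: eq_fract)
  qed
  have one: "\<psi> 1 = 1" using iso by (simp add: field_iso_def \<psi>_def One_fract_def)
  have zero: "\<psi> 0 = 0" using add[OF cpolys_closed(1,1)] by (simp only: add_0_left add_cancel_right_right)
  have nz: "\<psi> p \<noteq> 0" if "p \<in> cpolys m" "p \<noteq> 0" for p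
    using inj[of p 0] zero that cpolys_closed(1) by auto
  have power: "\<psi> (p ^ k) = \<psi> p ^ k" if "p \<in> cpolys m" for p k
    by (induction k) (simp_all add: one mult that cpolys_power)
  have sum: "\<psi> (\<Sum>i\<in>I. h i) = (\<Sum>i\<in>I. \<psi> (h i)) \<and> (\<Sum>i\<in>I. h i) \<in> cpolys m"
    if "finite I" "\<And>i. i \<in> I \<Longrightarrow> h i \<in> cpolys m" for I :: "nat set" and h
    using that by (induction I) (auto simp: zero add cpolys_closed)
  have q': "\<psi> (var 0) = q" and v': "\<psi> (var j) = v j" if "j \<in> {1..m}" for j
    using q v[OF that] by (simp_all add: \<psi>_def indet_def)
  have q'': "\<psi> (var 0) = q" using q by (simp add: \<psi>_def indet_def)
  have c0: "var 0 \<in> cpolys m" by (rule cpolys_closed) simp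
  have qnz: "q \<noteq> 0" using nz[OF c0 var_nonzero] q'' by simp
  have sep: "q ^ (2 * i) * v j \<noteq> v k" if "j \<in> {1..m}" "k \<in> {1..m}" "j \<noteq> k" for i j k
  proof
    assume eq: "q ^ (2 * i) * v j = v k"
    have c: "var j \<in> cpolys m" "var k \<in> cpolys m" by (rule cpolys_closed(5), use that in simp)+
    have "\<psi> (var 0 ^ (2 * i) * var j) = \<psi> (var k)"
      using eq by (simp only: mult power c0 c cpolys_power q'' v' that)
    then have "var 0 ^ (2 * i) * var j = var k" by (rule inj) (intro cpolys_closed cpolys_power c c0)+
    then have "Poly_Mapping.single (Poly_Mapping.single 0 (2 * i) + Poly_Mapping.single j 1) (1::complex) = var k"
      by (simp only: var_power mult_single mult_1)
    then have "Poly_Mapping.single 0 (2 * i) + Poly_Mapping.single j 1 = Poly_Mapping.single k (1::nat)"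
      by (metis keys_single one_neq_zero singleton_inject)
    then have "Poly_Mapping.lookup (Poly_Mapping.single 0 (2 * i) + Poly_Mapping.single j 1) k = (1::nat)" by simp
    then show False using that by (simp add: lookup_add lookup_single)
  qed
  show ?thesis
  proof
    fix N assume "N < n"
    let ?s = "\<Sum>i=0..N. var 0 ^ (2 * i)"
    have s: "\<psi> ?s = (\<Sum>i=0..N. \<psi> (var 0 ^ (2 * i))) \<and> ?s \<in> cpolys m" by (rule sum, simp) (rule cpolys_power[OF c0])
    have "Poly_Mapping.lookup (var 0 ^ (2 * i)) 0 = (if i = 0 then 1 else 0)" for i
    proof -
      have "Poly_Mapping.single 0 (2 * i) = (0 :: nat \<Rightarrow>\<^sub>0 nat) \<longleftrightarrow> i = 0"
        by (metis lookup_single_eq lookup_zero mult_eq_0_iff single_zero zero_neq_numeral)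
      then show ?thesis unfolding var_power lookup_single when_def by simp
    qed
    then have "Poly_Mapping.lookup ?s 0 = 1" by (simp only: lookup_sum) simp
    then have "?s \<noteq> 0" by auto
    then have "\<psi> ?s \<noteq> 0" using nz s by blast
    then show "(\<Sum>i=0..N. q ^ (2 * i)) \<noteq> 0" using s by (simp only: power[OF c0] q'' not_False_eq_True)
  next
    fix i j k assume jk: "j \<in> {1..m}" "k \<in> {1..m}" "j \<noteq> k"
    show "q powi (2 * i) * v j \<noteq> v k"
    proof (cases "i \<ge> 0")
      case True
      then have "q powi (2 * i) = q ^ (2 * nat i)" by (simp add: power_int_def nat_mult_distrib)
      then show ?thesis using sep[OF jk, of "nat i"] by simp
    next
      case False
      \<comment> \<open>A negative exponent is moved to the other side, where the roles of
        \<open>j\<close> and \<open>k\<close> are exchanged.\<close>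
      define Q where "Q = q ^ (2 * nat (- i))"
      have i: "q powi (2 * i) = inverse Q"
        using nat_mult_distrib[of 2 "- i"] False by (simp add: Q_def power_int_def power_inverse)
      have "Q * (inverse Q * v j) = v j" using qnz by (simp add: Q_def)
      moreover have "Q * v k \<noteq> v j" using sep[OF jk(2,1) jk(3)[symmetric]] by (simp add: Q_def)
      ultimately show ?thesis unfolding i by metis
    qed
  next
    fix j assume j: "j \<in> {1..m}"
    have "var j \<in> cpolys m" by (rule cpolys_closed(5)) (use j in simp)
    then show "v j \<noteq> 0" using nz[OF _ var_nonzero] v'[OF j] by metis
  qed (use assms qnz in auto)
qed

lemma complex_hecke_parameters:
  assumes "1 \<le> m" "1 \<le> n" "complex_parameters m n q v"
  shows "hecke_parameters m n q v"
  using assms unfolding complex_parameters_def by unfold_locales auto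


section \<open>Modules over non-commutative rings\<close>

context left_module
begin

lemma smult_zero_left: "x \<in> carrier M \<Longrightarrow> \<zero>\<^bsub>R\<^esub> \<odot>\<^bsub>M\<^esub> x = \<zero>\<^bsub>M\<^esub>"
  using smult_l_distr[of "\<zero>\<^bsub>R\<^esub>" "\<zero>\<^bsub>R\<^esub>" x] smult_closed[of "\<zero>\<^bsub>R\<^esub>" x] M.add.r_cancel_one'[of "\<zero>\<^bsub>R\<^esub> \<odot>\<^bsub>M\<^esub> x"]
  by (metis R.r_zero R.zero_closed)

lemma smult_minus_one: "x \<in> carrier M \<Longrightarrow> (\<ominus>\<^bsub>R\<^esub> \<one>\<^bsub>R\<^esub>) \<odot>\<^bsub>M\<^esub> x = \<ominus>\<^bsub>M\<^esub> x"
  using smult_l_distr[of "\<ominus>\<^bsub>R\<^esub> \<one>\<^bsub>R\<^esub>" "\<one>\<^bsub>R\<^esub>" x] smult_closed[of _ x] smult_zero_left[of x] smult_one[of x]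
  by (metis M.minus_equality R.a_inv_closed R.l_neg R.one_closed)

lemma submoduleI:
  assumes "N \<subseteq> carrier M" "\<zero>\<^bsub>M\<^esub> \<in> N" "\<And>x y. x \<in> N \<Longrightarrow> y \<in> N \<Longrightarrow> x \<oplus>\<^bsub>M\<^esub> y \<in> N"
    and "\<And>a x. a \<in> carrier R \<Longrightarrow> x \<in> N \<Longrightarrow> a \<odot>\<^bsub>M\<^esub> x \<in> N"
  shows "submodule N R M"
proof (intro submodule.intro submodule_axioms.intro)
  show "subgroup N (add_monoid M)"
  proof (rule M.add.subgroupI)
    fix x assume x: "x \<in> N"
    then have "(\<ominus>\<^bsub>R\<^esub> \<one>\<^bsub>R\<^esub>) \<odot>\<^bsub>M\<^esub> x \<in> N" using assms(4) by simp
    then show "\<ominus>\<^bsub>M\<^esub> x \<in> N" using smult_minus_one x assms(1) by auto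
  qed (use assms in auto)
qed (use assms in auto)

lemma submoduleD:
  assumes "submodule N R M"
  shows "N \<subseteq> carrier M" "\<zero>\<^bsub>M\<^esub> \<in> N" "x \<in> N \<Longrightarrow> y \<in> N \<Longrightarrow> x \<oplus>\<^bsub>M\<^esub> y \<in> N"
    and "a \<in> carrier R \<Longrightarrow> x \<in> N \<Longrightarrow> a \<odot>\<^bsub>M\<^esub> x \<in> N"
  using subgroup.subset[OF submodule.axioms(1)[OF assms]] subgroup.one_closed[OF submodule.axioms(1)[OF assms]]
    subgroup.m_closed[OF submodule.axioms(1)[OF assms]] submodule.smult_closed[OF assms] by auto

lemma submodule_left_module:
  assumes "submodule N R M"
  shows "left_module R (M\<lparr>carrier := N\<rparr>)"
proof (intro left_module.intro left_module_axioms.intro)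
  note N = submoduleD[OF assms]
  show "ring R" by unfold_locales
  show "abelian_group (M\<lparr>carrier := N\<rparr>)"
  proof (rule abelian_groupI)
    fix x assume x: "x \<in> carrier (M\<lparr>carrier := N\<rparr>)"
    then have "\<ominus>\<^bsub>M\<^esub> x \<in> N" using N(4)[of "\<ominus>\<^bsub>R\<^esub> \<one>\<^bsub>R\<^esub>" x] N(1) smult_minus_one[of x] by auto
    then show "\<exists>y\<in>carrier (M\<lparr>carrier := N\<rparr>). y \<oplus>\<^bsub>M\<lparr>carrier := N\<rparr>\<^esub> x = \<zero>\<^bsub>M\<lparr>carrier := N\<rparr>\<^esub>"
      using x N(1) by (auto intro!: bexI[of _ "\<ominus>\<^bsub>M\<^esub> x"] M.l_neg)
  qed (use N in \<open>auto intro: M.a_assoc M.a_comm dest: subsetD\<close>)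
qed (use submoduleD[OF assms] in \<open>auto intro: smult_l_distr smult_r_distr smult_assoc1 smult_one dest: subsetD\<close>)

lemma carrier_submodule: "submodule (carrier M) R M"
  by (rule submoduleI) (auto simp: smult_closed)

end

lemma submodule_generated_subset:
  "submodule N R M \<Longrightarrow> A \<subseteq> N \<Longrightarrow> submodule_generated R M A \<subseteq> N"
  unfolding submodule_generated_def by blast

lemma left_module_regular:
  assumes "ring R"
  shows "left_module R (regular_module R)"
proof -
  interpret ring R by fact
  have "abelian_group (regular_module R)"
  proof (rule abelian_groupI)
    fix x assume "x \<in> carrier (regular_module R)"
    then show "\<exists>y\<in>carrier (regular_module R). y \<oplus>\<^bsub>regular_module R\<^esub> x = \<zero>\<^bsub>regular_module R\<^esub>"
      by (intro bexI[of _ "\<ominus>\<^bsub>R\<^esub> x"]) (auto simp: regular_module_def l_neg)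
  qed (auto simp: regular_module_def a_ac)
  then show ?thesis
    by (intro left_module.intro left_module_axioms.intro assms)
       (auto simp: regular_module_def l_distr r_distr m_assoc)
qed

text \<open>Allows an isomorphism to be given in the direction in which it arises, here from the
  module on tableaux to an abstract simple module.\<close>

lemma module_isomorphicI:
  assumes bij: "bij_betw g (carrier N) (carrier M)"
    and add: "\<And>x y. x \<in> carrier N \<Longrightarrow> y \<in> carrier N \<Longrightarrow>
      x \<oplus>\<^bsub>N\<^esub> y \<in> carrier N \<and> g (x \<oplus>\<^bsub>N\<^esub> y) = g x \<oplus>\<^bsub>M\<^esub> g y"
    and smult: "\<And>a x. a \<in> carrier R \<Longrightarrow> x \<in> carrier N \<Longrightarrow>
      a \<odot>\<^bsub>N\<^esub> x \<in> carrier N \<and> g (a \<odot>\<^bsub>N\<^esub> x) = a \<odot>\<^bsub>M\<^esub> g x"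
  shows "module_isomorphic R M N"
proof -
  define f where "f = inv_into (carrier N) g"
  have f: "bij_betw f (carrier M) (carrier N)" unfolding f_def by (rule bij_betw_inv_into[OF bij])
  have offdiag_entry: "f x \<in> carrier N" "g (f x) = x" if "x \<in> carrier M" for x
    using bij_betwE[OF f] bij_betw_inv_into_right[OF bij] that by (auto simp: f_def)
  have fg: "f (g x) = x" if "x \<in> carrier N" for x
    using bij_betw_inv_into_left[OF bij] that by (auto simp: f_def)
  have "f (x \<oplus>\<^bsub>M\<^esub> y) = f x \<oplus>\<^bsub>N\<^esub> f y" if "x \<in> carrier M" "y \<in> carrier M" for x y
    using add[OF offdiag_entry(1)[OF that(1)] offdiag_entry(1)[OF that(2)]] offdiag_entry(2)[OF that(1)] offdiag_entry(2)[OF that(2)]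
      fg[of "f x \<oplus>\<^bsub>N\<^esub> f y"] by simp
  moreover have "f (a \<odot>\<^bsub>M\<^esub> x) = a \<odot>\<^bsub>N\<^esub> f x" if "a \<in> carrier R" "x \<in> carrier M" for a x
    using smult[OF that(1) offdiag_entry(1)[OF that(2)]] offdiag_entry(2)[OF that(2)] fg[of "a \<odot>\<^bsub>N\<^esub> f x"] by simp
  ultimately show ?thesis unfolding module_isomorphic_def using f by blast
qed


section \<open>Faithfulness of the action on paths\<close>

lemma lookup_sum_scale_bas:
  "finite P \<Longrightarrow> Poly_Mapping.lookup (\<Sum>p\<in>P. scale (c p) (bas p)) p = (if p \<in> P then c p else 0)"
  by (auto simp: lookup_sum lookup_single when_def if_distrib sum.delta cong: if_cong)

lemma independent_bas: "finite P \<Longrightarrow> PM.independent (bas ` P :: ('x \<Rightarrow>\<^sub>0 'k::field) set)"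
proof (rule PM.independent_if_scalars_zero)
  fix f :: "('x \<Rightarrow>\<^sub>0 'k) \<Rightarrow> 'k" and x :: "'x \<Rightarrow>\<^sub>0 'k"
  assume P: "finite P" and 0: "(\<Sum>x\<in>(bas ` P :: ('x \<Rightarrow>\<^sub>0 'k) set). scale (f x) x) = 0" and "x \<in> bas ` P"
  then obtain p where p: "p \<in> P" "x = bas p" by blast
  have "(\<Sum>x\<in>(bas ` P :: ('x \<Rightarrow>\<^sub>0 'k) set). scale (f x) x) = (\<Sum>p\<in>P. scale (f (bas p)) (bas p :: 'x \<Rightarrow>\<^sub>0 'k))"
    by (subst sum.reindex) (auto simp: inj_on_def poly_mapping_eq_iff fun_eq_iff lookup_single when_def)
  then show "f x = 0" using lookup_sum_scale_bas[OF P, of "\<lambda>p. f (bas p)" p] 0 p by simp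
qed simp

context hecke_parameters
begin

abbreviation I :: "'k falg set" where "I \<equiv> hecke_ideal m n q v"
abbreviation H :: "'k falg set ring" where "H \<equiv> hecke_algebra m n q v"

definition E :: "mnode list \<Rightarrow> mnode list \<Rightarrow> 'k falg" where
  "E S T = (SOME a. matrix_unit n a S T)"

lemma E_matrix_unit: "(S, T) \<in> shape_pairs m n \<Longrightarrow> matrix_unit n (E S T) S T"
  unfolding E_def using matrix_units_exist[OF n_pos order_refl] by (auto simp: shape_pairs_def intro: someI_ex)

lemma E_FA: "(S, T) \<in> shape_pairs m n \<Longrightarrow> E S T \<in> FA n"
  using E_matrix_unit by (simp add: matrix_unit_def)

lemma act_E_bas: "(S, T) \<in> shape_pairs m n \<Longrightarrow> U \<in> paths m n \<Longrightarrow> act gen_on_path (E S T) (bas U) = (if U = T then bas S else 0)"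
  using E_matrix_unit by (simp add: matrix_unit_def)

lemma act_E:
  assumes "(S, T) \<in> shape_pairs m n" "f \<in> supported (paths m n)"
  shows "act gen_on_path (E S T) f = scale (Poly_Mapping.lookup f T) (bas S)"
proof (rule lin_eq_on[where B = "paths m n" and f = f])
  show "lin (act gen_on_path (E S T))" by (rule lin_act)
  show "lin (\<lambda>f. scale (Poly_Mapping.lookup f T) (bas S))"
    by (rule linI) (simp_all add: lookup_add PM.scale_left_distrib)
  show "act gen_on_path (E S T) (bas U) = scale (Poly_Mapping.lookup (bas U) T) (bas S)" if "U \<in> paths m n" for U
    using act_E_bas[OF assms(1) that] by (simp add: lookup_single when_def)
qed (use assms in auto)

text \<open>\<open>\<rho>\<close> collects the matrix entries of an element. By the matrix units its
  image has dimension n! m^n at least, while modulo the ideal everything is a combination of at most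
  that many elements of \<open>M\<close>. Hence \<open>\<rho>\<close> is injective on the span of
  \<open>M\<close>, and an element with zero matrix is congruent to 0.\<close>

lemma kills_paths_iff_ideal:
  assumes a: "a \<in> FA n"
  shows "(\<forall>U\<in>paths m n. act gen_on_path a (bas U) = 0) \<longleftrightarrow> a \<in> I"
proof
  assume "a \<in> I"
  then show "\<forall>U\<in>paths m n. act gen_on_path a (bas U) = 0" using hecke_ideal_kills_paths by auto
next
  assume 0: "\<forall>U\<in>paths m n. act gen_on_path a (bas U) = 0"
  let ?P = "shape_pairs m n"
  define \<rho> where "\<rho> a = (\<Sum>p\<in>?P. scale (Poly_Mapping.lookup (act gen_on_path a (bas (snd p))) (fst p)) (bas p))" for a
  have lin: "lin \<rho>"
    by (rule linI) (simp_all add: \<rho>_def lookup_add PM.scale_left_distrib sum.distrib PM.scale_sum_right)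
  have cong: "\<rho> a = \<rho> b" if "hcong m q v a n b" for a b
  proof -
    have ab: "a - b \<in> I" using that by (simp add: hcong_def)
    have "act gen_on_path a (bas U) = act gen_on_path b (bas U)" if "U \<in> paths m n" for U
      using hecke_ideal_kills_paths[OF ab, of "bas U"] that by simp
    then show ?thesis unfolding \<rho>_def by (intro sum.cong refl) (auto simp: shape_pairs_def)
  qed
  have unit: "\<rho> (E S T) = bas (S, T)" if ST: "(S, T) \<in> ?P" for S T
  proof -
    have "scale (Poly_Mapping.lookup (act gen_on_path (E S T) (bas (snd p))) (fst p)) (bas p) = (if p = (S, T) then bas p else 0)"
      if "p \<in> ?P" for p
    proof (cases p)
      case (Pair S' T')
      then have "T' \<in> paths m n" using that by (simp add: shape_pairs_def)
      then show ?thesis using act_E_bas[OF ST, of T'] Pair by (auto simp: lookup_single when_def)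
    qed
    then have "\<rho> (E S T) = (\<Sum>p\<in>?P. if p = (S, T) then bas p else 0)" unfolding \<rho>_def by (rule sum.cong[OF refl])
    then show ?thesis using ST finite_shape_pairs by simp
  qed
  obtain M where M: "finite M" "card M \<le> fact n * m ^ n" "spans_hecke m q v n M"
    using hecke_spanning_set[OF m_pos n_pos] by blast
  have img: "\<rho> b \<in> PM.span (\<rho> ` M)" if "b \<in> FA n" for b
  proof -
    obtain c where c: "c \<in> PM.span M" "hcong m q v b n c" using M(3) \<open>b \<in> FA n\<close> unfolding spans_hecke_def by blast
    then show ?thesis using cong[OF c(2)] PMP.linear_span_image[OF lin, of M] by auto
  qed
  have "bas ` ?P \<subseteq> PM.span (\<rho> ` M)"
  proof
    fix y :: "mnode list \<times> mnode list \<Rightarrow>\<^sub>0 'k" assume "y \<in> bas ` ?P"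
    then obtain S T where "(S, T) \<in> ?P" "y = bas (S, T)" by auto
    then show "y \<in> PM.span (\<rho> ` M)" using img[OF E_FA] unit by metis
  qed
  note sub = this
  have card_bas: "card (bas ` ?P :: (_ \<Rightarrow>\<^sub>0 'k) set) = fact n * m ^ n"
    by (subst card_image) (auto simp: card_shape_pairs inj_on_def poly_mapping_eq_iff fun_eq_iff lookup_single when_def)
  \<comment> \<open>\<open>B\<close> has at least as many elements as there are shape pairs and at
    most as many as \<open>M\<close>, so all inequalities between \<open>B\<close>, the image of
    \<open>M\<close> and \<open>M\<close> are equalities.\<close>
  obtain B where B: "B \<subseteq> \<rho> ` M" "PM.independent B" "\<rho> ` M \<subseteq> PM.span B"
    using PM.maximal_independent_subset by blast
  have finB: "finite B" using B(1) M(1) finite_subset by blast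
  have "PM.span (\<rho> ` M) \<subseteq> PM.span B" by (rule PM.span_minimal[OF B(3) PM.subspace_span])
  with sub have "bas ` ?P \<subseteq> PM.span B" by blast
  from PM.independent_span_bound[OF finB independent_bas[OF finite_shape_pairs] this]
  have "fact n * m ^ n \<le> card B" using card_bas by simp
  moreover have "card B \<le> card (\<rho> ` M)" by (rule card_mono) (use B(1) M(1) in auto)
  moreover have "card (\<rho> ` M) \<le> card M" by (rule card_image_le[OF M(1)])
  ultimately have eq: "card B = card (\<rho> ` M)" "card (\<rho> ` M) = card M" using M(2) by linarith+
  have "B = \<rho> ` M" by (rule card_subset_eq[OF _ B(1) eq(1)]) (use M(1) in simp)
  then have "PM.independent (\<rho> ` M)" using B(2) by simp
  moreover have "inj_on \<rho> M" by (rule eq_card_imp_inj_on[OF M(1) eq(2)])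
  ultimately have inj: "inj_on \<rho> (PM.span M)" using PMP.linear_inj_on_span_iff_independent_image[OF lin] by blast
  obtain b where b: "b \<in> PM.span M" "hcong m q v a n b" using M(3) a unfolding spans_hecke_def by blast
  have "\<rho> a = 0" unfolding \<rho>_def using 0 by (intro sum.neutral) (auto simp: shape_pairs_def)
  then have "\<rho> b = \<rho> 0" using cong[OF b(2)] PMP.linear_0[OF lin] by simp
  then have "b = 0" using inj_onD[OF inj _ b(1) PM.span_zero] by blast
  then show "a \<in> I" using b(2) by (simp add: hcong_def)
qed

section \<open>Cosets and their action on paths\<close>

definition cls :: "'k falg \<Rightarrow> 'k falg set" where
  "cls a = I +>\<^bsub>free_algebra (hecke_gens n)\<^esub> a"

lemma cls_ops:
  "carrier H = cls ` FA n" "\<one>\<^bsub>H\<^esub> = cls 1"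
  "a \<in> FA n \<Longrightarrow> b \<in> FA n \<Longrightarrow> cls a \<oplus>\<^bsub>H\<^esub> cls b = cls (a + b)"
  "a \<in> FA n \<Longrightarrow> b \<in> FA n \<Longrightarrow> cls a \<otimes>\<^bsub>H\<^esub> cls b = cls (a * b)"
proof -
  let ?R = "free_algebra (hecke_gens n) :: 'k falg ring"
  interpret J: ideal I ?R by (rule hecke_ideal_ideal)
  note hom = J.rcos_ring_hom
  show "carrier H = cls ` FA n"
    by (auto simp: hecke_algebra_def FactRing_def A_RCOSETS_def' cls_def free_algebra_simps)
  show "\<one>\<^bsub>H\<^esub> = cls 1"
    by (simp add: hecke_algebra_def FactRing_def cls_def free_algebra_simps)
  show "cls a \<oplus>\<^bsub>H\<^esub> cls b = cls (a + b)" "cls a \<otimes>\<^bsub>H\<^esub> cls b = cls (a * b)" if "a \<in> FA n" "b \<in> FA n"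
    using ring_hom_add[OF hom, of a b] ring_hom_mult[OF hom, of a b] that
    by (simp_all add: hecke_algebra_def cls_def free_algebra_simps)
qed

lemma cls_mem: "x \<in> cls a \<longleftrightarrow> (\<exists>i\<in>I. x = i + a)"
  by (auto simp: cls_def a_r_coset_def' free_algebra_simps)

lemma cls_eq_iff: "cls a = cls b \<longleftrightarrow> a - b \<in> I"
proof
  assume eq: "cls a = cls b"
  have "a \<in> cls a" using hecke_ideal_closed(1) by (force simp: cls_mem)
  then obtain i where "i \<in> I" "a = i + b" using eq by (auto simp: cls_mem)
  then show "a - b \<in> I" by simp
next
  assume ab: "a - b \<in> I"
  have "x \<in> cls b" if "x \<in> cls a" for x
  proof -
    obtain i where "i \<in> I" "x = i + a" using \<open>x \<in> cls a\<close> by (auto simp: cls_mem)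
    then show ?thesis unfolding cls_mem using hecke_ideal_closed(2)[OF _ ab, of i]
      by (intro bexI[of _ "i + (a - b)"]) auto
  qed
  moreover have "x \<in> cls a" if "x \<in> cls b" for x
  proof -
    obtain i where "i \<in> I" "x = i + b" using \<open>x \<in> cls b\<close> by (auto simp: cls_mem)
    then show ?thesis unfolding cls_mem
      using hecke_ideal_closed(2)[OF _ hecke_ideal_uminus[OF ab], of i]
      by (intro bexI[of _ "i + - (a - b)"]) auto
  qed
  ultimately show "cls a = cls b" by blast
qed

lemma cls_eqI:
  assumes "a \<in> FA n" "b \<in> FA n" "\<And>U. U \<in> paths m n \<Longrightarrow> act gen_on_path a (bas U) = act gen_on_path b (bas U)"
  shows "cls a = cls b"
  unfolding cls_eq_iff using kills_paths_iff_ideal[of "a - b"] assms by simp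

lemma cls_eqD:
  assumes "cls a = cls b" "U \<in> paths m n"
  shows "act gen_on_path a (bas U) = act gen_on_path b (bas U)"
  using hecke_ideal_kills_paths[of "a - b" "bas U"] assms by (simp add: cls_eq_iff)

lemma zero_H: "\<zero>\<^bsub>H\<^esub> = cls 0"
proof -
  have "cls 0 = I" by (auto simp: cls_mem)
  then show ?thesis by (simp add: hecke_algebra_def FactRing_def)
qed

lemma ring_H: "ring H"
  unfolding hecke_algebra_def by (rule ideal.quotient_is_ring[OF hecke_ideal_ideal])

lemma act_shape:
  assumes "a \<in> FA n" "f \<in> supported (paths_to m (set T))" "T \<in> paths m n"
  shows "act gen_on_path a f \<in> supported (paths_to m (set T))"
proof -
  have "paths_to m (set T) = {xs \<in> paths m n. set xs = set T}"
    using assms(3) paths_same_set by (auto simp: paths_to_def paths_def)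
  then show ?thesis using shape_action_closed[OF assms(1) _ n_pos] assms(2) by simp
qed

lemma paths_to_shape_pair:
  assumes "T \<in> paths m n" "S \<in> paths_to m (set T)"
  shows "(S, T) \<in> shape_pairs m n" "(T, S) \<in> shape_pairs m n" "S \<in> paths m n"
  using assms paths_same_set[OF assms(1), of S] by (auto simp: paths_to_def shape_pairs_def)

lemma self_pair: "T \<in> paths m n \<Longrightarrow> (T, T) \<in> shape_pairs m n"
  by (simp add: shape_pairs_def)


section \<open>Semisimplicity\<close>

abbreviation RM :: "('k falg set, 'k falg set) module" where "RM \<equiv> regular_module H"

lemma RM_simps: "carrier RM = cls ` FA n" "\<zero>\<^bsub>RM\<^esub> = cls 0" "add RM = add H" "smult RM = mult H"
  by (simp_all add: regular_module_def cls_ops zero_H)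

text \<open>The matrices concentrated in the column with index \<open>T\<close>: the minimal left
  ideals that make up the semisimple decomposition.\<close>

definition column :: "mnode list \<Rightarrow> 'k falg set set" where
  "column T = {cls a | a. a \<in> FA n \<and> (\<forall>U\<in>paths m n. U \<noteq> T \<longrightarrow> act gen_on_path a (bas U) = 0)}"

lemma left_module_RM: "left_module H RM"
  by (rule left_module_regular[OF ring_H])

lemma submodule_RMI:
  assumes "N \<subseteq> cls ` FA n" "cls 0 \<in> N"
    and "\<And>a b. a \<in> FA n \<Longrightarrow> b \<in> FA n \<Longrightarrow> cls a \<in> N \<Longrightarrow> cls b \<in> N \<Longrightarrow> cls (a + b) \<in> N"
    and "\<And>a b. a \<in> FA n \<Longrightarrow> b \<in> FA n \<Longrightarrow> cls b \<in> N \<Longrightarrow> cls (a * b) \<in> N"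
  shows "submodule N H RM"
proof (rule left_module.submoduleI[OF left_module_RM])
  fix x y assume xy: "x \<in> N" "y \<in> N"
  then obtain a b where "x = cls a" "y = cls b" "a \<in> FA n" "b \<in> FA n" using assms(1) by blast
  then show "x \<oplus>\<^bsub>RM\<^esub> y \<in> N" using assms(3) xy by (simp add: RM_simps cls_ops)
next
  fix a x assume ax: "a \<in> carrier H" "x \<in> N"
  then obtain b c where "a = cls b" "x = cls c" "b \<in> FA n" "c \<in> FA n" using assms(1) by (auto simp: cls_ops)
  then show "a \<odot>\<^bsub>RM\<^esub> x \<in> N" using assms(4) ax by (simp add: RM_simps cls_ops)
qed (use assms in \<open>auto simp: RM_simps\<close>)

lemma column_memI:
  "a \<in> FA n \<Longrightarrow> (\<And>U. U \<in> paths m n \<Longrightarrow> U \<noteq> T \<Longrightarrow> act gen_on_path a (bas U) = 0) \<Longrightarrow> cls a \<in> column T"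
  unfolding column_def by blast

lemma column_memD:
  assumes "cls a \<in> column T" "U \<in> paths m n" "U \<noteq> T"
  shows "act gen_on_path a (bas U) = 0"
proof -
  obtain b where "cls a = cls b" "\<forall>U\<in>paths m n. U \<noteq> T \<longrightarrow> act gen_on_path b (bas U) = 0"
    using assms(1) unfolding column_def by blast
  then show ?thesis using cls_eqD[of a b U] assms by simp
qed

lemma column_submodule: "submodule (column T) H RM"
proof (rule submodule_RMI)
  show "column T \<subseteq> cls ` FA n" by (auto simp: column_def)
  show "cls 0 \<in> column T" by (rule column_memI) auto
  show "cls (a + b) \<in> column T" if "a \<in> FA n" "b \<in> FA n" "cls a \<in> column T" "cls b \<in> column T" for a b
    using that by (intro column_memI) (auto simp: column_memD)
  show "cls (a * b) \<in> column T" if "a \<in> FA n" "b \<in> FA n" "cls b \<in> column T" for a b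
    using that by (intro column_memI) (auto simp: column_memD)
qed

lemma column_simple:
  assumes T: "T \<in> paths m n"
  shows "simple_module H (RM\<lparr>carrier := column T\<rparr>)"
  unfolding simple_module_def
proof (intro conjI allI impI)
  show lm: "left_module H (RM\<lparr>carrier := column T\<rparr>)"
    by (rule left_module.submodule_left_module[OF left_module_RM column_submodule])
  have ET: "cls (E T T) \<in> column T"
    by (rule column_memI) (use E_FA act_E_bas self_pair T in auto)
  have "cls (E T T) \<noteq> cls 0"
  proof
    assume "cls (E T T) = cls 0"
    from cls_eqD[OF this T] have "bas T = (0 :: mnode list \<Rightarrow>\<^sub>0 'k)"
      using act_E_bas[OF self_pair[OF T] T] by simp
    then show False by (metis lookup_single_eq lookup_zero one_neq_zero)
  qed
  then show "carrier (RM\<lparr>carrier := column T\<rparr>) \<noteq> {\<zero>\<^bsub>RM\<lparr>carrier := column T\<rparr>\<^esub>}"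
    using ET by (auto simp: RM_simps)
  fix N assume N: "submodule N H (RM\<lparr>carrier := column T\<rparr>)"
  note ND = left_module.submoduleD[OF lm N]
  have Nsub: "N \<subseteq> column T" using ND(1) by simp
  show "N = {\<zero>\<^bsub>RM\<lparr>carrier := column T\<rparr>\<^esub>} \<or> N = carrier (RM\<lparr>carrier := column T\<rparr>)"
  proof (cases "N = {cls 0}")
    case False
    have "cls 0 \<in> N" using ND(2) by (simp add: RM_simps)
    with False obtain x where x: "x \<in> N" "x \<noteq> cls 0" by blast
    then obtain a where a: "x = cls a" "a \<in> FA n" using Nsub unfolding column_def by blast
    have acol: "act gen_on_path a (bas U) = 0" if "U \<in> paths m n" "U \<noteq> T" for U
      using column_memD[of a T U] x a Nsub that by blast
    have "a \<notin> I" using x a by (simp add: cls_eq_iff)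
    then have "act gen_on_path a (bas T) \<noteq> 0" using kills_paths_iff_ideal[OF a(2)] acol by metis
    then obtain S where S: "Poly_Mapping.lookup (act gen_on_path a (bas T)) S \<noteq> 0"
      by (metis lookup_zero poly_mapping_eqI)
    define c where "c = Poly_Mapping.lookup (act gen_on_path a (bas T)) S"
    have sup: "act gen_on_path a (bas T) \<in> supported (paths_to m (set T))"
      by (rule act_shape[OF a(2) _ T]) (use T in \<open>auto simp: paths_to_def paths_def\<close>)
    have Sp: "S \<in> paths_to m (set T)" using S sup by (auto simp: in_keys_iff)
    note pairs = paths_to_shape_pair[OF T Sp]
    have supp: "act gen_on_path a (bas T) \<in> supported (paths m n)"
      using path_action_closed[OF a(2) _ n_pos, of "bas T"] T by simp
    have "column T \<subseteq> N"
    proof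
      fix y assume y: "y \<in> column T"
      then obtain b where b: "y = cls b" "b \<in> FA n" unfolding column_def by blast
      \<comment> \<open>\<open>E T S\<close> divided by the nonzero entry \<open>c\<close> moves
        column \<open>T\<close> of \<open>a\<close> back to the basis vector of \<open>T\<close>, to
        which \<open>b\<close> is then applied.\<close>
      let ?d = "b * scale (1 / c) (E T S)"
      have d: "?d \<in> FA n" using b E_FA[OF pairs(2)] by auto
      have "cls b = cls (?d * a)"
      proof (rule cls_eqI)
        fix U assume U: "U \<in> paths m n"
        show "act gen_on_path b (bas U) = act gen_on_path (?d * a) (bas U)"
        proof (cases "U = T")
          case True
          then show ?thesis using act_E[OF pairs(2) supp] S by (simp add: c_def)
        next
          case False
          then show ?thesis using column_memD[of b T U] y b U acol[OF U False] by simp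
        qed
      qed (fact b(2), rule FA_mult[OF d a(2)])
      then have "y = cls ?d \<otimes>\<^bsub>H\<^esub> x" using b a d by (simp add: cls_ops)
      moreover have "cls ?d \<in> carrier H" using d by (simp add: cls_ops)
      ultimately show "y \<in> N" using ND(4)[of "cls ?d" x] x(1) by (simp add: RM_simps)
    qed
    then show ?thesis using Nsub by auto
  qed (simp add: RM_simps)
qed

text \<open>The diagonal units add up to the identity on paths, hence to 1 in the Hecke algebra by
  faithfulness.\<close>

lemma sum_diagonal_units:
  assumes "a \<in> FA n"
  shows "cls a = cls (\<Sum>T\<in>paths m n. a * E T T)"
proof (rule cls_eqI[OF assms])
  show sumFA: "(\<Sum>T\<in>paths m n. a * E T T) \<in> FA n" using assms E_FA self_pair by auto
  fix U assume U: "U \<in> paths m n"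
  have "act gen_on_path (\<Sum>T\<in>paths m n. a * E T T) (bas U) = (\<Sum>T\<in>paths m n. act gen_on_path (a * E T T) (bas U))"
    by (rule PMP.linear_sum[OF lin_act_left])
  also have "\<dots> = (\<Sum>T\<in>paths m n. if T = U then act gen_on_path a (bas U) else 0)"
    by (rule sum.cong[OF refl]) (use U act_E_bas self_pair in auto)
  also have "\<dots> = act gen_on_path a (bas U)" using U paths_finite by simp
  finally show "act gen_on_path a (bas U) = act gen_on_path (\<Sum>T\<in>paths m n. a * E T T) (bas U)" by simp
qed

lemma semisimple_H: "semisimple_ring H"
  unfolding semisimple_ring_def semisimple_module_def
proof (intro conjI exI[of _ "column ` paths m n"])
  show "left_module H RM" by (rule left_module_RM)
  show "\<forall>S\<in>column ` paths m n. submodule S H RM \<and> simple_module H (RM\<lparr>carrier := S\<rparr>)"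
    using column_submodule column_simple by blast
  show "submodule_generated H RM (\<Union>(column ` paths m n)) = carrier RM"
  proof (rule equalityI)
    show "submodule_generated H RM (\<Union>(column ` paths m n)) \<subseteq> carrier RM"
      by (rule submodule_generated_subset[OF left_module.carrier_submodule[OF left_module_RM]])
         (auto simp: column_def RM_simps)
    show "carrier RM \<subseteq> submodule_generated H RM (\<Union>(column ` paths m n))"
      unfolding submodule_generated_def
    proof (rule Inter_greatest, clarify)
      fix N x assume N: "submodule N H RM" "\<Union>(column ` paths m n) \<subseteq> N" and x: "x \<in> carrier RM"
      note ND = left_module.submoduleD[OF left_module_RM N(1)]
      obtain a where a: "x = cls a" "a \<in> FA n" using x by (auto simp: RM_simps)
      have aE: "a * E T T \<in> FA n" "cls (a * E T T) \<in> N" if "T \<in> paths m n" for T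
      proof -
        show *: "a * E T T \<in> FA n" using a E_FA self_pair that by auto
        have "cls (a * E T T) \<in> column T"
          by (rule column_memI[OF *]) (use act_E_bas self_pair that in auto)
        then show "cls (a * E T T) \<in> N" using N(2) that by blast
      qed
      have "cls (\<Sum>T\<in>Q. a * E T T) \<in> N \<and> (\<Sum>T\<in>Q. a * E T T) \<in> FA n" if "finite Q" "Q \<subseteq> paths m n" for Q
        using that
      proof (induction Q)
        case empty
        then show ?case using ND(2) by (simp add: RM_simps)
      next
        case (insert T Q)
        then have *: "T \<in> paths m n" "cls (\<Sum>T\<in>Q. a * E T T) \<in> N" "(\<Sum>T\<in>Q. a * E T T) \<in> FA n" by auto
        then show ?case using ND(3)[OF aE(2)[OF *(1)] *(2)] aE[OF *(1)] insert.hyps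
          by (simp add: RM_simps cls_ops)
      qed
      then show "x \<in> N" using sum_diagonal_units[OF a(2)] a(1) paths_finite by auto
    qed
  qed
  show "\<forall>S\<in>column ` paths m n. S \<inter> submodule_generated H RM (\<Union>(column ` paths m n - {S})) = {\<zero>\<^bsub>RM\<^esub>}"
  proof
    fix C assume "C \<in> column ` paths m n"
    then obtain T where T: "T \<in> paths m n" "C = column T" by blast
    \<comment> \<open>A left ideal that contains all other columns; an element of it in column
      \<open>T\<close> kills every path and is therefore 0.\<close>
    let ?Z = "{cls a | a. a \<in> FA n \<and> act gen_on_path a (bas T) = 0}"
    have Zmem: "act gen_on_path a (bas T) = 0" if a: "cls a \<in> ?Z" for a
    proof -
      obtain b where "cls a = cls b" "act gen_on_path b (bas T) = 0" using a by blast
      then show ?thesis using cls_eqD[of a b T] T(1) by simp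
    qed
    have ZI: "cls a \<in> ?Z" if "a \<in> FA n" "act gen_on_path a (bas T) = 0" for a using that by blast
    have Z: "submodule ?Z H RM"
    proof (rule submodule_RMI)
      show "cls (a + b) \<in> ?Z" if "a \<in> FA n" "b \<in> FA n" "cls a \<in> ?Z" "cls b \<in> ?Z" for a b
        by (rule ZI) (use that(1,2) Zmem[OF that(3)] Zmem[OF that(4)] in simp_all)
      show "cls (a * b) \<in> ?Z" if "a \<in> FA n" "b \<in> FA n" "cls b \<in> ?Z" for a b
        by (rule ZI) (use that(1,2) Zmem[OF that(3)] in simp_all)
      show "cls 0 \<in> ?Z" by (rule ZI) simp_all
    qed auto
    have "\<Union>(column ` paths m n - {C}) \<subseteq> ?Z"
    proof clarify
      fix x U assume U: "U \<in> paths m n" "column U \<noteq> C" "x \<in> column U"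
      then obtain a where "x = cls a" "a \<in> FA n" unfolding column_def by blast
      moreover have "act gen_on_path a (bas T) = 0" using column_memD[of a U T] U T calculation by metis
      ultimately show "\<exists>a. x = cls a \<and> a \<in> FA n \<and> act gen_on_path a (bas T) = 0" by blast
    qed
    from submodule_generated_subset[OF Z this]
    have gen: "submodule_generated H RM (\<Union>(column ` paths m n - {C})) \<subseteq> ?Z" .
    have "x = cls 0" if x: "x \<in> C" "x \<in> ?Z" for x
    proof -
      obtain a where a: "x = cls a" "a \<in> FA n" "act gen_on_path a (bas T) = 0" using x(2) by blast
      then have "\<forall>U\<in>paths m n. act gen_on_path a (bas U) = 0" using column_memD[of a T] x(1) T(2) by metis
      then show ?thesis using kills_paths_iff_ideal[OF a(2)] a(1) by (simp add: cls_eq_iff)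
    qed
    moreover have "cls 0 \<in> C" using left_module.submoduleD(2)[OF left_module_RM column_submodule] T(2)
      by (simp add: RM_simps)
    moreover have "cls 0 \<in> submodule_generated H RM (\<Union>(column ` paths m n - {C}))"
      unfolding submodule_generated_def using left_module.submoduleD(2)[OF left_module_RM] by (auto simp: RM_simps)
    ultimately show "C \<inter> submodule_generated H RM (\<Union>(column ` paths m n - {C})) = {\<zero>\<^bsub>RM\<^esub>}"
      using gen unfolding RM_simps by blast
  qed
qed


section \<open>The dimension\<close>

abbreviation combination :: "(mnode list \<times> mnode list \<Rightarrow> 'k) \<Rightarrow> (mnode list \<times> mnode list) set \<Rightarrow> 'k falg" where
  "combination c Q \<equiv> (\<Sum>p\<in>Q. scale (c p) (E (fst p) (snd p)))"

lemma combination_FA: "Q \<subseteq> shape_pairs m n \<Longrightarrow> combination c Q \<in> FA n"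
  by (intro FA_sum FA_closed(8) E_FA) auto

lemma lookup_combination:
  assumes Q: "Q \<subseteq> shape_pairs m n" and T: "T \<in> paths m n"
  shows "Poly_Mapping.lookup (act gen_on_path (combination c Q) (bas T)) S = (if (S, T) \<in> Q then c (S, T) else 0)"
proof -
  have fin: "finite Q" using Q finite_shape_pairs finite_subset by blast
  have "act gen_on_path (combination c Q) (bas T) = (\<Sum>p\<in>Q. act gen_on_path (scale (c p) (E (fst p) (snd p))) (bas T))"
    by (rule PMP.linear_sum[OF lin_act_left])
  also have "Poly_Mapping.lookup \<dots> S = (\<Sum>p\<in>Q. if p = (S, T) then c p else 0)"
    unfolding lookup_sum
  proof (rule sum.cong[OF refl])
    fix p assume "p \<in> Q"
    then have "(fst p, snd p) \<in> shape_pairs m n" using Q by auto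
    then show "Poly_Mapping.lookup (act gen_on_path (scale (c p) (E (fst p) (snd p))) (bas T)) S = (if p = (S, T) then c p else 0)"
      using T by (cases p) (auto simp: act_E_bas lookup_single when_def)
  qed
  finally show ?thesis using fin by simp
qed

lemma hecke_scalars_eq: "hecke_scalars m n q v = {cls (const c) | c. True}"
  by (simp add: hecke_scalars_def cls_def)

text \<open>Adding one matrix unit at a time extends the span by a line: the matrix entry of the new
  unit at its own pair is 1, whereas it is 0 for all previous combinations.\<close>

lemma dimension_combinations:
  assumes "finite Q" "Q \<subseteq> shape_pairs m n"
  shows "ring.dimension H (card Q) (hecke_scalars m n q v) {cls (combination c Q) | c. True}"
  using assms
proof (induction Q)
  case empty
  have "{cls (combination c {}) | c. True} = {\<zero>\<^bsub>H\<^esub>}" by (auto simp: zero_H)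
  then show ?case using ring.zero_dim[OF ring_H] by simp
next
  case (insert p Q)
  obtain S T where p: "p = (S, T)" by (cases p)
  have pair: "(S, T) \<in> shape_pairs m n" and Q: "Q \<subseteq> shape_pairs m n" using insert.prems p by auto
  then have T: "T \<in> paths m n" by (simp add: shape_pairs_def)
  note IH = insert.IH[OF Q]
  let ?v = "cls (E S T)" and ?B = "{cls (combination c Q) | c. True}"
  have v: "?v \<in> carrier H" using E_FA[OF pair] by (simp add: cls_ops)
  have "?v \<notin> ?B"
  proof
    assume "?v \<in> ?B"
    then obtain c where "cls (E S T) = cls (combination c Q)" by blast
    from cls_eqD[OF this T] have "Poly_Mapping.lookup (bas S) S = Poly_Mapping.lookup (act gen_on_path (combination c Q) (bas T)) S"
      using act_E_bas[OF pair T] by simp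
    then show False using lookup_combination[OF Q T, of c S] insert.hyps p by simp
  qed
  from ring.Suc_dim[OF ring_H v this IH]
  have "ring.dimension H (Suc (card Q)) (hecke_scalars m n q v) (ring.line_extension H (hecke_scalars m n q v) ?v ?B)" .
  moreover have "ring.line_extension H (hecke_scalars m n q v) ?v ?B = {cls (combination c (insert p Q)) | c. True}"
  proof -
    have eq: "cls (const k) \<otimes>\<^bsub>H\<^esub> ?v \<oplus>\<^bsub>H\<^esub> cls (combination c Q) = cls (scale k (E S T) + combination c Q)" for k c
      using E_FA[OF pair] combination_FA[OF Q, of c] by (simp add: cls_ops scale_eq_const_mult)
    have upd: "combination (c(p := k)) (insert p Q) = scale k (E S T) + combination c Q" for c k
      using insert.hyps p by (auto intro!: sum.cong)
    show ?thesis
    proof (intro equalityI subsetI)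
      fix x assume "x \<in> ring.line_extension H (hecke_scalars m n q v) ?v ?B"
      then obtain k c where "x = cls (const k) \<otimes>\<^bsub>H\<^esub> ?v \<oplus>\<^bsub>H\<^esub> cls (combination c Q)"
        unfolding ring.line_extension_mem_iff[OF ring_H] hecke_scalars_eq by blast
      then have "x = cls (combination (c(p := k)) (insert p Q))" unfolding eq upd .
      then show "x \<in> {cls (combination c (insert p Q)) | c. True}" by blast
    next
      fix x assume "x \<in> {cls (combination c (insert p Q)) | c. True}"
      then obtain c where "x = cls (combination c (insert p Q))" by blast
      then have "x = cls (combination (c(p := c p)) (insert p Q))" by simp
      then have "x = cls (const (c p)) \<otimes>\<^bsub>H\<^esub> ?v \<oplus>\<^bsub>H\<^esub> cls (combination c Q)" unfolding eq upd .
      then show "x \<in> ring.line_extension H (hecke_scalars m n q v) ?v ?B"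
        unfolding ring.line_extension_mem_iff[OF ring_H] hecke_scalars_eq by blast
    qed
  qed
  ultimately show ?case using insert.hyps by simp
qed

lemma dimension_H: "ring.dimension H (fact n * m ^ n) (hecke_scalars m n q v) (carrier H)"
proof -
  let ?P = "shape_pairs m n"
  have "carrier H = {cls (combination c ?P) | c. True}"
  proof (intro equalityI subsetI)
    fix x assume "x \<in> carrier H"
    then obtain a where a: "x = cls a" "a \<in> FA n" by (auto simp: cls_ops)
    \<comment> \<open>The coefficients are the matrix entries; entries at pairs of different shape
      vanish, since the action preserves shapes.\<close>
    define c where "c p = Poly_Mapping.lookup (act gen_on_path a (bas (snd p))) (fst p)" for p
    have "cls a = cls (combination c ?P)"
    proof (rule cls_eqI[OF a(2) combination_FA[OF order_refl]], rule poly_mapping_eqI)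
      fix U S assume U: "U \<in> paths m n"
      have "Poly_Mapping.lookup (act gen_on_path a (bas U)) S = 0" if "(S, U) \<notin> ?P"
      proof -
        have "act gen_on_path a (bas U) \<in> supported (paths_to m (set U))"
          by (rule act_shape[OF a(2) _ U]) (use U in \<open>auto simp: paths_to_def paths_def\<close>)
        then have "S \<notin> Poly_Mapping.keys (act gen_on_path a (bas U))" using that paths_to_shape_pair(1)[OF U] by blast
        then show ?thesis by (simp add: in_keys_iff)
      qed
      then show "Poly_Mapping.lookup (act gen_on_path a (bas U)) S = Poly_Mapping.lookup (act gen_on_path (combination c ?P) (bas U)) S"
        unfolding lookup_combination[OF order_refl U] by (simp add: c_def)
    qed
    then show "x \<in> {cls (combination c ?P) | c. True}" using a(1) by blast
  qed (auto simp: cls_ops intro: combination_FA)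
  then show ?thesis using dimension_combinations[OF finite_shape_pairs order_refl] by (simp add: card_shape_pairs)
qed


section \<open>The simple modules\<close>

lemma V_module_simps:
  "carrier (V_module n q v lam) = supported (standard_tableaux n lam)" "add (V_module n q v lam) = (+)"
  by (simp_all add: V_module_def)

text \<open>The coset acts through any representative because the ideal acts by 0; this is known on
  paths and is carried back along \<open>to_paths lam\<close>.\<close>

lemma V_module_smult:
  assumes lam: "lam \<in> mpartitions m n" and a: "a \<in> FA n" and f: "f \<in> supported (standard_tableaux n lam)"
  shows "cls a \<odot>\<^bsub>V_module n q v lam\<^esub> f = free_action n q v lam a f"
proof -
  have "free_action n q v lam b f = free_action n q v lam a f" if "b \<in> cls a" for b
  proof -
    obtain i where i: "i \<in> I" "b = i + a" using \<open>b \<in> cls a\<close> by (auto simp: cls_mem)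
    then have iFA: "i \<in> FA n" using hecke_ideal_subset by blast
    note b = bij_to_paths[OF lam]
    have "to_paths lam f \<in> supported (paths_to m (mnodes lam))" using bij_betwE[OF b] f by blast
    moreover have "paths_to m (mnodes lam) \<subseteq> paths m n"
      using paths_to_subset[of m "mnodes lam"] mnodes_diagram(2)[OF lam] by simp
    ultimately have "act gen_on_path i (to_paths lam f) = 0" using hecke_ideal_kills_paths[OF i(1)] by blast
    then have "to_paths lam (free_action n q v lam i f) = to_paths lam 0"
      using free_action_to_paths(2)[OF lam iFA f] PMP.linear_0[OF lin_to_paths] by simp
    then have "free_action n q v lam i f = 0"
      using bij_betw_imp_inj_on[OF b] free_action_to_paths(1)[OF lam iFA f] by (auto dest!: inj_onD)
    then show ?thesis by (simp add: i(2) free_action_eq_act)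
  qed
  moreover have "a \<in> cls a" using hecke_ideal_closed(1) by (force simp: cls_mem)
  ultimately have "(THE g. \<forall>b\<in>cls a. free_action n q v lam b f = g) = free_action n q v lam a f"
    by (intro the_equality) (blast, metis)
  then show ?thesis by (simp add: V_module_def)
qed

text \<open>The element whose matrix has the vector \<open>F\<close> in column \<open>T\<close> and
  zeros elsewhere, provided that \<open>F\<close> is supported on paths of the shape of
  \<open>T\<close>.\<close>

definition row_element :: "mnode list \<Rightarrow> (mnode list \<Rightarrow>\<^sub>0 'k) \<Rightarrow> 'k falg" where
  "row_element T = linear_extension (\<lambda>S. E S T)"

lemma lin_row_element: "lin (row_element T)"
  unfolding row_element_def by (rule lin_linear_extension)

lemma row_element_FA:
  assumes "T \<in> paths m n" "F \<in> supported (paths_to m (set T))"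
  shows "row_element T F \<in> FA n"
  unfolding row_element_def FA_eq_supported
  by (rule linear_extension_supported, unfold FA_eq_supported[symmetric])
     (use assms in \<open>auto intro!: E_FA paths_to_shape_pair(1)[OF assms(1)]\<close>)

lemma act_row_element:
  assumes T: "T \<in> paths m n" and F: "F \<in> supported (paths_to m (set T))" and U: "U \<in> paths m n"
  shows "act gen_on_path (row_element T F) (bas U) = (if U = T then F else 0)"
proof (rule lin_eq_on[where B = "paths_to m (set T)" and f = F])
  show "lin (\<lambda>F. act gen_on_path (row_element T F) (bas U))" by (rule lin_compose[OF lin_act_left lin_row_element])
  show "lin (\<lambda>F. if U = T then F else 0)" by (rule linI) auto
  show "act gen_on_path (row_element T (bas S)) (bas U) = (if U = T then bas S else 0)" if "S \<in> paths_to m (set T)" for S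
    using act_E_bas[OF paths_to_shape_pair(1)[OF T that] U] by (simp add: row_element_def)
qed (use F in auto)

text \<open>A vector fixed by some diagonal unit \<open>E T T\<close> generates an image of column
  \<open>T\<close>, that is, of the module on the paths with the node set of \<open>T\<close>. This
  set is the shape \<open>lam\<close>.\<close>

lemma simple_module_isomorphic:
  fixes W :: "('k falg set, 'w) module"
  assumes W: "simple_module H W"
  shows "\<exists>lam\<in>mpartitions m n. module_isomorphic H W (V_module n q v lam)"
proof -
  interpret W: left_module H W using W by (simp add: simple_module_def)
  have cH: "cls a \<in> carrier H" if "a \<in> FA n" for a using that by (simp add: cls_ops)
  have smc: "cls a \<odot>\<^bsub>W\<^esub> x \<in> carrier W" if "a \<in> FA n" "x \<in> carrier W" for a x
    by (rule W.smult_closed[OF cH that(2)]) (rule that)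
  have sadd: "cls (a + b) \<odot>\<^bsub>W\<^esub> x = cls a \<odot>\<^bsub>W\<^esub> x \<oplus>\<^bsub>W\<^esub> cls b \<odot>\<^bsub>W\<^esub> x"
    if "a \<in> FA n" "b \<in> FA n" "x \<in> carrier W" for a b x
    using W.smult_l_distr[OF cH cH, of a b x] that by (simp add: cls_ops)
  have smult: "cls (a * b) \<odot>\<^bsub>W\<^esub> x = cls a \<odot>\<^bsub>W\<^esub> (cls b \<odot>\<^bsub>W\<^esub> x)"
    if "a \<in> FA n" "b \<in> FA n" "x \<in> carrier W" for a b x
    using W.smult_assoc1[OF cH cH, of a b x] that by (simp add: cls_ops)
  have s0: "cls 0 \<odot>\<^bsub>W\<^esub> x = \<zero>\<^bsub>W\<^esub>" if "x \<in> carrier W" for x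
    using W.smult_zero_left[OF that] by (simp add: zero_H)
  have s1: "cls 1 \<odot>\<^bsub>W\<^esub> x = x" if "x \<in> carrier W" for x
    using W.smult_one[OF that] by (simp add: cls_ops)
  have r0: "cls a \<odot>\<^bsub>W\<^esub> \<zero>\<^bsub>W\<^esub> = \<zero>\<^bsub>W\<^esub>" if "a \<in> FA n" for a
    using smult[OF that, of 0 "\<zero>\<^bsub>W\<^esub>"] s0[of "\<zero>\<^bsub>W\<^esub>"] by simp
  have "carrier W \<noteq> {\<zero>\<^bsub>W\<^esub>}" using W by (simp add: simple_module_def)
  then obtain w where w: "w \<in> carrier W" "w \<noteq> \<zero>\<^bsub>W\<^esub>" using W.M.zero_closed by blast
  \<comment> \<open>Otherwise 1, the sum of these units, would annihilate \<open>w\<close>.\<close>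
  have "\<exists>T\<in>paths m n. cls (E T T) \<odot>\<^bsub>W\<^esub> w \<noteq> \<zero>\<^bsub>W\<^esub>"
  proof (rule ccontr)
    assume "\<not> ?thesis"
    then have z: "cls (E T T) \<odot>\<^bsub>W\<^esub> w = \<zero>\<^bsub>W\<^esub>" if "T \<in> paths m n" for T using that by blast
    have "cls (\<Sum>T\<in>Q. 1 * E T T) \<odot>\<^bsub>W\<^esub> w = \<zero>\<^bsub>W\<^esub> \<and> (\<Sum>T\<in>Q. 1 * E T T) \<in> FA n"
      if "finite Q" "Q \<subseteq> paths m n" for Q
      using that
    proof (induction Q)
      case empty
      then show ?case using s0 w(1) by simp
    next
      case (insert T Q)
      then show ?case using z[of T] sadd[of "E T T" "\<Sum>T\<in>Q. E T T" w] w(1) E_FA[OF self_pair, of T] by simp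
    qed
    then have "cls (\<Sum>T\<in>paths m n. 1 * E T T) \<odot>\<^bsub>W\<^esub> w = \<zero>\<^bsub>W\<^esub>" using paths_finite by blast
    then show False using sum_diagonal_units[of 1] s1[OF w(1)] w(2) by simp
  qed
  then obtain T where T: "T \<in> paths m n" "cls (E T T) \<odot>\<^bsub>W\<^esub> w \<noteq> \<zero>\<^bsub>W\<^esub>" by blast
  note ETT = E_FA[OF self_pair[OF T(1)]]
  define w' where "w' = cls (E T T) \<odot>\<^bsub>W\<^esub> w"
  have w': "w' \<in> carrier W" "w' \<noteq> \<zero>\<^bsub>W\<^esub>" using smc[OF ETT w(1)] T(2) by (auto simp: w'_def)
  have Ew': "cls (E T T) \<odot>\<^bsub>W\<^esub> w' = w'"
  proof -
    have "cls (E T T * E T T) = cls (E T T)"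
      by (rule cls_eqI) (use ETT act_E_bas[OF self_pair[OF T(1)]] T(1) in auto)
    then show ?thesis unfolding w'_def using smult[OF ETT ETT w(1)] by simp
  qed
  define PV where "PV = (supported (paths_to m (set T)) :: (mnode list \<Rightarrow>\<^sub>0 'k) set)"
  have sub: "PM.subspace PV" unfolding PV_def by (rule subspace_supported)
  define \<phi> where "\<phi> F = cls (row_element T F) \<odot>\<^bsub>W\<^esub> w'" for F
  have rFA: "row_element T F \<in> FA n" if "F \<in> PV" for F using row_element_FA[OF T(1)] that by (simp add: PV_def)
  have \<phi>c: "\<phi> F \<in> carrier W" if "F \<in> PV" for F unfolding \<phi>_def by (rule smc[OF rFA[OF that] w'(1)])
  have \<phi>add: "\<phi> (F + G) = \<phi> F \<oplus>\<^bsub>W\<^esub> \<phi> G" if "F \<in> PV" "G \<in> PV" for F G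
    unfolding \<phi>_def PMP.linear_add[OF lin_row_element] by (rule sadd[OF rFA rFA w'(1)]) (use that in auto)
  have closed: "act gen_on_path a F \<in> PV" if "a \<in> FA n" "F \<in> PV" for a F
    using act_shape[OF that(1) _ T(1)] that(2) by (simp add: PV_def)
  have \<phi>act: "\<phi> (act gen_on_path a F) = cls a \<odot>\<^bsub>W\<^esub> \<phi> F" if aF: "a \<in> FA n" "F \<in> PV" for a F
  proof -
    have "cls (row_element T (act gen_on_path a F)) = cls (a * row_element T F)"
    proof (rule cls_eqI[OF rFA[OF closed[OF aF]]])
      show "a * row_element T F \<in> FA n" using aF rFA by auto
      show "act gen_on_path (row_element T (act gen_on_path a F)) (bas U) = act gen_on_path (a * row_element T F) (bas U)"
        if "U \<in> paths m n" for U
        using act_row_element[OF T(1) _ that, of F] act_row_element[OF T(1) _ that, of "act gen_on_path a F"] closed[OF aF] aF(2)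
        by (simp add: PV_def)
    qed
    then show ?thesis unfolding \<phi>_def using smult[OF aF(1) rFA[OF aF(2)] w'(1)] by simp
  qed
  \<comment> \<open>From a nonzero entry of \<open>F\<close> at \<open>S\<close>, a multiple of
    \<open>E T S\<close> produces \<open>bas T\<close>, whose image is \<open>w'\<close>; so the
    kernel is trivial without appeal to irreducibility of the source.\<close>
  have \<phi>zero: "F = 0" if F: "F \<in> PV" "\<phi> F = \<zero>\<^bsub>W\<^esub>" for F
  proof (rule ccontr)
    assume "F \<noteq> 0"
    then obtain S where S: "Poly_Mapping.lookup F S \<noteq> 0" by (metis lookup_zero poly_mapping_eqI)
    define c where "c = Poly_Mapping.lookup F S"
    have "S \<in> paths_to m (set T)" using F(1) S by (auto simp: PV_def in_keys_iff)
    note pairs = paths_to_shape_pair[OF T(1) this]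
    let ?e = "scale (1 / c) (E T S)"
    have eFA: "?e \<in> FA n" using E_FA[OF pairs(2)] by auto
    have "paths_to m (set T) \<subseteq> paths m n" using paths_to_shape_pair(3)[OF T(1)] by blast
    then have "F \<in> supported (paths m n)" using F(1) by (auto simp: PV_def)
    then have "act gen_on_path ?e F = bas T" using act_E[OF pairs(2), of F] S by (simp add: c_def)
    then have "\<phi> (bas T) = cls ?e \<odot>\<^bsub>W\<^esub> \<phi> F" using \<phi>act[OF eFA F(1)] by simp
    then have "\<phi> (bas T) = \<zero>\<^bsub>W\<^esub>" using F(2) r0[OF eFA] by simp
    then show False using Ew' w'(2) by (simp add: \<phi>_def row_element_def)
  qed
  have inj: "inj_on \<phi> PV"
  proof (rule inj_onI)
    fix F G assume FG: "F \<in> PV" "G \<in> PV" "\<phi> F = \<phi> G"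
    have D: "F - G \<in> PV" by (rule PM.subspace_diff[OF sub FG(1,2)])
    have "\<phi> (F - G) \<oplus>\<^bsub>W\<^esub> \<phi> G = \<phi> G" using \<phi>add[OF D FG(2)] FG(3) by simp
    then have "\<phi> (F - G) = \<zero>\<^bsub>W\<^esub>"
      using \<phi>c[OF D] \<phi>c[OF FG(2)] by (metis W.M.add.r_cancel_one')
    then show "F = G" using \<phi>zero[OF D] by simp
  qed
  have "submodule (\<phi> ` PV) H W"
  proof (rule W.submoduleI)
    show "\<phi> ` PV \<subseteq> carrier W" using \<phi>c by blast
    have "\<phi> 0 = \<zero>\<^bsub>W\<^esub>" using s0[OF w'(1)] by (simp add: \<phi>_def PMP.linear_0[OF lin_row_element])
    then show "\<zero>\<^bsub>W\<^esub> \<in> \<phi> ` PV" using PM.subspace_0[OF sub] by (metis imageI)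
    show "x \<oplus>\<^bsub>W\<^esub> y \<in> \<phi> ` PV" if xy: "x \<in> \<phi> ` PV" "y \<in> \<phi> ` PV" for x y
    proof -
      obtain F G where "F \<in> PV" "x = \<phi> F" "G \<in> PV" "y = \<phi> G" using xy by blast
      then show ?thesis using \<phi>add[of F G] PM.subspace_add[OF sub, of F G] by (metis imageI)
    qed
    show "a \<odot>\<^bsub>W\<^esub> x \<in> \<phi> ` PV" if ax: "a \<in> carrier H" "x \<in> \<phi> ` PV" for a x
    proof -
      obtain b F where "a = cls b" "b \<in> FA n" "F \<in> PV" "x = \<phi> F" using ax unfolding cls_ops by blast
      then show ?thesis using \<phi>act[of b F] closed[of b F] by (metis imageI)
    qed
  qed
  moreover have bT: "bas T \<in> PV" using T(1) by (auto simp: PV_def paths_to_def paths_def)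
  then have "\<phi> ` PV \<noteq> {\<zero>\<^bsub>W\<^esub>}" using Ew' w'(2) by (force simp: \<phi>_def row_element_def)
  ultimately have surj: "\<phi> ` PV = carrier W" using W by (auto simp: simple_module_def)
  have "diagram m (set T)" "card (set T) = n"
    using T(1) by (auto simp: paths_def path_diagram path_distinct distinct_card)
  then obtain lam where lam: "lam \<in> mpartitions m n" "mnodes lam = set T" using diagram_is_mnodes by blast
  let ?V = "V_module n q v lam"
  have bijt: "bij_betw (to_paths lam) (carrier ?V) PV"
    using bij_to_paths[OF lam(1)] by (simp add: V_module_simps PV_def lam(2))
  have "module_isomorphic H W ?V"
  proof (rule module_isomorphicI[where g = "\<lambda>f. \<phi> (to_paths lam f)"])
    show "bij_betw (\<lambda>f. \<phi> (to_paths lam f)) (carrier ?V) (carrier W)"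
      using bij_betw_trans[OF bijt, of \<phi> "carrier W"] inj surj by (simp add: bij_betw_def comp_def)
    fix f assume f: "f \<in> carrier ?V"
    have tf: "to_paths lam f \<in> PV" using bij_betwE[OF bijt] f by blast
    show "f \<oplus>\<^bsub>?V\<^esub> g \<in> carrier ?V \<and> \<phi> (to_paths lam (f \<oplus>\<^bsub>?V\<^esub> g)) = \<phi> (to_paths lam f) \<oplus>\<^bsub>W\<^esub> \<phi> (to_paths lam g)"
      if g: "g \<in> carrier ?V" for g
    proof
      have tg: "to_paths lam g \<in> PV" using bij_betwE[OF bijt] g by blast
      show "f \<oplus>\<^bsub>?V\<^esub> g \<in> carrier ?V"
        using PM.subspace_add[OF subspace_supported] f g unfolding V_module_simps by blast
      show "\<phi> (to_paths lam (f \<oplus>\<^bsub>?V\<^esub> g)) = \<phi> (to_paths lam f) \<oplus>\<^bsub>W\<^esub> \<phi> (to_paths lam g)"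
        unfolding V_module_simps PMP.linear_add[OF lin_to_paths] by (rule \<phi>add[OF tf tg])
    qed
    show "a \<odot>\<^bsub>?V\<^esub> f \<in> carrier ?V \<and> \<phi> (to_paths lam (a \<odot>\<^bsub>?V\<^esub> f)) = a \<odot>\<^bsub>W\<^esub> \<phi> (to_paths lam f)"
      if "a \<in> carrier H" for a
    proof -
      obtain b where b: "a = cls b" "b \<in> FA n" using \<open>a \<in> carrier H\<close> by (auto simp: cls_ops)
      have f': "f \<in> supported (standard_tableaux n lam)" using f by (simp add: V_module_simps)
      show ?thesis
        using free_action_to_paths[OF lam(1) b(2) f'] \<phi>act[OF b(2) tf]
        unfolding b(1) V_module_smult[OF lam(1) b(2) f'] V_module_simps by simp
    qed
  qed
  with lam(1) show ?thesis by blast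
qed

end

theorem mainTheorem4:
  fixes m n :: nat and q :: "'k::field" and v :: "nat \<Rightarrow> 'k"
  assumes "m \<ge> 1" and "n \<ge> 1"
    and "generic_parameters m q v \<or> complex_parameters m n q v"
  shows "semisimple_ring (hecke_algebra m n q v)
    \<and> ring.dimension (hecke_algebra m n q v) (fact n * m ^ n)
        (hecke_scalars m n q v) (carrier (hecke_algebra m n q v))
    \<and> (\<forall>W :: ('k falg set, 'w) module. simple_module (hecke_algebra m n q v) W \<longrightarrow>
          (\<exists>lam\<in>mpartitions m n.
             module_isomorphic (hecke_algebra m n q v) W (V_module n q v lam)))"
proof -
  interpret hecke_parameters m n q v
    using assms generic_hecke_parameters complex_hecke_parameters by blast
  show ?thesis using semisimple_H dimension_H simple_module_isomorphic by blast
qed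

end
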